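(* Let $R$ be a noetherian normal integral domain with field of fractions $K$, let $L/K$ be a finite Galois extension, let $S$ be the normalization of $R$ in $L$, and let $\mathfrak p\in\operatorname{Spec}R$. Then the following statements are equivalent: (a) $S/R$ is tamely ramified over $\mathfrak p$. (b) $S/R$ is cohomologically tamely ramified over $\mathfrak p$. (c) $S/R$ is numerically tamely ramified over $\mathfrak p$.
   Context: The trace $\mathrm{Tr}_{L/K}$ restricts to an $R$-linear map $\mathrm{Tr}\colon S\to R$. Set $\mathfrak p^{\mathrm{Tr}}=\{s\in S\mid\mathrm{Tr}(sS)\subset\mathfrak p\}$. Tamely ramified over $\mathfrak p$: $\mathfrak p^{\mathrm{Tr}}=\sqrt{\mathfrak pS}$. Cohomologically tamely ramified over $\mathfrak p$: the localized trace $\mathrm{Tr}_{\mathfrak p}\colon S_{\mathfrak p}\to R_{\mathfrak p}$ is surjective. Numerically tamely ramified over $\mathfrak p$: $\operatorname{char}\kappa(\mathfrak p)\nmid e_{\mathfrak p}$, where $e_{\mathfrak p}=|I_{\mathfrak q}|$ is the ramification index: for a prime $\mathfrak q$ of $S$ over $\mathfrak p$ and $G=\operatorname{Gal}(L/K)$, $D_{\mathfrak q}=\{\sigma\in G\mid\sigma(\mathfrak q)=\mathfrak q\}$ and $I_{\mathfrak q}=\ker\big(D_{\mathfrak q}\to\operatorname{Aut}(\kappa(\mathfrak q)/\kappa(\mathfrak p))\big)$ (the order is independent of $\mathfrak q$; in residue characteristic $0$ the condition always holds). *)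

theory Defs
  imports "HOL-Algebra.Algebra"
begin

text \<open>
  All rings live inside one ambient field \<open>L\<close>: \<open>R \<subseteq> K \<subseteq> L\<close> and \<open>R \<subseteq> S \<subseteq> L\<close> are subsets of
  \<^term>\<open>carrier L\<close>, regarded as rings via \<^term>\<open>L\<lparr>carrier := R\<rparr>\<close>.  Localizations of \<open>R\<close> and \<open>S\<close>
  are likewise taken inside \<open>L\<close>, which is legitimate because \<open>L\<close> is a field.
\<close>

subsection \<open>Integral closure, fractions, residue fields\<close>

definition integral_over :: "('a, 'm) ring_scheme \<Rightarrow> 'a set \<Rightarrow> 'a \<Rightarrow> bool" where
  "integral_over L R x \<longleftrightarrow>
     (\<exists>f \<in> carrier (univ_poly L R). f \<noteq> [] \<and> lead_coeff f = \<one>\<^bsub>L\<^esub> \<and> ring.eval L f x = \<zero>\<^bsub>L\<^esub>)"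

definition integral_closure_in :: "('a, 'm) ring_scheme \<Rightarrow> 'a set \<Rightarrow> 'a set \<Rightarrow> 'a set" where
  "integral_closure_in L R E = {x \<in> E. integral_over L R x}"

definition fractions :: "('a, 'm) ring_scheme \<Rightarrow> 'a set \<Rightarrow> 'a set \<Rightarrow> 'a set" where
  "fractions L M T = {m \<otimes>\<^bsub>L\<^esub> inv\<^bsub>L\<^esub> t | m t. m \<in> M \<and> t \<in> T}"

definition fraction_field :: "('a, 'm) ring_scheme \<Rightarrow> 'a set \<Rightarrow> 'a set" where
  "fraction_field L R = fractions L R (R - {\<zero>\<^bsub>L\<^esub>})"

definition localization_at :: "('a, 'm) ring_scheme \<Rightarrow> 'a set \<Rightarrow> 'a set \<Rightarrow> 'a set" where
  "localization_at L R p = fractions L R (R - p)"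

definition residue_field :: "('a, 'm) ring_scheme \<Rightarrow> 'a set \<Rightarrow> 'a set \<Rightarrow> 'a set ring" where
  "residue_field L R p = (L\<lparr>carrier := localization_at L R p\<rparr>) Quot (fractions L p (R - p))"

text \<open>The additive order of \<open>1\<close>; \<^const>\<open>group.ord\<close> is \<open>0\<close> for elements of infinite order.\<close>

definition ring_characteristic :: "('a, 'm) ring_scheme \<Rightarrow> nat" where
  "ring_characteristic A = group.ord (add_monoid A) \<one>\<^bsub>A\<^esub>"

definition radical_of :: "('a, 'm) ring_scheme \<Rightarrow> 'a set \<Rightarrow> 'a set" where
  "radical_of A I = {x \<in> carrier A. \<exists>n::nat. x [^]\<^bsub>A\<^esub> n \<in> I}"


subsection \<open>Galois extensions and the trace\<close>

text \<open>As in \<^const>\<open>BijGroup\<close>, automorphisms are extensional functions on the carrier.\<close>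

definition aut_group :: "('a, 'm) ring_scheme \<Rightarrow> 'a set \<Rightarrow> ('a \<Rightarrow> 'a) monoid" where
  "aut_group A k = (BijGroup (carrier A))
     \<lparr>carrier := {\<sigma> \<in> Bij (carrier A) \<inter> ring_hom A A. \<forall>x \<in> k. \<sigma> x = x}\<rparr>"

definition finite_galois_extension :: "('a, 'm) ring_scheme \<Rightarrow> 'a set \<Rightarrow> bool" where
  "finite_galois_extension L K \<longleftrightarrow>
     field L \<and> subfield K L \<and> ring.finite_dimension L K (carrier L) \<and>
     {x \<in> carrier L. \<forall>\<sigma> \<in> carrier (aut_group L K). \<sigma> x = x} = K"

definition field_basis :: "('a, 'm) ring_scheme \<Rightarrow> 'a set \<Rightarrow> 'a list \<Rightarrow> bool" where
  "field_basis L K us \<longleftrightarrow> ring.independent L K us \<and> ring.Span L K us = carrier L"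

text \<open>
  The trace of the \<open>K\<close>-linear map given by multiplication by \<open>x\<close>; \<open>M\<close> is its matrix in the basis \<open>us\<close>.
\<close>

definition field_trace :: "('a, 'm) ring_scheme \<Rightarrow> 'a set \<Rightarrow> 'a \<Rightarrow> 'a" where
  "field_trace L K x = (THE t. \<exists>us (M :: nat \<Rightarrow> nat \<Rightarrow> 'a).
     field_basis L K us \<and>
     (\<forall>i < length us. \<forall>j < length us. M i j \<in> K) \<and>
     (\<forall>i < length us. x \<otimes>\<^bsub>L\<^esub> (us ! i) = ring.combine L (map (M i) [0..<length us]) us) \<and>
     t = (\<Oplus>\<^bsub>L\<^esub>i \<in> {..<length us}. M i i))"


subsection \<open>Tame ramification\<close>

definition trace_ideal :: "('a, 'm) ring_scheme \<Rightarrow> 'a set \<Rightarrow> 'a set \<Rightarrow> 'a set \<Rightarrow> 'a set" where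
  "trace_ideal L K S p = {s \<in> S. \<forall>t \<in> S. field_trace L K (s \<otimes>\<^bsub>L\<^esub> t) \<in> p}"

definition tamely_ramified :: "('a, 'm) ring_scheme \<Rightarrow> 'a set \<Rightarrow> 'a set \<Rightarrow> 'a set \<Rightarrow> bool" where
  "tamely_ramified L K S p \<longleftrightarrow>
     trace_ideal L K S p = radical_of (L\<lparr>carrier := S\<rparr>) (genideal (L\<lparr>carrier := S\<rparr>) p)"

text \<open>The map \<open>s / t \<mapsto> f s / t\<close> induced by an \<open>R\<close>-linear map \<open>f\<close> on \<open>M\<close>.\<close>

definition localized_map ::
    "('a, 'm) ring_scheme \<Rightarrow> 'a set \<Rightarrow> 'a set \<Rightarrow> ('a \<Rightarrow> 'a) \<Rightarrow> 'a \<Rightarrow> 'a" where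
  "localized_map L M T f x =
     (THE y. \<exists>m \<in> M. \<exists>t \<in> T. x = m \<otimes>\<^bsub>L\<^esub> inv\<^bsub>L\<^esub> t \<and> y = f m \<otimes>\<^bsub>L\<^esub> inv\<^bsub>L\<^esub> t)"

definition cohomologically_tamely_ramified ::
    "('a, 'm) ring_scheme \<Rightarrow> 'a set \<Rightarrow> 'a set \<Rightarrow> 'a set \<Rightarrow> 'a set \<Rightarrow> bool" where
  "cohomologically_tamely_ramified L K R S p \<longleftrightarrow>
     localized_map L S (R - p) (field_trace L K) ` fractions L S (R - p) = localization_at L R p"

definition primes_over ::
    "('a, 'm) ring_scheme \<Rightarrow> 'a set \<Rightarrow> 'a set \<Rightarrow> 'a set \<Rightarrow> 'a set set" where
  "primes_over L R S p = {q. primeideal q (L\<lparr>carrier := S\<rparr>) \<and> q \<inter> R = p}"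

definition decomposition_group ::
    "('a, 'm) ring_scheme \<Rightarrow> 'a set \<Rightarrow> 'a set \<Rightarrow> ('a \<Rightarrow> 'a) monoid" where
  "decomposition_group L K q =
     (aut_group L K)\<lparr>carrier := {\<sigma> \<in> carrier (aut_group L K). \<sigma> ` q = q}\<rparr>"

text \<open>The image of \<open>\<kappa>(p)\<close> in \<open>\<kappa>(q)\<close>.\<close>

definition residue_base_field ::
    "('a, 'm) ring_scheme \<Rightarrow> 'a set \<Rightarrow> 'a set \<Rightarrow> 'a set \<Rightarrow> 'a set \<Rightarrow> 'a set set" where
  "residue_base_field L R S p q =
     {fractions L q (S - q) +>\<^bsub>L\<lparr>carrier := localization_at L S q\<rparr>\<^esub> x | x. x \<in> localization_at L R p}"

text \<open>
  Elements of \<open>\<kappa>(q)\<close> are cosets in \<open>L\<close>, so an element of the decomposition group acts on \<open>\<kappa>(q)\<close> by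
  taking images.
\<close>

definition residue_action ::
    "('a, 'm) ring_scheme \<Rightarrow> 'a set \<Rightarrow> 'a set \<Rightarrow> ('a \<Rightarrow> 'a) \<Rightarrow> 'a set \<Rightarrow> 'a set" where
  "residue_action L S q \<sigma> = (\<lambda>C \<in> carrier (residue_field L S q). \<sigma> ` C)"

definition inertia_group ::
    "('a, 'm) ring_scheme \<Rightarrow> 'a set \<Rightarrow> 'a set \<Rightarrow> 'a set \<Rightarrow> 'a set \<Rightarrow> 'a set \<Rightarrow> ('a \<Rightarrow> 'a) set" where
  "inertia_group L K R S p q =
     kernel (decomposition_group L K q)
       (aut_group (residue_field L S q) (residue_base_field L R S p q))
       (residue_action L S q)"

text \<open>The common order of the inertia groups at the primes of \<open>S\<close> over \<open>p\<close>.\<close>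

definition ramification_index ::
    "('a, 'm) ring_scheme \<Rightarrow> 'a set \<Rightarrow> 'a set \<Rightarrow> 'a set \<Rightarrow> 'a set \<Rightarrow> nat" where
  "ramification_index L K R S p =
     (THE e. \<exists>q \<in> primes_over L R S p. e = card (inertia_group L K R S p q))"

text \<open>
  In residue characteristic \<open>0\<close> the condition reads \<open>\<not> 0 dvd e\<close>, i.e. \<open>e \<noteq> 0\<close>, and so always holds.
\<close>

definition numerically_tamely_ramified ::
    "('a, 'm) ring_scheme \<Rightarrow> 'a set \<Rightarrow> 'a set \<Rightarrow> 'a set \<Rightarrow> 'a set \<Rightarrow> bool" where
  "numerically_tamely_ramified L K R S p \<longleftrightarrow>
     \<not> ring_characteristic (residue_field L R p) dvd ramification_index L K R S p"

end

theory Submission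
  imports Defs
begin

text \<open>
  Write \<open>G\<close> for the Galois group and \<open>T x\<close> for the sum of the conjugates \<open>g x\<close>, \<open>g \<in> G\<close>.  The trace form
  \<open>(x, y) \<mapsto> T (x y)\<close> is nondegenerate because automorphisms are linearly independent; a dual basis then
  shows that the matrix trace is \<open>T\<close> (\<open>field_trace_eq_conj_sum\<close>).  Cohomological tameness thus says that
  \<open>T\<close> takes a value outside \<open>p\<close> on \<open>S\<close>.

  Fix a prime \<open>q\<close> of \<open>S\<close> over \<open>p\<close>, and let \<open>I\<close> be its inertia group, that is, the automorphisms acting
  trivially on \<open>S/q\<close>.  All members of a right coset of \<open>I\<close> agree modulo \<open>q\<close>, so, for a system \<open>F\<close> of
  representatives, \<open>T z\<close> is congruent to \<open>|I|\<close> times the sum of the \<open>f z\<close>, \<open>f \<in> F\<close>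
  (\<open>trace_mod_prime\<close>).  The integer \<open>|I|\<close>, read as an element of \<open>R\<close>, lies in \<open>p\<close> exactly when the residue
  characteristic divides it.  Distinct members of \<open>F\<close> stay distinct modulo \<open>q\<close>, hence are independent over the
  domain \<open>S/q\<close> in the sense of Dedekind (\<open>dedekind_independence_mod_prime\<close>).  This gives the cycle:

  \<^item> If \<open>|I| \<in> p\<close>, then \<open>T\<close> maps \<open>S\<close> into \<open>q \<inter> R = p\<close>.  So cohomological tameness implies numerical tameness.

  \<^item> If \<open>|I| \<notin> p\<close> and \<open>T (s S) \<subseteq> p\<close>, then the sum of the \<open>f s f z\<close> lies in \<open>q\<close> for every \<open>z\<close>, and independence
    gives \<open>s \<in> q\<close>.  The set of such \<open>s\<close> is stable under \<open>G\<close>, so all conjugates of \<open>s\<close> lie in \<open>q\<close>, the lower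
    coefficients of \<open>\<Prod> (X - g s)\<close> lie in \<open>p\<close>, and a power of \<open>s\<close> lies in \<open>p S\<close>.  Conversely an element of the
    radical of \<open>p S\<close> lies in every prime over \<open>p\<close> together with its multiples and their conjugates, so
    its multiples have trace in \<open>p\<close>.  So numerical tameness implies tameness.

  \<^item> If \<open>T\<close> maps \<open>S\<close> into \<open>p\<close>, then \<open>1\<close> lies in the trace ideal but not in the radical of \<open>p S\<close>, because
    some prime lies over \<open>p\<close>.  So tameness implies cohomological tameness.

  Besides the existence of \<open>q\<close> (\<open>ex_lies_over\<close>), this requires that \<open>S\<close> is a ring
  (\<open>integral_closure_subring\<close>), and that \<open>|I|\<close> does not depend on \<open>q\<close> (\<open>card_inertia_unique\<close>), which
  follows from the conjugacy of the primes over \<open>p\<close>.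
\<close>

section \<open>Finitely generated modules over a noetherian subring\<close>

inductive_set (in ring) lin_span :: "'a set \<Rightarrow> 'a set \<Rightarrow> 'a set" for A W where
  zero: "\<zero> \<in> lin_span A W"
| add: "\<lbrakk> a \<in> A; w \<in> W; y \<in> lin_span A W \<rbrakk> \<Longrightarrow> a \<otimes> w \<oplus> y \<in> lin_span A W"

text \<open>
  \<open>A\<close>-submodules of the ambient ring are kept as plain sets, so that ideals of subrings, spans and
  localized ideals can be treated alike; for \<open>N \<subseteq> A\<close> these are the ideals of \<open>A\<close> (\<open>ideal_iff_submodule\<close>).
\<close>

definition (in ring) closed_submodule :: "'a set \<Rightarrow> 'a set \<Rightarrow> bool" where
  "closed_submodule A N \<longleftrightarrow> N \<subseteq> carrier R \<and> \<zero> \<in> N \<and> (\<forall>x\<in>N. \<forall>y\<in>N. x \<oplus> y \<in> N)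
     \<and> (\<forall>a\<in>A. \<forall>x\<in>N. a \<otimes> x \<in> N)"

lemma (in cring) sum_minus_sum_cancel:
  "\<lbrakk> x \<in> carrier R; y \<in> carrier R; z \<in> carrier R \<rbrakk> \<Longrightarrow> (x \<oplus> y) \<ominus> (x \<oplus> z) = y \<ominus> z"
  by algebra

lemma (in cring) minus_add_cancel:
  "\<lbrakk> x \<in> carrier R; y \<in> carrier R \<rbrakk> \<Longrightarrow> (x \<ominus> y) \<oplus> y = x"
  by algebra

locale coefficient_subring = domain L for L (structure) +
  fixes A :: "'a set"
  assumes subring_A: "subring A L"
begin

lemma A_carrier [intro]: "a \<in> A \<Longrightarrow> a \<in> carrier L"
  using subringE[OF subring_A] by auto

lemma A_simps [simp, intro]:
  "\<zero> \<in> A" "\<one> \<in> A"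
  "\<lbrakk> a \<in> A; b \<in> A \<rbrakk> \<Longrightarrow> a \<oplus> b \<in> A" "\<lbrakk> a \<in> A; b \<in> A \<rbrakk> \<Longrightarrow> a \<otimes> b \<in> A" "a \<in> A \<Longrightarrow> \<ominus> a \<in> A"
  "\<lbrakk> a \<in> A; b \<in> A \<rbrakk> \<Longrightarrow> a \<ominus> b \<in> A"
  using subringE[OF subring_A] by (auto simp: a_minus_def)

lemma A_pow [simp, intro]: "a \<in> A \<Longrightarrow> a [^] (n::nat) \<in> A"
  by (induction n) auto

lemma ring_A: "cring (L\<lparr>carrier := A\<rparr>)"
  using subcring_iff subcringI'[OF subring_A] A_carrier by blast

lemma submoduleD:
  assumes "closed_submodule A N"
  shows "N \<subseteq> carrier L" "x \<in> N \<Longrightarrow> x \<in> carrier L" "\<zero> \<in> N" "\<lbrakk> x \<in> N; y \<in> N \<rbrakk> \<Longrightarrow> x \<oplus> y \<in> N"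
    "\<lbrakk> a \<in> A; x \<in> N \<rbrakk> \<Longrightarrow> a \<otimes> x \<in> N"
    "x \<in> N \<Longrightarrow> \<ominus> x \<in> N"  "\<lbrakk> x \<in> N; y \<in> N \<rbrakk> \<Longrightarrow> x \<ominus> y \<in> N"
proof -
  show *: "N \<subseteq> carrier L" "\<And>x. x \<in> N \<Longrightarrow> x \<in> carrier L" "\<zero> \<in> N" "\<And>x y. \<lbrakk> x \<in> N; y \<in> N \<rbrakk> \<Longrightarrow> x \<oplus> y \<in> N"
    "\<And>a x. \<lbrakk> a \<in> A; x \<in> N \<rbrakk> \<Longrightarrow> a \<otimes> x \<in> N"
    using assms unfolding closed_submodule_def by auto
  show n: "\<And>x. x \<in> N \<Longrightarrow> \<ominus> x \<in> N"
    using *(5)[of "\<ominus> \<one>"] *(2) by (simp add: l_minus)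
  show "\<lbrakk> x \<in> N; y \<in> N \<rbrakk> \<Longrightarrow> x \<ominus> y \<in> N"
    using n *(4) by (simp add: a_minus_def)
qed

lemma lin_span_carrier:
  assumes "W \<subseteq> carrier L" "x \<in> lin_span A W" shows "x \<in> carrier L"
  using assms(2,1) by induction auto

lemma lin_span_submodule:
  assumes "W \<subseteq> carrier L" shows "closed_submodule A (lin_span A W)"
proof -
  have c: "x \<in> carrier L" if "x \<in> lin_span A W" for x
    using lin_span_carrier assms that by blast
  have "x \<oplus> y \<in> lin_span A W" if x: "x \<in> lin_span A W" and y: "y \<in> lin_span A W" for x y
    using x
  proof induction
    case zero
    then show ?case using y c by simp
  next
    case (add a w z)
    then have "a \<otimes> w \<oplus> (z \<oplus> y) \<in> lin_span A W" by (intro lin_span.add)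
    then show ?case using add y c assms by (simp add: a_assoc subset_iff A_carrier)
  qed
  moreover have "b \<otimes> x \<in> lin_span A W" if x: "x \<in> lin_span A W" and b: "b \<in> A" for x b
    using x
  proof induction
    case zero
    then show ?case using b by (simp add: lin_span.zero A_carrier)
  next
    case (add a w z)
    then have "(b \<otimes> a) \<otimes> w \<oplus> (b \<otimes> z) \<in> lin_span A W" using b by (intro lin_span.add) auto
    then show ?case using add b c assms by (simp add: m_assoc r_distr subset_iff A_carrier)
  qed
  ultimately show ?thesis
    using c by (auto simp: closed_submodule_def lin_span.zero)
qed

lemma lin_span_base: "W \<subseteq> carrier L \<Longrightarrow> w \<in> W \<Longrightarrow> w \<in> lin_span A W"
  using lin_span.add[of \<one> A w W \<zero>] by (auto simp: lin_span.zero subset_iff)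

lemma lin_span_minimal:
  assumes "closed_submodule A N" "W \<subseteq> N" shows "lin_span A W \<subseteq> N"
proof
  fix x assume "x \<in> lin_span A W"
  then show "x \<in> N"
    by induction (use submoduleD[OF assms(1)] assms(2) in auto)
qed

lemma lin_span_mono:
  assumes "W \<subseteq> V" "V \<subseteq> carrier L" shows "lin_span A W \<subseteq> lin_span A V"
  using lin_span_minimal[OF lin_span_submodule[OF assms(2)]] lin_span_base[OF assms(2)] assms(1) by blast

lemma submodule_multiplier:
  assumes "closed_submodule A N" "y \<in> carrier L"
  shows "closed_submodule A {x \<in> carrier L. y \<otimes> x \<in> N}"
  unfolding closed_submodule_def
  using submoduleD[OF assms(1)] assms(2) by (auto simp: r_distr m_lcomm A_carrier)

lemma lin_span_insert:
  assumes "insert w W \<subseteq> carrier L" "z \<in> lin_span A (insert w W)"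
  shows "\<exists>c\<in>A. \<exists>y\<in>lin_span A W. z = c \<otimes> w \<oplus> y"
  using assms(2)
proof induction
  case zero
  show ?case using assms(1) by (intro bexI[of _ \<zero>]) (auto simp: lin_span.zero)
next
  case (add a v z)
  then obtain c y where cy: "c \<in> A" "y \<in> lin_span A W" "z = c \<otimes> w \<oplus> y" by blast
  have y: "y \<in> carrier L" using cy lin_span_carrier assms by blast
  show ?case
  proof (cases "v = w")
    case True
    then have "a \<otimes> v \<oplus> z = (a \<oplus> c) \<otimes> w \<oplus> y"
      using cy add assms y by (simp add: l_distr a_assoc A_carrier)
    then show ?thesis using cy add by blast
  next
    case False
    then have "a \<otimes> v \<oplus> y \<in> lin_span A W" using add cy by (intro lin_span.add) auto
    moreover have "a \<otimes> v \<oplus> z = c \<otimes> w \<oplus> (a \<otimes> v \<oplus> y)"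
      using cy add assms y False by (auto simp: a_lcomm subset_iff A_carrier)
    ultimately show ?thesis using cy by blast
  qed
qed

lemma ideal_iff_submodule:
  "ideal I (L\<lparr>carrier := A\<rparr>) \<longleftrightarrow> I \<subseteq> A \<and> closed_submodule A I"
proof
  assume "ideal I (L\<lparr>carrier := A\<rparr>)"
  then interpret I: ideal I "L\<lparr>carrier := A\<rparr>" .
  have "I \<subseteq> A" using I.a_subset by simp
  moreover have "\<zero> \<in> I" using additive_subgroup.zero_closed[OF I.is_additive_subgroup] by simp
  moreover have "x \<oplus> y \<in> I" if "x \<in> I" "y \<in> I" for x y using additive_subgroup.a_closed[OF I.is_additive_subgroup that] by simp
  moreover have "a \<otimes> x \<in> I" if "x \<in> I" "a \<in> A" for x a using I.I_l_closed[of x a] that by simp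
  ultimately show "I \<subseteq> A \<and> closed_submodule A I"
    using A_carrier by (auto simp: closed_submodule_def)
next
  assume I: "I \<subseteq> A \<and> closed_submodule A I"
  then have "closed_submodule A I" by blast
  note ID = submoduleD[OF this]
  have inv: "inv\<^bsub>add_monoid L\<lparr>carrier := A\<rparr>\<^esub> a = \<ominus> a" if "a \<in> A" for a
    using add.m_inv_consistent[OF subring.axioms(1)[OF subring_A] that] by (simp add: a_inv_def)
  show "ideal I (L\<lparr>carrier := A\<rparr>)"
  proof (rule idealI)
    show "ring (L\<lparr>carrier := A\<rparr>)" using ring_A cring.axioms(1) by blast
    have [simp]: "add_monoid (L\<lparr>carrier := A\<rparr>) = add_monoid L\<lparr>carrier := A\<rparr>" by simp
    have "inv\<^bsub>add_monoid L\<lparr>carrier := A\<rparr>\<^esub> a \<in> I" if "a \<in> I" for a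
      using inv[of a] that I ID by (metis subsetD)
    then show "subgroup I (add_monoid (L\<lparr>carrier := A\<rparr>))"
      using I ID(3,4) by unfold_locales auto
    show "x \<otimes>\<^bsub>L\<lparr>carrier := A\<rparr>\<^esub> a \<in> I" if "a \<in> I" "x \<in> carrier (L\<lparr>carrier := A\<rparr>)" for a x
      using ID that by simp
    show "a \<otimes>\<^bsub>L\<lparr>carrier := A\<rparr>\<^esub> x \<in> I" if "a \<in> I" "x \<in> carrier (L\<lparr>carrier := A\<rparr>)" for a x
    proof -
      have "a \<otimes> x = x \<otimes> a" using that ID by (intro m_comm) auto
      then show ?thesis using ID(5)[of x a] that by auto
    qed
  qed
qed

text \<open>
  The coefficients of \<open>w\<close> in elements of \<open>N\<close>, taken modulo \<open>M\<close>.  They play the part of the leading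
  coefficients in Hilbert's basis theorem and carry the induction on the number of generators.
\<close>

lemma leading_coefficients_ideal:
  assumes "closed_submodule A N" "closed_submodule A M" "w \<in> carrier L"
  shows "ideal {c \<in> A. \<exists>y\<in>M. c \<otimes> w \<oplus> y \<in> N} (L\<lparr>carrier := A\<rparr>)" (is "ideal ?I _")
proof -
  note N = submoduleD[OF assms(1)] and M = submoduleD[OF assms(2)]
  have add: "a \<oplus> b \<in> ?I" if "a \<in> ?I" "b \<in> ?I" for a b
  proof -
    obtain y z where yz: "y \<in> M" "z \<in> M" "a \<otimes> w \<oplus> y \<in> N" "b \<otimes> w \<oplus> z \<in> N"
      using \<open>a \<in> ?I\<close> \<open>b \<in> ?I\<close> by blast
    have "(a \<oplus> b) \<otimes> w \<oplus> (y \<oplus> z) = (a \<otimes> w \<oplus> y) \<oplus> (b \<otimes> w \<oplus> z)"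
      using that yz M(2) assms(3) by (auto simp: l_distr a_ac A_carrier)
    then have "(a \<oplus> b) \<otimes> w \<oplus> (y \<oplus> z) \<in> N" using yz N by simp
    then show ?thesis using yz M that by blast
  qed
  have mul: "c \<otimes> a \<in> ?I" if "a \<in> ?I" "c \<in> A" for a c
  proof -
    obtain y where yz: "y \<in> M" "a \<otimes> w \<oplus> y \<in> N" using \<open>a \<in> ?I\<close> by blast
    have "(c \<otimes> a) \<otimes> w \<oplus> c \<otimes> y = c \<otimes> (a \<otimes> w \<oplus> y)"
      using that yz M assms by (auto simp: r_distr m_assoc A_carrier)
    then have "(c \<otimes> a) \<otimes> w \<oplus> c \<otimes> y \<in> N" using yz N that by simp
    then show ?thesis using yz M that by blast
  qed
  have zero: "\<zero> \<in> ?I" using N M assms by auto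
  show ?thesis
    unfolding ideal_iff_submodule closed_submodule_def using add mul zero by blast
qed

end

locale noetherian_coefficients = coefficient_subring +
  assumes noetherian_A: "noetherian_ring (L\<lparr>carrier := A\<rparr>)"
begin

text \<open>
  Induction on the generators \<open>W\<close>.  When \<open>w\<close> is added, finitely many elements of \<open>N\<close> realize generators of
  the ideal of coefficients of \<open>w\<close>; subtracting a combination of them from an element of \<open>N\<close> leaves an
  element of \<open>N\<close> in the span of the smaller set, where the induction hypothesis applies.
\<close>

lemma submodule_finitely_generated:
  assumes "finite W" "W \<subseteq> carrier L" "closed_submodule A N" "N \<subseteq> lin_span A W"
  shows "\<exists>F\<subseteq>N. finite F \<and> N \<subseteq> lin_span A F"
  using assms
proof (induction W arbitrary: N rule: finite_induct)
  case empty
  have "lin_span A {} \<subseteq> {\<zero>}"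
    by (rule lin_span_minimal) (auto simp: closed_submodule_def A_carrier)
  then show ?case using empty lin_span.zero by (intro exI[of _ "{}"]) auto
next
  case (insert w W)
  note N = submoduleD[OF insert.prems(2)]
  let ?lead = "\<lambda>N. {c \<in> A. \<exists>y\<in>lin_span A W. c \<otimes> w \<oplus> y \<in> N}"
  have W: "closed_submodule A (lin_span A W)" using insert.prems by (intro lin_span_submodule) auto
  note WD = submoduleD[OF W]
  have w: "w \<in> carrier L" using insert.prems by auto
  have "ideal (?lead N) (L\<lparr>carrier := A\<rparr>)"
    using leading_coefficients_ideal W w insert.prems by blast
  then obtain B where B: "B \<subseteq> A" "finite B" "?lead N = Idl\<^bsub>L\<lparr>carrier := A\<rparr>\<^esub> B"
    using noetherian_ring.finetely_gen[OF noetherian_A, of "?lead N"] by auto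
  have "B \<subseteq> ?lead N" unfolding B(3)
    by (rule ring.genideal_self) (use B ring_A cring.axioms(1) in auto)
  then have "\<forall>c\<in>B. \<exists>y. y \<in> lin_span A W \<and> c \<otimes> w \<oplus> y \<in> N" by blast
  then obtain y where y: "\<And>c. c \<in> B \<Longrightarrow> y c \<in> lin_span A W" "\<And>c. c \<in> B \<Longrightarrow> c \<otimes> w \<oplus> y c \<in> N"
    by metis
  \<comment> \<open>F1 realizes generators of the ideal of coefficients of w; F2 below handles the elements without w\<close>
  define F1 where "F1 = (\<lambda>c. c \<otimes> w \<oplus> y c) ` B"
  have F1: "F1 \<subseteq> N" "finite F1" using y B by (auto simp: F1_def)
  then have F1c: "F1 \<subseteq> carrier L" using N by blast
  have "ideal (?lead (lin_span A F1)) (L\<lparr>carrier := A\<rparr>)"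
    using leading_coefficients_ideal W w lin_span_submodule[OF F1c] by blast
  moreover have "B \<subseteq> ?lead (lin_span A F1)"
  proof
    fix c assume c: "c \<in> B"
    then have "c \<otimes> w \<oplus> y c \<in> lin_span A F1" using lin_span_base[OF F1c] by (auto simp: F1_def)
    then show "c \<in> ?lead (lin_span A F1)" using c y(1)[OF c] B(1) by auto
  qed
  ultimately have "?lead N \<subseteq> ?lead (lin_span A F1)" unfolding B(3)
    by (intro ring.genideal_minimal) (use ring_A cring.axioms(1) in auto)
  note lead = this
  have "closed_submodule A (N \<inter> lin_span A W)"
    using N WD by (auto simp: closed_submodule_def)
  from insert.IH[OF _ this] insert.prems obtain F2 where
    F2: "F2 \<subseteq> N \<inter> lin_span A W" "finite F2" "N \<inter> lin_span A W \<subseteq> lin_span A F2" by auto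
  define F where "F = F1 \<union> F2"
  have F: "F \<subseteq> N" "finite F" "F \<subseteq> carrier L" using F1 F2 N by (auto simp: F_def)
  note S = submoduleD[OF lin_span_submodule[OF F(3)]]
  have F1F: "lin_span A F1 \<subseteq> lin_span A F" "lin_span A F2 \<subseteq> lin_span A F"
    using lin_span_mono[OF _ F(3)] by (auto simp: F_def)
  have F1N: "lin_span A F1 \<subseteq> N" using lin_span_minimal insert.prems F1 by blast
  have "z \<in> lin_span A F" if z: "z \<in> N" for z
  proof -
    have "z \<in> lin_span A (insert w W)" using z insert.prems by auto
    from lin_span_insert[OF insert.prems(1) this] obtain c v where
      cv: "c \<in> A" "v \<in> lin_span A W" "z = c \<otimes> w \<oplus> v" by blast
    then have "c \<in> ?lead N" using z by auto
    with lead have "c \<in> ?lead (lin_span A F1)" by (rule subsetD)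
    then obtain u where u: "u \<in> lin_span A W" "c \<otimes> w \<oplus> u \<in> lin_span A F1" by auto
    have carr: "u \<in> carrier L" "v \<in> carrier L" "c \<in> carrier L" "z \<in> carrier L"
      using WD(2)[OF u(1)] WD(2)[OF cv(2)] A_carrier[OF cv(1)] N(2)[OF z] by auto
    have "(c \<otimes> w \<oplus> v) \<ominus> (c \<otimes> w \<oplus> u) = v \<ominus> u"
      using carr w by (simp add: sum_minus_sum_cancel)
    then have eq: "z \<ominus> (c \<otimes> w \<oplus> u) = v \<ominus> u" by (simp only: cv(3))
    have "z \<ominus> (c \<otimes> w \<oplus> u) \<in> N" using N(7)[OF z subsetD[OF F1N u(2)]] .
    moreover have "z \<ominus> (c \<otimes> w \<oplus> u) \<in> lin_span A W" unfolding eq using WD(7)[OF cv(2) u(1)] .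
    ultimately have "z \<ominus> (c \<otimes> w \<oplus> u) \<in> lin_span A F"
      using subsetD[OF F2(3)] subsetD[OF F1F(2)] by blast
    from S(4)[OF this subsetD[OF F1F(1) u(2)]]
    have "(z \<ominus> (c \<otimes> w \<oplus> u)) \<oplus> (c \<otimes> w \<oplus> u) \<in> lin_span A F" .
    moreover have "(z \<ominus> (c \<otimes> w \<oplus> u)) \<oplus> (c \<otimes> w \<oplus> u) = z"
      using carr w by (simp add: minus_add_cancel)
    ultimately show ?thesis by simp
  qed
  then show ?case using F by blast
qed

end

section \<open>Integral elements form a subring\<close>

context coefficient_subring
begin

abbreviation powers_below :: "'a \<Rightarrow> nat \<Rightarrow> 'a set" where
  "powers_below x n \<equiv> (\<lambda>i. x [^] i) ` {..<n}"

lemma submodule_mult: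
  assumes "closed_submodule A N" "y \<in> carrier L" "V \<subseteq> carrier L" "\<And>w. w \<in> V \<Longrightarrow> y \<otimes> w \<in> N" "z \<in> lin_span A V"
  shows "y \<otimes> z \<in> N"
proof -
  have "lin_span A V \<subseteq> {x \<in> carrier L. y \<otimes> x \<in> N}"
    using assms by (intro lin_span_minimal submodule_multiplier) auto
  then show ?thesis using assms(5) by auto
qed

lemma lin_span_powers_iff:
  assumes "x \<in> carrier L"
  shows "z \<in> lin_span A (powers_below x n) \<longleftrightarrow> (\<exists>cs. set cs \<subseteq> A \<and> length cs = n \<and> z = eval cs x)"
proof
  assume "z \<in> lin_span A (powers_below x n)"
  then show "\<exists>cs. set cs \<subseteq> A \<and> length cs = n \<and> z = eval cs x"
  proof (induction n arbitrary: z)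
    case 0
    have "lin_span A {} \<subseteq> {\<zero>}"
      by (rule lin_span_minimal) (auto simp: closed_submodule_def A_carrier)
    then show ?case using 0 by auto
  next
    case (Suc n)
    have "powers_below x (Suc n) = insert (x [^] n) (powers_below x n)"
      by (simp add: lessThan_Suc)
    with lin_span_insert[of "x [^] n" "powers_below x n" z] Suc.prems assms
    obtain c y where cy: "c \<in> A" "y \<in> lin_span A (powers_below x n)" "z = c \<otimes> x [^] n \<oplus> y"
      by auto
    from Suc.IH[OF cy(2)] obtain cs where "set cs \<subseteq> A" "length cs = n" "y = eval cs x" by blast
    then have "set (c # cs) \<subseteq> A" "length (c # cs) = Suc n" "z = eval (c # cs) x"
      using cy by auto
    then show ?case by blast
  qed
next
  assume "\<exists>cs. set cs \<subseteq> A \<and> length cs = n \<and> z = eval cs x"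
  then obtain cs where "set cs \<subseteq> A" "length cs = n" "z = eval cs x" by blast
  then show "z \<in> lin_span A (powers_below x n)"
  proof (induction cs arbitrary: n z)
    case Nil
    then show ?case by (simp add: lin_span.zero)
  next
    case (Cons c cs)
    have "eval cs x \<in> lin_span A (powers_below x (length cs))"
      using Cons.IH Cons.prems by auto
    then have "eval cs x \<in> lin_span A (powers_below x n)"
      using lin_span_mono[of "powers_below x (length cs)" "powers_below x n"] Cons.prems assms
      by (fastforce simp: subset_iff)
    then show ?case using Cons.prems by (auto intro!: lin_span.add)
  qed
qed

text \<open>
  A monic equation of degree \<open>n\<close> for \<open>x\<close> is the same as a representation of \<open>x\<^sup>n\<close> as a combination
  of lower powers.
\<close>

lemma integral_over_iff:
  assumes x: "x \<in> carrier L"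
  shows "integral_over L A x \<longleftrightarrow> (\<exists>n. x [^] n \<in> lin_span A (powers_below x n))"
proof
  assume "integral_over L A x"
  then obtain f where f: "f \<in> carrier (univ_poly L A)" "f \<noteq> []" "lead_coeff f = \<one>" "eval f x = \<zero>"
    unfolding integral_over_def by blast
  then obtain cs where cs: "f = \<one> # cs" by (cases f) auto
  have A: "set cs \<subseteq> A" using f(1) cs by (auto simp: univ_poly_def polynomial_def)
  then have c: "eval cs x \<in> carrier L" using x A_carrier by (intro eval_in_carrier) auto
  have e: "eval cs x \<in> lin_span A (powers_below x (length cs))"
    using A x lin_span_powers_iff by blast
  have pc: "powers_below x (length cs) \<subseteq> carrier L" using x by auto
  have "x [^] length cs \<oplus> eval cs x = \<zero>" using f(4) cs x by simp
  then have "x [^] length cs = \<ominus> eval cs x" using x c by (simp add: sum_zero_eq_neg)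
  then show "\<exists>n. x [^] n \<in> lin_span A (powers_below x n)"
    using submoduleD(6)[OF lin_span_submodule[OF pc] e] by metis
next
  assume "\<exists>n. x [^] n \<in> lin_span A (powers_below x n)"
  then obtain n where n: "x [^] n \<in> lin_span A (powers_below x n)" by blast
  have pc: "powers_below x n \<subseteq> carrier L" using x by auto
  have "\<ominus> (x [^] n) \<in> lin_span A (powers_below x n)"
    using submoduleD(6)[OF lin_span_submodule[OF pc] n] .
  then obtain cs where cs: "set cs \<subseteq> A" "length cs = n" "\<ominus> (x [^] n) = eval cs x"
    using lin_span_powers_iff x by auto
  have "eval (\<one> # cs) x = \<zero>" using cs x by (simp flip: cs(3) add: r_neg)
  moreover have "\<one> # cs \<in> carrier (univ_poly L A)"
    using cs by (auto simp: univ_poly_def polynomial_def)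
  ultimately show "integral_over L A x"
    unfolding integral_over_def by (metis list.sel(1) list.distinct(1))
qed

text \<open>
  The module spanned by the products \<open>t\<^sup>i w\<close>, with \<open>i\<close> below the degree of an equation of \<open>t\<close>, is stable
  under \<open>t\<close> and under every multiplier of the old module.  Starting from the module spanned by \<open>1\<close>, two
  applications produce a finitely generated module stable under two given integral elements.
\<close>

lemma integral_extend_module:
  assumes W: "finite W" "W \<subseteq> carrier L" "\<one> \<in> lin_span A W"
    and t: "t \<in> carrier L" "integral_over L A t"
  shows "\<exists>V. finite V \<and> V \<subseteq> carrier L \<and> \<one> \<in> lin_span A V \<and> (\<forall>v\<in>V. t \<otimes> v \<in> lin_span A V) \<and>
    (\<forall>x\<in>carrier L. (\<forall>w\<in>W. x \<otimes> w \<in> lin_span A W) \<longrightarrow> (\<forall>v\<in>V. x \<otimes> v \<in> lin_span A V))"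
proof -
  obtain n where n: "t [^] n \<in> lin_span A (powers_below t n)"
    using t integral_over_iff by blast
  have "n \<noteq> 0"
  proof
    assume "n = 0"
    moreover have "lin_span A {} \<subseteq> {\<zero>}"
      by (rule lin_span_minimal) (auto simp: closed_submodule_def A_carrier)
    ultimately show False using n by auto
  qed
  define V where "V = (\<lambda>(i, w). t [^] i \<otimes> w) ` ({..<n} \<times> W)"
  have V: "finite V" "V \<subseteq> carrier L" using W t by (auto simp: V_def)
  note M = lin_span_submodule[OF V(2)]
  have base: "t [^] i \<otimes> w \<in> lin_span A V" if "i < n" "w \<in> W" for i w
    by (rule lin_span_base[OF V(2)]) (use that in \<open>auto simp: V_def\<close>)
  have powW: "t [^] i \<otimes> y \<in> lin_span A V" if "i < n" "y \<in> lin_span A W" for i y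
    by (rule submodule_mult[OF M _ W(2) _ that(2)]) (use base that t in auto)
  have "\<one> \<in> lin_span A V" using powW[of 0 \<one>] W(3) \<open>n \<noteq> 0\<close> by simp
  moreover have "t \<otimes> v \<in> lin_span A V" if v: "v \<in> V" for v
  proof -
    obtain i w where iw: "i < n" "w \<in> W" "v = t [^] i \<otimes> w" using v by (auto simp: V_def)
    have wc: "w \<in> carrier L" using iw W by auto
    have eq: "t \<otimes> v = t [^] (Suc i) \<otimes> w" using iw t wc by (simp add: m_ac)
    show ?thesis
    proof (cases "Suc i < n")
      case True
      then show ?thesis unfolding eq using base iw(2) by blast
    next
      case False
      then have "Suc i = n" using iw by simp
      have pc: "powers_below t n \<subseteq> carrier L" using t by auto
      have "w \<otimes> t [^] n \<in> lin_span A V"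
      proof (rule submodule_mult[OF M wc pc _ n])
        fix u assume "u \<in> powers_below t n"
        then obtain j where "j < n" "u = t [^] j" by auto
        then show "w \<otimes> u \<in> lin_span A V" using base[of j w] iw(2) t wc by (metis m_comm nat_pow_closed)
      qed
      then show ?thesis unfolding eq \<open>Suc i = n\<close> using wc t by (simp add: m_comm)
    qed
  qed
  moreover have "x \<otimes> v \<in> lin_span A V"
    if x: "x \<in> carrier L" "\<forall>w\<in>W. x \<otimes> w \<in> lin_span A W" and v: "v \<in> V" for x v
  proof -
    obtain i w where iw: "i < n" "w \<in> W" "v = t [^] i \<otimes> w" using v by (auto simp: V_def)
    have wc: "w \<in> carrier L" using iw W by auto
    have "x \<otimes> v = t [^] i \<otimes> (x \<otimes> w)" using iw t wc x by (simp add: m_lcomm)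
    then show ?thesis using powW iw x by simp
  qed
  ultimately show ?thesis using V by blast
qed

lemma integral_hom_image:
  assumes h: "h \<in> ring_hom L L" "\<And>a. a \<in> A \<Longrightarrow> h a = a" and x: "x \<in> carrier L" "integral_over L A x"
  shows "integral_over L A (h x)"
proof -
  interpret h: ring_hom_cring L L h
    by (intro ring_hom_cring.intro ring_hom_cring_axioms.intro is_cring h(1))
  have e: "h (eval cs x) = eval cs (h x)" if "set cs \<subseteq> A" for cs
    using that
  proof (induction cs)
    case (Cons c cs)
    have "eval cs x \<in> carrier L" using Cons.prems A_carrier x by (intro eval_in_carrier) auto
    then show ?case using Cons h(2) x by (auto simp: A_carrier)
  qed simp
  obtain n where "x [^] n \<in> lin_span A (powers_below x n)" using x integral_over_iff by blast
  then obtain cs where cs: "set cs \<subseteq> A" "length cs = n" "x [^] n = eval cs x"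
    using lin_span_powers_iff x by blast
  moreover have "h (x [^] i) = h x [^] i" for i :: nat using x by (induction i) auto
  ultimately have "h x [^] n = eval cs (h x)" using e by metis
  then have "h x [^] n \<in> lin_span A (powers_below (h x) n)" using lin_span_powers_iff cs x by auto
  then show ?thesis using integral_over_iff x by blast
qed

end

context noetherian_coefficients
begin

text \<open>
  The powers of \<open>x\<close> span a submodule of a finitely generated module.  It is itself finitely generated
  because \<open>A\<close> is noetherian, so finitely many powers suffice and the next one depends on them.
\<close>

lemma integral_if_stable_module:
  assumes W: "finite W" "W \<subseteq> carrier L" "\<one> \<in> lin_span A W"
    and x: "x \<in> carrier L" "\<And>w. w \<in> W \<Longrightarrow> x \<otimes> w \<in> lin_span A W"
  shows "integral_over L A x"
proof -
  define P where "P = range (\<lambda>i::nat. x [^] i)"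
  have P: "P \<subseteq> carrier L" using x by (auto simp: P_def)
  note M = lin_span_submodule[OF W(2)]
  have "x [^] i \<in> lin_span A W" for i :: nat
  proof (induction i)
    case (Suc i)
    have "x \<otimes> x [^] i \<in> lin_span A W" by (rule submodule_mult[OF M x(1) W(2) x(2) Suc])
    then show ?case using x by (simp add: m_comm)
  qed (simp add: W)
  then have "lin_span A P \<subseteq> lin_span A W" by (intro lin_span_minimal M) (auto simp: P_def)
  from submodule_finitely_generated[OF W(1,2) lin_span_submodule[OF P] this]
  obtain F where F: "F \<subseteq> lin_span A P" "finite F" "lin_span A P \<subseteq> lin_span A F" by blast
  have "\<exists>n. F \<subseteq> lin_span A (powers_below x n)" using F(2,1)
  proof induction
    case (insert z F)
    then obtain n where n: "F \<subseteq> lin_span A (powers_below x n)" by auto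
    have "z \<in> lin_span A P" using insert by auto
    then have "\<exists>m. z \<in> lin_span A (powers_below x m)"
    proof induction
      case zero
      show ?case using lin_span.zero by blast
    next
      case (add a w y)
      then obtain m k where mk: "y \<in> lin_span A (powers_below x m)" "w = x [^] (k::nat)" by (auto simp: P_def)
      have "lin_span A (powers_below x m) \<subseteq> lin_span A (powers_below x (max m (Suc k)))"
        by (rule lin_span_mono) (use x in auto)
      then have "a \<otimes> w \<oplus> y \<in> lin_span A (powers_below x (max m (Suc k)))"
        using mk add by (intro lin_span.add) auto
      then show ?case by blast
    qed
    then obtain m where m: "z \<in> lin_span A (powers_below x m)" by blast
    have "lin_span A (powers_below x m) \<subseteq> lin_span A (powers_below x (max m n))"
      "lin_span A (powers_below x n) \<subseteq> lin_span A (powers_below x (max m n))"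
      by (intro lin_span_mono; use x in auto)+
    then have "insert z F \<subseteq> lin_span A (powers_below x (max m n))" using m n by auto
    then show ?case by blast
  qed auto
  then obtain n where n: "F \<subseteq> lin_span A (powers_below x n)" by blast
  have pc: "powers_below x n \<subseteq> carrier L" using x by auto
  have "lin_span A F \<subseteq> lin_span A (powers_below x n)"
    by (rule lin_span_minimal[OF lin_span_submodule[OF pc] n])
  moreover have "x [^] n \<in> lin_span A P" using lin_span_base[OF P] by (auto simp: P_def)
  ultimately show ?thesis using integral_over_iff[OF x(1)] F(3) by blast
qed

lemma integral_sum_prod:
  assumes "s \<in> carrier L" "integral_over L A s" "t \<in> carrier L" "integral_over L A t"
  shows "integral_over L A (s \<oplus> t)" "integral_over L A (s \<otimes> t)"
proof -
  have "\<one> \<in> lin_span A {\<one>}" using lin_span_base by auto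
  from integral_extend_module[OF _ _ this assms(1,2)] obtain V where
    V: "finite V" "V \<subseteq> carrier L" "\<one> \<in> lin_span A V" "\<forall>v\<in>V. s \<otimes> v \<in> lin_span A V" by auto
  from integral_extend_module[OF V(1-3) assms(3,4)] V(4) assms(1) obtain W where
    W: "finite W" "W \<subseteq> carrier L" "\<one> \<in> lin_span A W" "\<forall>v\<in>W. t \<otimes> v \<in> lin_span A W"
     "\<forall>v\<in>W. s \<otimes> v \<in> lin_span A W" by auto
  note M = lin_span_submodule[OF W(2)]
  have "(s \<oplus> t) \<otimes> w \<in> lin_span A W" if "w \<in> W" for w
  proof -
    have "(s \<oplus> t) \<otimes> w = s \<otimes> w \<oplus> t \<otimes> w" using assms that W(2) by (auto intro: l_distr)
    then show ?thesis using submoduleD(4)[OF M] W that by simp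
  qed
  then show "integral_over L A (s \<oplus> t)" using integral_if_stable_module[OF W(1-3)] assms by simp
  have "(s \<otimes> t) \<otimes> w \<in> lin_span A W" if "w \<in> W" for w
  proof -
    have "(s \<otimes> t) \<otimes> w = s \<otimes> (t \<otimes> w)" using assms that W(2) by (auto intro: m_assoc)
    moreover have "s \<otimes> (t \<otimes> w) \<in> lin_span A W"
      by (rule submodule_mult[OF M _ W(2)]) (use W that assms in auto)
    ultimately show ?thesis by simp
  qed
  then show "integral_over L A (s \<otimes> t)" using integral_if_stable_module[OF W(1-3)] assms by simp
qed

lemma integral_coefficients:
  assumes "a \<in> A" shows "integral_over L A a"
proof (rule integral_if_stable_module[of "{\<one>}"])
  have one: "\<one> \<in> lin_span A {\<one>}" using lin_span_base by auto
  show "\<one> \<in> lin_span A {\<one>}" using one .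
  show "a \<otimes> w \<in> lin_span A {\<one>}" if "w \<in> {\<one>}" for w
    using submoduleD(5)[OF lin_span_submodule assms one] that by auto
qed (use assms A_carrier in auto)

lemma integral_closure_subring: "subring (integral_closure_in L A (carrier L)) L"
proof (rule subringI)
  show "\<ominus> x \<in> integral_closure_in L A (carrier L)" if "x \<in> integral_closure_in L A (carrier L)" for x
  proof -
    have "\<ominus> x = \<ominus> \<one> \<otimes> x" using that by (simp add: integral_closure_in_def l_minus)
    then show ?thesis using that integral_sum_prod(2)[of "\<ominus> \<one>" x] integral_coefficients[of "\<ominus> \<one>"]
      by (auto simp: integral_closure_in_def)
  qed
qed (use integral_sum_prod integral_coefficients in \<open>auto simp: integral_closure_in_def\<close>)

end

section \<open>Prime ideals of a subring\<close>

lemma (in cring) leading_term_cancel: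
  assumes "a \<in> carrier R" "b \<in> carrier R" "t \<in> carrier R" "d \<in> carrier R" "u \<in> carrier R"
  shows "b \<ominus> t \<otimes> a = (d \<otimes> (t \<otimes> u) \<oplus> b) \<ominus> t \<otimes> (d \<otimes> u \<oplus> a)"
  using assms by algebra

lemma (in cring) add_minus_cancel_right:
  "\<lbrakk> a \<in> carrier R; b \<in> carrier R \<rbrakk> \<Longrightarrow> (a \<oplus> b) \<ominus> b = a"
  by algebra

lemma (in ring) finsum_minus:
  assumes "\<And>i. i \<in> I \<Longrightarrow> f i \<in> carrier R" "\<And>i. i \<in> I \<Longrightarrow> f' i \<in> carrier R"
  shows "(\<Oplus>i\<in>I. f i \<ominus> f' i) = (\<Oplus>i\<in>I. f i) \<ominus> (\<Oplus>i\<in>I. f' i)"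
  using assms
proof (induction I rule: infinite_finite_induct)
  case (insert i I)
  have "(f i \<ominus> f' i) \<oplus> (a \<ominus> b) = (f i \<oplus> a) \<ominus> (f' i \<oplus> b)" if "a \<in> carrier R" "b \<in> carrier R" for a b
    using insert.prems that by (simp add: a_minus_def minus_add a_ac)
  moreover have "finsum R f I \<in> carrier R" "finsum R f' I \<in> carrier R"
    using insert.prems by (auto intro!: finsum_closed)
  ultimately show ?case using insert by (simp add: Pi_def)
qed (auto simp: a_minus_def)

context coefficient_subring
begin

text \<open>
  This removes the record update and its derived inverse from the definition, so that all
  computations with primes take place in the ambient ring.
\<close>

lemma primeideal_iff:
  "primeideal q (L\<lparr>carrier := A\<rparr>) \<longleftrightarrow> q \<subseteq> A \<and> closed_submodule A q \<and> \<one> \<notin> q \<and>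
     (\<forall>a\<in>A. \<forall>b\<in>A. a \<otimes> b \<in> q \<longrightarrow> a \<in> q \<or> b \<in> q)"
proof
  assume "primeideal q (L\<lparr>carrier := A\<rparr>)"
  then interpret q: primeideal q "L\<lparr>carrier := A\<rparr>" .
  have "\<one> \<notin> q" using q.one_imp_carrier q.I_notcarr by auto
  moreover have "a \<in> q \<or> b \<in> q" if "a \<in> A" "b \<in> A" "a \<otimes> b \<in> q" for a b
    using q.I_prime[of a b] that by simp
  ultimately show "q \<subseteq> A \<and> closed_submodule A q \<and> \<one> \<notin> q \<and>
     (\<forall>a\<in>A. \<forall>b\<in>A. a \<otimes> b \<in> q \<longrightarrow> a \<in> q \<or> b \<in> q)"
    using ideal_iff_submodule[of q] q.is_ideal by blast
next
  assume q: "q \<subseteq> A \<and> closed_submodule A q \<and> \<one> \<notin> q \<and>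
     (\<forall>a\<in>A. \<forall>b\<in>A. a \<otimes> b \<in> q \<longrightarrow> a \<in> q \<or> b \<in> q)"
  then have "ideal q (L\<lparr>carrier := A\<rparr>)" using ideal_iff_submodule by blast
  moreover have "A \<noteq> q" using q by auto
  ultimately show "primeideal q (L\<lparr>carrier := A\<rparr>)"
    using q by (intro primeidealI ring_A) auto
qed

lemma primeD:
  assumes "primeideal q (L\<lparr>carrier := A\<rparr>)"
  shows "x \<in> q \<Longrightarrow> x \<in> A" "closed_submodule A q" "\<one> \<notin> q"
    "\<lbrakk> a \<in> A; b \<in> A; a \<otimes> b \<in> q \<rbrakk> \<Longrightarrow> a \<in> q \<or> b \<in> q"
  using assms unfolding primeideal_iff by blast+

lemma submodule_finsum:
  assumes "closed_submodule A N" "\<And>i. i \<in> I \<Longrightarrow> f i \<in> N"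
  shows "(\<Oplus>i\<in>I. f i) \<in> N"
  using assms(2)
proof (induction I rule: infinite_finite_induct)
  case (insert i I)
  then have "(\<Oplus>i\<in>insert i I. f i) = f i \<oplus> (\<Oplus>i\<in>I. f i)"
    using submoduleD(2)[OF assms(1)] by (intro finsum_insert) auto
  then show ?case using insert submoduleD(4)[OF assms(1)] by auto
qed (use submoduleD(3)[OF assms(1)] in auto)

lemma A_finsum [intro]: "(\<And>i. i \<in> I \<Longrightarrow> f i \<in> A) \<Longrightarrow> (\<Oplus>i\<in>I. f i) \<in> A"
  by (rule submodule_finsum) (auto simp: closed_submodule_def A_carrier)

lemma A_finprod [intro]: "(\<And>i. i \<in> I \<Longrightarrow> f i \<in> A) \<Longrightarrow> (\<Otimes>i\<in>I. f i) \<in> A"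
proof (induction I rule: infinite_finite_induct)
  case (insert i I)
  then have "(\<Otimes>i\<in>insert i I. f i) = f i \<otimes> (\<Otimes>i\<in>I. f i)"
    by (intro finprod_insert) (auto simp: A_carrier)
  then show ?case using insert by auto
qed auto

lemma nat_multiple_of_one_in [simp, intro]: "[n] \<cdot> \<one> \<in> A" for n :: nat
  by (induction n) (auto simp: add_pow_def)

lemma cong_mod_trans:
  assumes "closed_submodule A q" "a \<in> A" "b \<in> A" "c \<in> A" "a \<ominus> b \<in> q" "b \<ominus> c \<in> q" shows "a \<ominus> c \<in> q"
proof -
  have "(a \<ominus> b) \<oplus> (b \<ominus> c) \<in> q" using submoduleD(4)[OF assms(1)] assms(5,6) .
  also have "(a \<ominus> b) \<oplus> (b \<ominus> c) = a \<ominus> c" using assms(2-4)[THEN A_carrier] by algebra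
  finally show ?thesis .
qed

lemma cong_mod_sym:
  assumes "closed_submodule A q" "a \<in> A" "b \<in> A" "a \<ominus> b \<in> q" shows "b \<ominus> a \<in> q"
proof -
  have "\<ominus> (a \<ominus> b) \<in> q" using submoduleD(6)[OF assms(1,4)] .
  also have "\<ominus> (a \<ominus> b) = b \<ominus> a" using assms(2-3)[THEN A_carrier] by algebra
  finally show ?thesis .
qed

lemma finsum_cong_mod:
  assumes N: "closed_submodule A N"
    and "\<And>i. i \<in> I \<Longrightarrow> f i \<in> A" "\<And>i. i \<in> I \<Longrightarrow> f' i \<in> A" "\<And>i. i \<in> I \<Longrightarrow> f i \<ominus> f' i \<in> N"
  shows "(\<Oplus>i\<in>I. f i) \<ominus> (\<Oplus>i\<in>I. f' i) \<in> N"
proof -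
  have "(\<Oplus>i\<in>I. f i \<ominus> f' i) \<in> N" using assms by (intro submodule_finsum) auto
  then show ?thesis using finsum_minus[of I f f'] assms(2,3) A_carrier by simp
qed

lemma finprod_cong_mod:
  assumes N: "closed_submodule A N"
    and "\<And>i. i \<in> I \<Longrightarrow> f i \<in> A" "\<And>i. i \<in> I \<Longrightarrow> f' i \<in> A" "\<And>i. i \<in> I \<Longrightarrow> f i \<ominus> f' i \<in> N"
  shows "(\<Otimes>i\<in>I. f i) \<ominus> (\<Otimes>i\<in>I. f' i) \<in> N"
  using assms(2-)
proof (induction I rule: infinite_finite_induct)
  case (insert i I)
  let ?P = "\<Otimes>i\<in>I. f i" and ?Q = "\<Otimes>i\<in>I. f' i"
  have A: "f i \<in> A" "f' i \<in> A" "?P \<in> A" "?Q \<in> A" using insert.prems by auto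
  note c = A[THEN A_carrier]
  have "f i \<otimes> (?P \<ominus> ?Q) \<oplus> ?Q \<otimes> (f i \<ominus> f' i) \<in> N"
    using insert A by (intro submoduleD(4)[OF N] submoduleD(5)[OF N]) auto
  also have "f i \<otimes> (?P \<ominus> ?Q) \<oplus> ?Q \<otimes> (f i \<ominus> f' i) = f i \<otimes> ?P \<ominus> f' i \<otimes> ?Q"
    using c by algebra
  also have "f i \<otimes> ?P = (\<Otimes>i\<in>insert i I. f i)"
    using insert by (intro finprod_insert[symmetric]) (auto simp: A_carrier)
  also have "f' i \<otimes> ?Q = (\<Otimes>i\<in>insert i I. f' i)"
    using insert by (intro finprod_insert[symmetric]) (auto simp: A_carrier)
  finally show ?case .
qed (use submoduleD(3)[OF N] in \<open>simp_all add: a_minus_def r_neg\<close>)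

text \<open>
  The submodule generated by \<open>N\<close> and \<open>a\<close>, which enters the maximality argument for primes over \<open>p\<close>.
\<close>

lemma extend_submodule:
  assumes "closed_submodule A N" "a \<in> carrier L"
  shows "closed_submodule A {y \<oplus> a \<otimes> s | y s. y \<in> N \<and> s \<in> A}"
proof -
  note N = submoduleD[OF assms(1)]
  let ?E = "{y \<oplus> a \<otimes> s | y s. y \<in> N \<and> s \<in> A}"
  have mem: "y \<oplus> a \<otimes> s \<in> ?E" if "y \<in> N" "s \<in> A" for y s using that by blast
  show ?thesis
    unfolding closed_submodule_def
  proof (intro conjI ballI subsetI)
    show "\<zero> \<in> ?E" using mem[of \<zero> \<zero>] N(3) assms by simp
    show "x \<in> carrier L" if "x \<in> ?E" for x using that N(2) assms(2) A_carrier by auto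
    show "x \<oplus> x' \<in> ?E" if xx: "x \<in> ?E" "x' \<in> ?E" for x x'
    proof -
      obtain y s y' s' where y: "y \<in> N" "y' \<in> N" "s \<in> A" "s' \<in> A" "x = y \<oplus> a \<otimes> s" "x' = y' \<oplus> a \<otimes> s'"
        using xx by blast
      then have "x \<oplus> x' = (y \<oplus> y') \<oplus> a \<otimes> (s \<oplus> s')"
        using N(2) assms A_carrier by (simp add: r_distr a_ac)
      then show ?thesis using mem[of "y \<oplus> y'" "s \<oplus> s'"] y N(4) by simp
    qed
    show "c \<otimes> x \<in> ?E" if c: "c \<in> A" and x: "x \<in> ?E" for c x
    proof -
      obtain y s where y: "y \<in> N" "s \<in> A" "x = y \<oplus> a \<otimes> s" using x by blast
      then have "c \<otimes> x = c \<otimes> y \<oplus> a \<otimes> (c \<otimes> s)"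
        using N(2) assms A_carrier c by (simp add: r_distr m_lcomm)
      then show ?thesis using mem[of "c \<otimes> y" "c \<otimes> s"] y N(5) c by simp
    qed
  qed
qed

lemma prime_pow:
  assumes "primeideal q (L\<lparr>carrier := A\<rparr>)" "a \<in> A" "a [^] (n::nat) \<in> q"
  shows "a \<in> q"
  using assms(3)
proof (induction n)
  case 0
  then show ?case using primeD(3)[OF assms(1)] by simp
next
  case (Suc n)
  then have "a [^] n \<in> q \<or> a \<in> q" using primeD(4)[OF assms(1), of "a [^] n" a] assms(2) by simp
  then show ?case using Suc.IH by blast
qed

lemma prime_finprod:
  assumes q: "primeideal q (L\<lparr>carrier := A\<rparr>)" and "\<And>i. i \<in> I \<Longrightarrow> f i \<in> A" "(\<Otimes>i\<in>I. f i) \<in> q"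
  shows "\<exists>i\<in>I. f i \<in> q"
  using assms(2,3)
proof (induction I rule: infinite_finite_induct)
  case (insert i I)
  then have "(\<Otimes>i\<in>insert i I. f i) = f i \<otimes> (\<Otimes>i\<in>I. f i)"
    by (intro finprod_insert) (auto simp: A_carrier)
  moreover have "(\<Otimes>i\<in>I. f i) \<in> A" using insert.prems by auto
  ultimately have "f i \<in> q \<or> (\<Otimes>i\<in>I. f i) \<in> q" using primeD(4)[OF q] insert.prems by auto
  then show ?case using insert by auto
qed (use primeD(3)[OF q] in auto)

lemma finprod_in_submodule:
  assumes "closed_submodule A N" "finite I" "j \<in> I" "f j \<in> N" "\<And>i. i \<in> I \<Longrightarrow> f i \<in> A"
  shows "(\<Otimes>i\<in>I. f i) \<in> N"
proof -
  have "(\<Otimes>i\<in>insert j (I - {j}). f i) = f j \<otimes> (\<Otimes>i\<in>I - {j}. f i)"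
    using assms by (intro finprod_insert) (auto simp: A_carrier)
  moreover have "(\<Otimes>i\<in>I - {j}. f i) \<in> A" using assms by auto
  moreover have "f j \<otimes> (\<Otimes>i\<in>I - {j}. f i) = (\<Otimes>i\<in>I - {j}. f i) \<otimes> f j"
    using assms calculation(2) by (intro m_comm) (auto simp: A_carrier)
  ultimately show ?thesis using submoduleD(5)[OF assms(1)] assms by (simp add: insert_absorb)
qed

text \<open>
  Induction over the finite set of primes.  If \<open>x\<close> avoids the earlier primes but lies in \<open>P\<close>, add an
  element of \<open>q'\<close> that lies in all the earlier primes but not in \<open>P\<close>; incomparability supplies it.
\<close>

lemma prime_avoidance:
  assumes q': "closed_submodule A q'" "q' \<subseteq> A" and fin: "finite \<Q>"
    and prime: "\<And>P. P \<in> \<Q> \<Longrightarrow> primeideal P (L\<lparr>carrier := A\<rparr>)"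
    and incomp: "\<And>P P'. \<lbrakk> P \<in> \<Q>; P' \<in> \<Q>; P \<subseteq> P' \<rbrakk> \<Longrightarrow> P = P'"
    and not_sub: "\<And>P. P \<in> \<Q> \<Longrightarrow> \<not> q' \<subseteq> P"
  shows "\<exists>x\<in>q'. \<forall>P\<in>\<Q>. x \<notin> P"
proof -
  note M = submoduleD[OF q'(1)]
  have "\<exists>x\<in>q'. \<forall>P\<in>\<R>. x \<notin> P" if "finite \<R>" "\<R> \<subseteq> \<Q>" for \<R>
    using that
  proof (induction \<R> rule: finite_induct)
    case empty
    show ?case using M(3) by blast
  next
    case (insert P \<R>)
    have PQ: "P \<in> \<Q>" and RQ: "\<R> \<subseteq> \<Q>" using insert.prems by simp_all
    obtain x where x: "x \<in> q'" "\<And>P'. P' \<in> \<R> \<Longrightarrow> x \<notin> P'" using insert.IH[OF RQ] by blast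
    note primeP = prime[OF PQ]
    note PD = primeD[OF primeP]
    show ?case
    proof (cases "x \<in> P")
      case False
      then show ?thesis using x by blast
    next
      case True
      have "\<exists>y. y \<in> P' \<and> y \<notin> P" if P': "P' \<in> \<R>" for P'
      proof (rule ccontr)
        assume "\<not> ?thesis"
        then have "P' = P" by (intro incomp[OF subsetD[OF RQ P'] PQ] subsetI) simp
        then show False using P' insert.hyps(2) by simp
      qed
      then obtain y where y: "\<And>P'. P' \<in> \<R> \<Longrightarrow> y P' \<in> P'" "\<And>P'. P' \<in> \<R> \<Longrightarrow> y P' \<notin> P" by metis
      have yS: "y P' \<in> A" if "P' \<in> \<R>" for P' using primeD(1)[OF prime[OF subsetD[OF RQ that]] y(1)[OF that]] .
      obtain z where z: "z \<in> q'" "z \<notin> P" using not_sub[OF PQ] by blast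
      define u where "u = (\<Otimes>P'\<in>\<R>. y P')"
      have uS: "u \<in> A" unfolding u_def using yS by (rule A_finprod)
      have uP: "u \<notin> P"
      proof
        assume "u \<in> P"
        then have "\<exists>P'\<in>\<R>. y P' \<in> P" unfolding u_def by (intro prime_finprod[OF primeP]) (use yS in auto)
        then show False using y(2) by blast
      qed
      define w where "w = u \<otimes> z"
      have zS: "z \<in> A" using z q' by blast
      have w: "w \<in> q'" "w \<notin> P" using M(5)[OF uS z(1)] PD(4)[OF uS zS] uP z(2) by (auto simp: w_def)
      have wP': "w \<in> P'" if "P' \<in> \<R>" for P'
      proof -
        have P'D: "closed_submodule A P'" using primeD(2)[OF prime[OF subsetD[OF RQ that]]] .
        have "u \<in> P'" unfolding u_def
          using y(1)[OF that] yS insert.hyps(1) that by (intro finprod_in_submodule[OF P'D]) auto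
        then have "z \<otimes> u \<in> P'" using submoduleD(5)[OF P'D zS] by blast
        then show ?thesis using m_comm[OF A_carrier[OF zS] A_carrier[OF uS]] by (simp add: w_def)
      qed
      have c: "x \<in> carrier L" "w \<in> carrier L" using M(2) x w by auto
      have "x \<oplus> w \<in> q'" using M(4)[OF x(1) w(1)] .
      moreover have "x \<oplus> w \<notin> P"
      proof
        assume "x \<oplus> w \<in> P"
        then have "(w \<oplus> x) \<ominus> x \<in> P" using submoduleD(7)[OF PD(2) _ True] c by (simp add: a_comm)
        then show False using w(2) add_minus_cancel_right[OF c(2,1)] by simp
      qed
      moreover have "x \<oplus> w \<notin> P'" if P': "P' \<in> \<R>" for P'
      proof
        assume "x \<oplus> w \<in> P'"
        then have "(x \<oplus> w) \<ominus> w \<in> P'"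
          using submoduleD(7)[OF primeD(2)[OF prime[OF subsetD[OF RQ P']]]] wP'[OF P'] by blast
        then show False using x(2)[OF P'] add_minus_cancel_right[OF c] by simp
      qed
      ultimately show ?thesis by blast
    qed
  qed
  from this[OF fin subset_refl] show ?thesis .
qed

text \<open>
  Dedekind's argument over the domain \<open>A/q\<close>: replacing \<open>z\<close> by \<open>y z\<close> in a relation and subtracting \<open>h y\<close> times
  the original relation eliminates \<open>h\<close> and multiplies the coefficient of \<open>g\<close> by \<open>g y - h y\<close>, which is
  nonzero modulo \<open>q\<close> for a suitable \<open>y\<close>.  With \<open>q = 0\<close> it gives the independence of field automorphisms,
  and for a prime of \<open>S\<close> the independence of automorphisms that differ on the residue ring.
\<close>

lemma dedekind_independence_mod_prime:
  assumes q: "primeideal q (L\<lparr>carrier := A\<rparr>)"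
    and fin: "finite E"
    and closed: "\<And>g x. \<lbrakk> g \<in> E; x \<in> A \<rbrakk> \<Longrightarrow> g x \<in> A"
    and hmult: "\<And>g x y. \<lbrakk> g \<in> E; x \<in> A; y \<in> A \<rbrakk> \<Longrightarrow> g (x \<otimes> y) = g x \<otimes> g y"
    and hone: "\<And>g. g \<in> E \<Longrightarrow> g \<one> = \<one>"
    and distinct: "\<And>g h. \<lbrakk> g \<in> E; h \<in> E; g \<noteq> h \<rbrakk> \<Longrightarrow> \<exists>y\<in>A. g y \<ominus> h y \<notin> q"
    and coeff: "\<forall>g\<in>E. c g \<in> A"
    and vanish: "\<forall>z\<in>A. (\<Oplus>g\<in>E. c g \<otimes> g z) \<in> q"
  shows "\<forall>g\<in>E. c g \<in> q"
proof -
  note qD = primeD[OF q]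
  have "F \<subseteq> E \<Longrightarrow> \<forall>g\<in>F. c g \<in> A \<Longrightarrow> \<forall>z\<in>A. (\<Oplus>g\<in>F. c g \<otimes> g z) \<in> q \<Longrightarrow> \<forall>g\<in>F. c g \<in> q"
    if "finite F" for F c
    using that
  proof (induction F arbitrary: c rule: finite_induct)
    case (insert h F)
    have FE: "h \<in> E" "\<And>g. g \<in> F \<Longrightarrow> g \<in> E" using insert.prems(1) by auto
    have cA: "c h \<in> A" "\<And>g. g \<in> F \<Longrightarrow> c g \<in> A" using insert.prems(2) by auto
    note closedF = closed[OF FE(1)] closed[OF FE(2)]
    have split: "(\<Oplus>g\<in>insert h F. c g \<otimes> g z) = c h \<otimes> h z \<oplus> (\<Oplus>g\<in>F. c g \<otimes> g z)" if "z \<in> A" for z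
      using insert.hyps closedF cA that by (intro finsum_insert) (auto simp: A_carrier)
    \<comment> \<open>the relation after elimination of h, which is shorter and falls under the induction hypothesis\<close>
    have key: "(\<Oplus>g\<in>F. (c g \<otimes> (g y \<ominus> h y)) \<otimes> g z) \<in> q" if y: "y \<in> A" and z: "z \<in> A" for y z
    proof -
      let ?S = "\<lambda>z. \<Oplus>g\<in>F. c g \<otimes> g z"
      have carr: "c h \<in> carrier L" "h y \<in> carrier L" "h z \<in> carrier L" "?S z \<in> carrier L" "?S (y \<otimes> z) \<in> carrier L"
        using closedF cA y z by (auto simp: A_carrier intro!: finsum_closed)
      have "(\<Oplus>g\<in>F. (c g \<otimes> (g y \<ominus> h y)) \<otimes> g z)
          = (\<Oplus>g\<in>F. c g \<otimes> g (y \<otimes> z) \<ominus> h y \<otimes> (c g \<otimes> g z))"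
      proof (rule finsum_cong')
        fix g assume s: "g \<in> F"
        then have "c g \<in> carrier L" "g y \<in> carrier L" "g z \<in> carrier L"
          using closedF cA y z by (auto simp: A_carrier)
        moreover have "g (y \<otimes> z) = g y \<otimes> g z" using hmult[OF FE(2)[OF s] y z] by simp
        ultimately show "(c g \<otimes> (g y \<ominus> h y)) \<otimes> g z = c g \<otimes> g (y \<otimes> z) \<ominus> h y \<otimes> (c g \<otimes> g z)"
          using carr(2) by (simp add: a_minus_def r_distr l_distr r_minus l_minus m_ac)
      qed (use closedF cA y z carr in \<open>auto simp: A_carrier\<close>)
      also have "\<dots> = ?S (y \<otimes> z) \<ominus> (\<Oplus>g\<in>F. h y \<otimes> (c g \<otimes> g z))"
        using closedF cA y z carr by (intro finsum_minus) (auto simp: A_carrier)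
      also have "(\<Oplus>g\<in>F. h y \<otimes> (c g \<otimes> g z)) = h y \<otimes> ?S z"
        using closedF cA y z carr insert.hyps by (intro finsum_rdistr[symmetric]) (auto simp: A_carrier)
      also have "?S (y \<otimes> z) \<ominus> h y \<otimes> ?S z
         = (c h \<otimes> h (y \<otimes> z) \<oplus> ?S (y \<otimes> z)) \<ominus> h y \<otimes> (c h \<otimes> h z \<oplus> ?S z)"
        unfolding hmult[OF FE(1) y z] by (rule leading_term_cancel[OF carr(4,5,2,1,3)])
      also have "\<dots> = (\<Oplus>g\<in>insert h F. c g \<otimes> g (y \<otimes> z)) \<ominus> h y \<otimes> (\<Oplus>g\<in>insert h F. c g \<otimes> g z)"
        using split y z by simp
      also have "\<dots> \<in> q"
        using submoduleD(5,7)[OF qD(2)] bspec[OF insert.prems(3) z] bspec[OF insert.prems(3), of "y \<otimes> z"] y z closedF by auto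
      finally show ?thesis .
    qed
    have F: "c g \<in> q" if s: "g \<in> F" for g
    proof -
      have "g \<noteq> h" using s insert.hyps by auto
      then obtain y where y: "y \<in> A" "g y \<ominus> h y \<notin> q" using distinct[OF FE(2)[OF s] FE(1)] by auto
      have "\<forall>g\<in>F. c g \<otimes> (g y \<ominus> h y) \<in> q"
      proof (rule insert.IH)
        show "F \<subseteq> E" using insert.prems(1) by auto
        show "\<forall>g\<in>F. c g \<otimes> (g y \<ominus> h y) \<in> A" using cA closedF y by auto
        show "\<forall>z\<in>A. (\<Oplus>g\<in>F. c g \<otimes> (g y \<ominus> h y) \<otimes> g z) \<in> q" using key y by auto
      qed
      then have "c g \<otimes> (g y \<ominus> h y) \<in> q" using s by auto
      then show ?thesis using qD(4)[of "c g" "g y \<ominus> h y"] closedF cA s y by auto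
    qed
    have one: "c g \<otimes> g \<one> = c g" if "g \<in> insert h F" for g
    proof -
      have "c g \<in> carrier L" "g \<in> E" using that cA A_carrier FE by auto
      then show ?thesis using hone[of g] by simp
    qed
    define r where "r = (\<Oplus>g\<in>F. c g \<otimes> g \<one>)"
    have r: "r \<in> q" unfolding r_def
    proof (rule submodule_finsum[OF qD(2)])
      fix g assume "g \<in> F"
      then show "c g \<otimes> g \<one> \<in> q" using F one by simp
    qed
    have "c h \<oplus> r \<in> q"
      using bspec[OF insert.prems(3), of \<one>] split[of \<one>] one[of h] by (simp add: r_def)
    from submoduleD(7)[OF qD(2) this r] have "c h \<in> q"
      using add_minus_cancel_right[OF A_carrier[OF cA(1)] submoduleD(2)[OF qD(2) r]] by simp
    then show ?case using F by blast
  qed simp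
  from this[OF fin subset_refl coeff vanish] show ?thesis .
qed

end

section \<open>The Galois group and sums of conjugates\<close>

locale galois_extension = field L for L (structure) +
  fixes K :: "'a set"
  assumes galois: "finite_galois_extension L K"
begin

abbreviation G :: "('a \<Rightarrow> 'a) set" where "G \<equiv> carrier (aut_group L K)"

abbreviation aut_comp :: "('a \<Rightarrow> 'a) \<Rightarrow> ('a \<Rightarrow> 'a) \<Rightarrow> 'a \<Rightarrow> 'a" (infixl "\<star>" 70)
  where "g \<star> h \<equiv> g \<otimes>\<^bsub>aut_group L K\<^esub> h"

abbreviation "aut_inv \<equiv> m_inv (aut_group L K)"

abbreviation "aut_id \<equiv> \<one>\<^bsub>aut_group L K\<^esub>"

lemma subfield_K: "subfield K L"
  using galois by (simp add: finite_galois_extension_def)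

lemma K_carrier: "x \<in> K \<Longrightarrow> x \<in> carrier L"
  using subfieldE(3)[OF subfield_K] by blast

lemma fixed_field: "x \<in> K \<longleftrightarrow> x \<in> carrier L \<and> (\<forall>g\<in>G. g x = x)"
  using galois by (auto simp: finite_galois_extension_def)

lemma aut_iff: "g \<in> G \<longleftrightarrow> g \<in> Bij (carrier L) \<and> g \<in> ring_hom L L \<and> (\<forall>x\<in>K. g x = x)"
  by (auto simp: aut_group_def)

lemma aut_hom:
  assumes "g \<in> G"
  shows "x \<in> carrier L \<Longrightarrow> g x \<in> carrier L"
    "\<lbrakk> x \<in> carrier L; y \<in> carrier L \<rbrakk> \<Longrightarrow> g (x \<otimes> y) = g x \<otimes> g y"
    "\<lbrakk> x \<in> carrier L; y \<in> carrier L \<rbrakk> \<Longrightarrow> g (x \<oplus> y) = g x \<oplus> g y"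
    "g \<one> = \<one>" "x \<in> K \<Longrightarrow> g x = x" "g \<zero> = \<zero>"
  using assms fixed_field ring_hom_zero[OF _ ring_axioms ring_axioms]
  unfolding aut_iff ring_hom_def by auto

lemma aut_hom_minus:
  assumes "g \<in> G" shows "x \<in> carrier L \<Longrightarrow> g (\<ominus> x) = \<ominus> g x"
    "\<lbrakk> x \<in> carrier L; y \<in> carrier L \<rbrakk> \<Longrightarrow> g (x \<ominus> y) = g x \<ominus> g y"
proof -
  show n: "g (\<ominus> x) = \<ominus> g x" if x: "x \<in> carrier L" for x
  proof -
    have "g (\<ominus> x) \<oplus> g x = \<zero>"
      using x aut_hom(6)[OF assms] by (simp flip: aut_hom(3)[OF assms] add: l_neg)
    then show ?thesis using x aut_hom(1)[OF assms] by (simp add: sum_zero_eq_neg)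
  qed
  show "\<lbrakk> x \<in> carrier L; y \<in> carrier L \<rbrakk> \<Longrightarrow> g (x \<ominus> y) = g x \<ominus> g y"
    using n aut_hom(3)[OF assms] by (simp add: a_minus_def)
qed

lemma aut_hom_pow: "\<lbrakk> g \<in> G; x \<in> carrier L \<rbrakk> \<Longrightarrow> g (x [^] (n::nat)) = g x [^] n"
  by (induction n) (auto simp: aut_hom(1,2,4))

lemma aut_eqI:
  assumes "g \<in> G" "h \<in> G" "\<And>x. x \<in> carrier L \<Longrightarrow> g x = h x" shows "g = h"
  using assms Bij_imp_extensional unfolding aut_iff by (metis extensionalityI)

lemma aut_mult_compose: "\<lbrakk> g \<in> G; h \<in> G \<rbrakk> \<Longrightarrow> g \<star> h = compose (carrier L) g h"
  by (simp add: aut_group_def BijGroup_def)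

lemma aut_one: "aut_id = (\<lambda>x\<in>carrier L. x)"
  by (simp add: aut_group_def BijGroup_def)

lemma group_aut: "group (aut_group L K)"
proof -
  interpret B: group "BijGroup (carrier L)" by (rule group_BijGroup)
  have "subgroup G (BijGroup (carrier L))"
  proof (rule B.subgroupI)
    show "G \<subseteq> carrier (BijGroup (carrier L))" by (auto simp: aut_iff BijGroup_def)
    have "(\<lambda>x\<in>carrier L. x) \<in> G"
      using K_carrier by (auto simp: aut_iff id_Bij ring_hom_def)
    then show "G \<noteq> {}" by blast
    show "g \<otimes>\<^bsub>BijGroup (carrier L)\<^esub> h \<in> G" if "g \<in> G" "h \<in> G" for g h
    proof -
      have "compose (carrier L) g h \<in> G"
        using that compose_Bij[of g _ h] aut_hom[OF that(1)] aut_hom[OF that(2)] K_carrier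
        unfolding aut_iff[of "compose _ _ _"] by (auto simp: aut_iff ring_hom_def compose_eq)
      then show ?thesis using that by (simp add: BijGroup_def aut_iff)
    qed
    show "inv\<^bsub>BijGroup (carrier L)\<^esub> g \<in> G" if g: "g \<in> G" for g
    proof -
      let ?h = "\<lambda>x\<in>carrier L. inv_into (carrier L) g x"
      have bij: "bij_betw g (carrier L) (carrier L)" using g by (auto simp: aut_iff Bij_def)
      have inv: "inv_into (carrier L) g y = x" if "x \<in> carrier L" "y = g x" for x y
        using that bij by (simp add: bij_betw_inv_into_left)
      have clos: "inv_into (carrier L) g y \<in> carrier L" "g (inv_into (carrier L) g y) = y" if "y \<in> carrier L" for y
        using that bij by (metis bij_betw_def inv_into_into, metis bij_betw_inv_into_right)
      have "?h \<in> ring_hom L L"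
        unfolding ring_hom_def using clos aut_hom[OF g] by (auto intro!: inv)
      moreover have "\<forall>x\<in>K. ?h x = x"
        using aut_hom(5)[OF g] K_carrier inv by (metis restrict_apply)
      moreover have "?h \<in> Bij (carrier L)" using g by (simp add: aut_iff restrict_inv_into_Bij)
      ultimately have "?h \<in> G" by (simp add: aut_iff)
      then show ?thesis using g by (simp add: inv_BijGroup aut_iff)
    qed
  qed
  then show ?thesis
    using B.subgroup_imp_group by (simp add: aut_group_def)
qed

sublocale aut: group "aut_group L K" by (rule group_aut)

lemma aut_apply [simp]:
  "\<lbrakk> g \<in> G; h \<in> G; x \<in> carrier L \<rbrakk> \<Longrightarrow> (g \<star> h) x = g (h x)"
  "x \<in> carrier L \<Longrightarrow> aut_id x = x"
  "\<lbrakk> g \<in> G; x \<in> carrier L \<rbrakk> \<Longrightarrow> aut_inv g (g x) = x"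
  "\<lbrakk> g \<in> G; x \<in> carrier L \<rbrakk> \<Longrightarrow> g (aut_inv g x) = x"
proof -
  show 1: "\<And>g h. \<lbrakk> g \<in> G; h \<in> G; x \<in> carrier L \<rbrakk> \<Longrightarrow> (g \<star> h) x = g (h x)"
    by (simp add: aut_mult_compose compose_eq)
  show 2: "x \<in> carrier L \<Longrightarrow> aut_id x = x" by (simp add: aut_one)
  show "\<lbrakk> g \<in> G; x \<in> carrier L \<rbrakk> \<Longrightarrow> aut_inv g (g x) = x"
    using 1[of "aut_inv g" g] 2 by (simp add: aut.l_inv)
  show "\<lbrakk> g \<in> G; x \<in> carrier L \<rbrakk> \<Longrightarrow> g (aut_inv g x) = x"
    using 1[of g "aut_inv g"] 2 by (simp add: aut.r_inv)
qed

lemma aut_combine: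
  assumes "g \<in> G" "set Ks \<subseteq> K" "set us \<subseteq> carrier L"
  shows "g (combine Ks us) = combine Ks (map g us)"
  using assms(2,3)
proof (induction Ks us rule: combine.induct)
  case (1 k Ks u Us)
  then have "combine Ks Us \<in> carrier L" using K_carrier by (intro combine_in_carrier) auto
  then show ?case using 1 aut_hom[OF assms(1)] K_carrier by simp
qed (simp_all add: aut_hom[OF assms(1)])

lemma aut_eval:
  assumes "g \<in> G" "set p \<subseteq> K" "x \<in> carrier L"
  shows "g (eval p x) = eval p (g x)"
  using assms(2)
proof (induction p)
  case (Cons c p)
  then have "eval p x \<in> carrier L" using K_carrier assms by (intro eval_in_carrier) auto
  then show ?case
    using Cons assms(3) aut_hom[OF assms(1)] aut_hom_pow[OF assms(1)] K_carrier by simp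
qed (simp add: aut_hom[OF assms(1)])

lemma ex_basis: "\<exists>us. field_basis L K us"
proof -
  obtain n where "dimension n K (carrier L)"
    using galois by (auto simp: finite_galois_extension_def)
  then show ?thesis unfolding field_basis_def using exists_base[OF subfield_K] by blast
qed

lemma basis_in_carrier: "field_basis L K us \<Longrightarrow> set us \<subseteq> carrier L"
  using independent_in_carrier by (auto simp: field_basis_def)

text \<open>
  The conjugates of \<open>x\<close> are roots of any polynomial over \<open>K\<close> that \<open>x\<close> satisfies.
\<close>

lemma finite_conjugates:
  assumes "x \<in> carrier L" shows "finite ((\<lambda>g. g x) ` G)"
proof -
  have "(algebraic over K) x"
    using finite_dimension_imp_algebraic[OF subfield_K carrier_is_subring _ assms] galois
    by (simp add: finite_galois_extension_def)
  then obtain p where p: "p \<in> carrier (univ_poly L K)" "p \<noteq> []" "eval p x = \<zero>"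
    using algebraicE[OF subfieldE(1)[OF subfield_K] assms] by blast
  have K: "set p \<subseteq> K" using p(1) by (auto simp: univ_poly_def polynomial_def)
  have "p \<in> carrier (univ_poly L (carrier L))"
    using p(1) K K_carrier by (auto simp: univ_poly_def polynomial_def)
  then have "finite {y. is_root p y}" by (rule finite_number_of_roots)
  moreover have "(\<lambda>g. g x) ` G \<subseteq> {y. is_root p y}"

  proof clarify
    fix g assume g: "g \<in> G"
    have "eval p (g x) = \<zero>" using aut_eval[OF g K assms] aut_hom(6)[OF g] p(3) by simp
    then show "is_root p (g x)" using p(2) aut_hom(1)[OF g assms] by (simp add: is_root_def)
  qed
  ultimately show ?thesis by (rule finite_subset[rotated])
qed

text \<open>
  An automorphism is determined by its values on a basis, and each value has finitely many possibilities.
\<close>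

lemma finite_aut: "finite G"
proof -
  obtain us where us: "field_basis L K us" using ex_basis by blast
  note uc = basis_in_carrier[OF us]
  have "inj_on (\<lambda>g. map g us) G"
  proof (rule inj_onI)
    fix g h assume gh: "g \<in> G" "h \<in> G" "map g us = map h us"
    show "g = h"
    proof (rule aut_eqI[OF gh(1,2)])
      fix x assume "x \<in> carrier L"
      then have "x \<in> Span K us" using us by (simp add: field_basis_def)
      then obtain Ks where "set Ks \<subseteq> K" "x = combine Ks us"
        using Span_eq_combine_set[OF subfield_K uc] by blast
      then show "g x = h x" using aut_combine gh uc by metis
    qed
  qed
  moreover have "(\<lambda>g. map g us) ` G \<subseteq> {ys. set ys \<subseteq> (\<Union>u\<in>set us. (\<lambda>g. g u) ` G) \<and> length ys = length us}"
    by fastforce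
  moreover have "finite {ys. set ys \<subseteq> (\<Union>u\<in>set us. (\<lambda>g. g u) ` G) \<and> length ys = length us}"
    using finite_conjugates uc by (intro finite_lists_length_eq) auto
  ultimately show ?thesis by (meson finite_imageD finite_subset)
qed

lemma aut_finsum:
  assumes "g \<in> G" "\<And>i. i \<in> I \<Longrightarrow> f i \<in> carrier L"
  shows "g (\<Oplus>i\<in>I. f i) = (\<Oplus>i\<in>I. g (f i))"
  using assms(2)
proof (induction I rule: infinite_finite_induct)
  case (insert i I)
  then have "(\<Oplus>i\<in>I. f i) \<in> carrier L" by (intro finsum_closed) auto
  then show ?case using insert aut_hom[OF assms(1)] by (simp add: Pi_def)
qed (simp_all add: aut_hom[OF assms(1)])

lemma aut_finprod:
  assumes "g \<in> G" "\<And>i. i \<in> I \<Longrightarrow> f i \<in> carrier L"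
  shows "g (\<Otimes>i\<in>I. f i) = (\<Otimes>i\<in>I. g (f i))"
  using assms(2)
proof (induction I rule: infinite_finite_induct)
  case (insert i I)
  then have "(\<Otimes>i\<in>I. f i) \<in> carrier L" by (intro finprod_closed) auto
  then show ?case using insert aut_hom[OF assms(1)] by (simp add: Pi_def)
qed (simp_all add: aut_hom[OF assms(1)])

lemma aut_translate:
  assumes "g \<in> G"
  shows "inj_on (\<lambda>h. g \<star> h) G" "(\<lambda>h. g \<star> h) ` G = G"
    "inj_on (\<lambda>h. h \<star> g) G" "(\<lambda>h. h \<star> g) ` G = G"
proof -
  show l: "inj_on (\<lambda>h. g \<star> h) G" and r: "inj_on (\<lambda>h. h \<star> g) G"
    using assms by (auto intro!: inj_onI)
  show "(\<lambda>h. g \<star> h) ` G = G" "(\<lambda>h. h \<star> g) ` G = G"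
    using assms by (intro endo_inj_surj[OF finite_aut _ l] endo_inj_surj[OF finite_aut _ r]; auto)+
qed

text \<open>
  This is the trace of \<open>L/K\<close>, see \<open>field_trace_eq_conj_sum\<close>.
\<close>

definition conj_sum :: "'a \<Rightarrow> 'a" where "conj_sum x = (\<Oplus>g\<in>G. g x)"

lemma conj_sum_closed: "x \<in> carrier L \<Longrightarrow> conj_sum x \<in> carrier L"
  by (auto simp: conj_sum_def aut_hom(1) intro!: finsum_closed)

lemma conj_sum_in_K: assumes "x \<in> carrier L" shows "conj_sum x \<in> K"
proof -
  have "g (conj_sum x) = conj_sum x" if g: "g \<in> G" for g
  proof -
    have "g (conj_sum x) = (\<Oplus>h\<in>G. g (h x))"
      unfolding conj_sum_def using assms g aut_hom(1) by (intro aut_finsum) auto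
    also have "\<dots> = (\<Oplus>h\<in>G. (g \<star> h) x)"
      using assms g aut_hom(1) by (intro finsum_cong') auto
    also have "\<dots> = (\<Oplus>h\<in>(\<lambda>h. g \<star> h) ` G. h x)"
      using assms g aut_translate(1,2)[OF g] aut_hom(1) by (intro finsum_reindex[symmetric]) auto
    finally show ?thesis using aut_translate(2)[OF g] by (simp add: conj_sum_def)
  qed
  then show ?thesis using fixed_field conj_sum_closed assms by blast
qed

lemma conj_sum_aut: assumes "x \<in> carrier L" "g \<in> G" shows "conj_sum (g x) = conj_sum x"
proof -
  have "conj_sum (g x) = (\<Oplus>h\<in>G. (h \<star> g) x)"
    unfolding conj_sum_def using assms aut_hom(1) by (intro finsum_cong') auto
  also have "\<dots> = (\<Oplus>h\<in>(\<lambda>h. h \<star> g) ` G. h x)"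
    using assms aut_translate(3,4)[OF assms(2)] aut_hom(1) by (intro finsum_reindex[symmetric]) auto
  finally show ?thesis using aut_translate(4)[OF assms(2)] by (simp add: conj_sum_def)
qed

lemma conj_sum_add:
  "\<lbrakk> x \<in> carrier L; y \<in> carrier L \<rbrakk> \<Longrightarrow> conj_sum (x \<oplus> y) = conj_sum x \<oplus> conj_sum y"
proof -
  assume xy: "x \<in> carrier L" "y \<in> carrier L"
  have "conj_sum (x \<oplus> y) = (\<Oplus>g\<in>G. g x \<oplus> g y)"
    unfolding conj_sum_def using xy aut_hom(1,3) by (intro finsum_cong') auto
  also have "\<dots> = conj_sum x \<oplus> conj_sum y"
    unfolding conj_sum_def using xy aut_hom(1) by (intro finsum_addf) auto
  finally show ?thesis .
qed

lemma conj_sum_scale: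
  "\<lbrakk> k \<in> K; x \<in> carrier L \<rbrakk> \<Longrightarrow> conj_sum (k \<otimes> x) = k \<otimes> conj_sum x"
proof -
  assume xy: "k \<in> K" "x \<in> carrier L"
  have "g (k \<otimes> x) = k \<otimes> g x" if "g \<in> G" for g
    using aut_hom(2)[OF that] aut_hom(5)[OF that] xy K_carrier by simp
  then have "conj_sum (k \<otimes> x) = (\<Oplus>g\<in>G. k \<otimes> g x)"
    unfolding conj_sum_def using xy K_carrier aut_hom(1) by (intro finsum_cong') auto
  also have "\<dots> = k \<otimes> conj_sum x"
    unfolding conj_sum_def using xy K_carrier finite_aut aut_hom(1) by (intro finsum_rdistr[symmetric]) auto
  finally show ?thesis .
qed

lemma conj_sum_minus:
  assumes "x \<in> carrier L" "y \<in> carrier L" shows "conj_sum (x \<ominus> y) = conj_sum x \<ominus> conj_sum y"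
proof -
  have "x \<ominus> y = x \<oplus> \<ominus> \<one> \<otimes> y" "\<ominus> \<one> \<in> K"
    using assms subringE(3,5)[OF subfieldE(1)[OF subfield_K]] by (auto simp: a_minus_def l_minus)
  then have "conj_sum (x \<ominus> y) = conj_sum x \<oplus> \<ominus> \<one> \<otimes> conj_sum y"
    using assms conj_sum_add[of x "\<ominus> \<one> \<otimes> y"] conj_sum_scale[of "\<ominus> \<one>" y] by simp
  then show ?thesis using assms conj_sum_closed by (simp add: a_minus_def l_minus)
qed

lemma conj_sum_zero: "conj_sum \<zero> = \<zero>"
  unfolding conj_sum_def by (rule add.finprod_one_eqI) (rule aut_hom(6))

lemma conj_sum_finsum:
  assumes "\<And>i. i \<in> I \<Longrightarrow> f i \<in> carrier L"
  shows "conj_sum (\<Oplus>i\<in>I. f i) = (\<Oplus>i\<in>I. conj_sum (f i))"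
  using assms
proof (induction I rule: infinite_finite_induct)
  case (insert i I)
  then have "(\<Oplus>i\<in>I. f i) \<in> carrier L" by (intro finsum_closed) auto
  then show ?case using insert by (simp add: Pi_def conj_sum_add conj_sum_closed)
qed (auto simp: conj_sum_zero)

lemma aut_independent:
  assumes "\<And>g. g \<in> G \<Longrightarrow> c g \<in> carrier L" "\<And>z. z \<in> carrier L \<Longrightarrow> (\<Oplus>g\<in>G. c g \<otimes> g z) = \<zero>" "g \<in> G"
  shows "c g = \<zero>"
proof -
  interpret C: coefficient_subring L "carrier L"
    by (intro coefficient_subring.intro coefficient_subring_axioms.intro domain_axioms carrier_is_subring)
  have "primeideal {\<zero>} (L\<lparr>carrier := carrier L\<rparr>)" using zeroprimeideal by simp
  then have "\<forall>g\<in>G. c g \<in> {\<zero>}"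
  proof (rule C.dedekind_independence_mod_prime[OF _ finite_aut])
    show "\<exists>y\<in>carrier L. g y \<ominus> h y \<notin> {\<zero>}" if gh: "g \<in> G" "h \<in> G" "g \<noteq> h" for g h
    proof -
      obtain y where y: "y \<in> carrier L" "g y \<noteq> h y" using aut_eqI gh by blast
      then have "g y \<ominus> h y \<noteq> \<zero>" using aut_hom(1)[OF gh(1)] aut_hom(1)[OF gh(2)] by simp
      then show ?thesis using y(1) by blast
    qed
    show "\<forall>g\<in>G. c g \<in> carrier L" using assms(1) by blast
    show "\<forall>z\<in>carrier L. (\<Oplus>g\<in>G. c g \<otimes> g z) \<in> {\<zero>}" using assms(2) by blast
  qed (fact aut_hom)+
  then show ?thesis using assms(3) by simp
qed

text \<open>
  Independence of the automorphisms yields some \<open>z\<close> with nonzero sum of conjugates; scale it by an element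
  of \<open>K\<close> and divide by \<open>w\<close>.
\<close>

lemma conj_sum_nondegenerate:
  assumes "w \<in> carrier L" "w \<noteq> \<zero>" shows "\<exists>y\<in>carrier L. conj_sum (w \<otimes> y) = \<one>"
proof -
  have "\<exists>z\<in>carrier L. conj_sum z \<noteq> \<zero>"
  proof (rule ccontr)
    assume no: "\<not> ?thesis"
    have "(\<Oplus>g\<in>G. \<one> \<otimes> g z) = \<zero>" if "z \<in> carrier L" for z
    proof -
      have "(\<Oplus>g\<in>G. \<one> \<otimes> g z) = (\<Oplus>g\<in>G. g z)"
        using that aut_hom(1) by (intro finsum_cong') auto
      then show ?thesis using no that by (auto simp: conj_sum_def)
    qed
    then have "\<one> = \<zero>" using aut_independent[of "\<lambda>_. \<one>" "aut_id"] by auto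
    then show False by simp
  qed
  then obtain z where z: "z \<in> carrier L" "conj_sum z \<noteq> \<zero>" by blast
  define k where "k = inv (conj_sum z)"
  have k: "k \<in> K" "k \<otimes> conj_sum z = \<one>"
    using subfield_m_inv(1)[OF subfield_K, of "conj_sum z"] subfield_m_inv(3)[OF subfield_K, of "conj_sum z"]
      conj_sum_in_K[OF z(1)] z by (auto simp: k_def)
  have w: "inv w \<in> carrier L" "w \<otimes> inv w = \<one>"
    using assms field_Units by (auto simp: Units_inv_closed Units_r_inv)
  have "w \<otimes> (inv w \<otimes> (k \<otimes> z)) = k \<otimes> z" using w k z assms K_carrier by (simp flip: m_assoc)
  then show ?thesis using k z w K_carrier conj_sum_scale by (intro bexI[of _ "inv w \<otimes> (k \<otimes> z)"]) auto
qed

end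

section \<open>The trace is the sum of the conjugates\<close>

lemma (in ring) combine_eq_finsum_nth:
  assumes "length ks = length us" "set ks \<subseteq> carrier R" "set us \<subseteq> carrier R"
  shows "combine ks us = (\<Oplus>j\<in>{..<length us}. ks ! j \<otimes> us ! j)"
  using assms
proof (induction ks us rule: list_induct2)
  case (Cons k ks u us)
  have split: "{..<length (u # us)} = insert 0 (Suc ` {..<length us})"
    by (auto simp: lessThan_Suc_eq_insert_0)
  have c: "\<And>j. j < length us \<Longrightarrow> ks ! j \<otimes> us ! j \<in> carrier R"
    using Cons by (metis list.set_intros(2) m_closed nth_mem subset_code(1))
  have "(\<Oplus>j\<in>{..<length (u # us)}. (k # ks) ! j \<otimes> (u # us) ! j)
      = k \<otimes> u \<oplus> (\<Oplus>j\<in>Suc ` {..<length us}. (k # ks) ! j \<otimes> (u # us) ! j)"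
    unfolding split using Cons c by (subst finsum_insert) auto
  also have "(\<Oplus>j\<in>Suc ` {..<length us}. (k # ks) ! j \<otimes> (u # us) ! j) = (\<Oplus>j\<in>{..<length us}. ks ! j \<otimes> us ! j)"
    using c by (subst finsum_reindex) auto
  finally show ?case using Cons by simp
qed simp

lemma (in ring) combine_map_eq_finsum:
  assumes "distinct us" "set us \<subseteq> carrier R" "\<And>u. u \<in> set us \<Longrightarrow> f u \<in> carrier R"
  shows "combine (map f us) us = (\<Oplus>u\<in>set us. f u \<otimes> u)"
  using assms
proof (induction us)
  case (Cons u us)
  then have "(\<Oplus>v\<in>insert u (set us). f v \<otimes> v) = f u \<otimes> u \<oplus> (\<Oplus>v\<in>set us. f v \<otimes> v)"
    by (intro finsum_insert) auto
  then show ?case using Cons by simp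
qed simp

lemma (in ring) finsum_swap:
  assumes "finite I" "finite J" "\<And>i j. \<lbrakk> i \<in> I; j \<in> J \<rbrakk> \<Longrightarrow> f i j \<in> carrier R"
  shows "(\<Oplus>i\<in>I. \<Oplus>j\<in>J. f i j) = (\<Oplus>j\<in>J. \<Oplus>i\<in>I. f i j)"
  using assms(1,3)
proof (induction I rule: finite_induct)
  case (insert k I)
  have "(\<Oplus>i\<in>insert k I. \<Oplus>j\<in>J. f i j) = (\<Oplus>j\<in>J. f k j) \<oplus> (\<Oplus>j\<in>J. \<Oplus>i\<in>I. f i j)"
    using insert by (subst finsum_insert) (auto intro!: finsum_closed)
  also have "\<dots> = (\<Oplus>j\<in>J. f k j \<oplus> (\<Oplus>i\<in>I. f i j))"
    using insert.prems by (intro finsum_addf[symmetric]) (auto intro!: finsum_closed)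
  also have "\<dots> = (\<Oplus>j\<in>J. \<Oplus>i\<in>insert k I. f i j)"
    using insert by (intro finsum_cong' refl finsum_insert[symmetric]) (auto intro!: finsum_closed)
  finally show ?case .
qed (simp add: finsum_zero)

lemma (in ring) finsum_delta:
  assumes "finite I" "i \<in> I" "\<And>j. j \<in> I \<Longrightarrow> f j \<in> carrier R"
  shows "(\<Oplus>j\<in>I. f j \<otimes> (if j = i then \<one> else \<zero>)) = f i"
proof -
  have "(\<Oplus>j\<in>I. f j \<otimes> (if j = i then \<one> else \<zero>)) = (\<Oplus>j\<in>I. if i = j then f j else \<zero>)"
    using assms by (intro finsum_cong') auto
  also have "\<dots> = f i" using assms by (intro finsum_singleton) auto
  finally show ?thesis .
qed

context galois_extension
begin

text \<open>
  A Gram-Schmidt step for the trace form.  Given a dual family of \<open>us\<close>, subtract from \<open>u\<close> its projection \<open>p\<close>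
  onto the span of \<open>us\<close>.  The difference is nonzero and orthogonal to the dual family, and some \<open>y\<close> pairs
  to \<open>1\<close> with it.  Correcting \<open>y\<close> gives the dual vector of \<open>u\<close>, and then the old dual vectors are
  made orthogonal to \<open>u\<close>.
\<close>

lemma ex_dual_family:
  assumes "independent K us"
  shows "\<exists>b. (\<forall>v\<in>set us. b v \<in> carrier L) \<and>
    (\<forall>u\<in>set us. \<forall>v\<in>set us. conj_sum (u \<otimes> b v) = (if u = v then \<one> else \<zero>))"
  using assms
proof (induction us rule: list.induct)
  case (Cons u us)
  note ind = independent_backwards[OF Cons.prems]
  obtain b where b: "\<And>v. v \<in> set us \<Longrightarrow> b v \<in> carrier L"
    and dual: "\<And>v w. \<lbrakk> v \<in> set us; w \<in> set us \<rbrakk> \<Longrightarrow> conj_sum (v \<otimes> b w) = (if v = w then \<one> else \<zero>)"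
    using Cons.IH ind(2) by blast
  have us: "set us \<subseteq> carrier L" and u: "u \<in> carrier L" and dist: "distinct us" "u \<notin> set us"
    using independent_in_carrier[OF ind(2)] ind(3) independent_distinct[OF subfield_K Cons.prems] by auto
  have usc: "v \<in> carrier L" if "v \<in> set us" for v using us that by blast
  \<comment> \<open>p is the projection of u onto the span of us\<close>
  define p where "p = (\<Oplus>v\<in>set us. conj_sum (u \<otimes> b v) \<otimes> v)"
  have coeff: "conj_sum (u \<otimes> b v) \<in> K" "conj_sum (u \<otimes> b v) \<in> carrier L" if "v \<in> set us" for v
    using b[OF that] u conj_sum_in_K conj_sum_closed by auto
  have p: "p \<in> carrier L" unfolding p_def using coeff usc by (intro finsum_closed) auto
  have "p = combine (map (\<lambda>v. conj_sum (u \<otimes> b v)) us) us"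
    unfolding p_def using combine_map_eq_finsum[OF dist(1) us coeff(2)] by simp
  moreover have "set (map (\<lambda>v. conj_sum (u \<otimes> b v)) us) \<subseteq> K" using coeff by auto
  ultimately have "p \<in> Span K us" using Span_eq_combine_set[OF subfield_K us] by blast
  then have "u \<noteq> p" using ind(1) by blast
  then obtain y where y: "y \<in> carrier L" "conj_sum ((u \<ominus> p) \<otimes> y) = \<one>"
    using conj_sum_nondegenerate[of "u \<ominus> p"] u p by auto
  define c where "c = y \<ominus> (\<Oplus>v\<in>set us. conj_sum (y \<otimes> v) \<otimes> b v)"
  have coeff': "conj_sum (y \<otimes> v) \<in> K" "conj_sum (y \<otimes> v) \<in> carrier L" if "v \<in> set us" for v
    using usc[OF that] y conj_sum_in_K conj_sum_closed by auto
  have r: "(\<Oplus>v\<in>set us. conj_sum (y \<otimes> v) \<otimes> b v) \<in> carrier L" using coeff' b by (intro finsum_closed) auto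
  have c: "c \<in> carrier L" using r y by (simp add: c_def)
  have expand: "conj_sum (x \<otimes> c) = conj_sum (x \<otimes> y) \<ominus> (\<Oplus>v\<in>set us. conj_sum (y \<otimes> v) \<otimes> conj_sum (x \<otimes> b v))"
    if x: "x \<in> carrier L" for x
  proof -
    have "x \<otimes> c = x \<otimes> y \<ominus> x \<otimes> (\<Oplus>v\<in>set us. conj_sum (y \<otimes> v) \<otimes> b v)"
      unfolding c_def using x y r by (simp add: a_minus_def r_distr r_minus)
    also have "x \<otimes> (\<Oplus>v\<in>set us. conj_sum (y \<otimes> v) \<otimes> b v) = (\<Oplus>v\<in>set us. x \<otimes> (conj_sum (y \<otimes> v) \<otimes> b v))"
      using x coeff' b by (intro finsum_rdistr) auto
    also have "\<dots> = (\<Oplus>v\<in>set us. conj_sum (y \<otimes> v) \<otimes> (x \<otimes> b v))"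
      using x coeff' b by (intro finsum_cong') (auto simp: m_lcomm)
    finally have e: "x \<otimes> c = x \<otimes> y \<ominus> (\<Oplus>v\<in>set us. conj_sum (y \<otimes> v) \<otimes> (x \<otimes> b v))" .
    have "conj_sum (\<Oplus>v\<in>set us. conj_sum (y \<otimes> v) \<otimes> (x \<otimes> b v)) = (\<Oplus>v\<in>set us. conj_sum (conj_sum (y \<otimes> v) \<otimes> (x \<otimes> b v)))"
      using x coeff' b by (intro conj_sum_finsum) auto
    also have "\<dots> = (\<Oplus>v\<in>set us. conj_sum (y \<otimes> v) \<otimes> conj_sum (x \<otimes> b v))"
      using x coeff' b by (intro finsum_cong') (auto simp: conj_sum_scale conj_sum_closed)
    finally show ?thesis
      unfolding e using x y coeff' b by (subst conj_sum_minus) (auto intro!: finsum_closed)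
  qed
  have c_us: "conj_sum (v \<otimes> c) = \<zero>" if v: "v \<in> set us" for v
  proof -
    have "(\<Oplus>w\<in>set us. conj_sum (y \<otimes> w) \<otimes> conj_sum (v \<otimes> b w))
        = (\<Oplus>w\<in>set us. conj_sum (y \<otimes> w) \<otimes> (if w = v then \<one> else \<zero>))"
      using v dual coeff' by (intro finsum_cong') auto
    also have "\<dots> = conj_sum (v \<otimes> y)"
      using v coeff' finsum_delta[of "set us" v "\<lambda>w. conj_sum (y \<otimes> w)"] usc[OF v] y by (simp add: m_comm)
    finally show ?thesis using expand[OF usc[OF v]] usc[OF v] y conj_sum_closed by simp
  qed
  have c_u: "conj_sum (u \<otimes> c) = \<one>"
  proof -
    have "conj_sum (p \<otimes> y) = (\<Oplus>v\<in>set us. conj_sum (y \<otimes> v) \<otimes> conj_sum (u \<otimes> b v))"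
    proof -
      have "p \<otimes> y = (\<Oplus>v\<in>set us. (conj_sum (u \<otimes> b v) \<otimes> v) \<otimes> y)"
        unfolding p_def using coeff usc y by (intro finsum_ldistr) auto
      also have "\<dots> = (\<Oplus>v\<in>set us. conj_sum (u \<otimes> b v) \<otimes> (y \<otimes> v))"
        using coeff usc y by (intro finsum_cong') (auto simp: m_ac)
      finally have "conj_sum (p \<otimes> y) = (\<Oplus>v\<in>set us. conj_sum (conj_sum (u \<otimes> b v) \<otimes> (y \<otimes> v)))"
        using coeff usc y by (simp add: conj_sum_finsum)
      also have "\<dots> = (\<Oplus>v\<in>set us. conj_sum (y \<otimes> v) \<otimes> conj_sum (u \<otimes> b v))"
      proof (intro finsum_cong')
        fix v assume v: "v \<in> set us"
        have "conj_sum (conj_sum (u \<otimes> b v) \<otimes> (y \<otimes> v)) = conj_sum (u \<otimes> b v) \<otimes> conj_sum (y \<otimes> v)"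
          using coeff(1)[OF v] usc[OF v] y by (intro conj_sum_scale) auto
        also have "\<dots> = conj_sum (y \<otimes> v) \<otimes> conj_sum (u \<otimes> b v)"
          using coeff(2)[OF v] coeff'(2)[OF v] by (rule m_comm)
        finally show "conj_sum (conj_sum (u \<otimes> b v) \<otimes> (y \<otimes> v)) = conj_sum (y \<otimes> v) \<otimes> conj_sum (u \<otimes> b v)" .
      qed (use coeff coeff' in auto)
      finally show ?thesis .
    qed
    moreover have "(u \<ominus> p) \<otimes> y = u \<otimes> y \<ominus> p \<otimes> y"
      using u p y by (simp add: a_minus_def l_distr l_minus)
    then have "\<one> = conj_sum (u \<otimes> y) \<ominus> conj_sum (p \<otimes> y)"
      using y u p by (simp flip: y(2) add: conj_sum_minus)
    ultimately show ?thesis using expand[OF u] by simp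
  qed
  \<comment> \<open>c is dual to u; the remaining vectors lose their pairing with u\<close>
  define b' where "b' = (\<lambda>v. if v = u then c else b v \<ominus> conj_sum (u \<otimes> b v) \<otimes> c)"
  have shift: "conj_sum (x \<otimes> (b v \<ominus> conj_sum (u \<otimes> b v) \<otimes> c))
      = conj_sum (x \<otimes> b v) \<ominus> conj_sum (u \<otimes> b v) \<otimes> conj_sum (x \<otimes> c)"
    if x: "x \<in> carrier L" and v: "v \<in> set us" for x v
  proof -
    have "x \<otimes> (b v \<ominus> conj_sum (u \<otimes> b v) \<otimes> c) = x \<otimes> b v \<ominus> conj_sum (u \<otimes> b v) \<otimes> (x \<otimes> c)"
      using x b[OF v] coeff(2)[OF v] c by (simp add: a_minus_def r_distr r_minus m_lcomm)
    then show ?thesis using x b[OF v] coeff[OF v] c by (simp add: conj_sum_minus conj_sum_scale)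
  qed
  have "b' v \<in> carrier L" if "v \<in> set (u # us)" for v
    using that b coeff c by (auto simp: b'_def)
  moreover have "conj_sum (x \<otimes> b' v) = (if x = v then \<one> else \<zero>)"
    if x: "x \<in> set (u # us)" and v: "v \<in> set (u # us)" for x v
  proof (cases "v = u")
    case True
    then show ?thesis using x c_u c_us dist by (auto simp: b'_def)
  next
    case False
    then have v: "v \<in> set us" using v by simp
    have xc: "x \<in> carrier L" using x u usc by auto
    have "conj_sum (x \<otimes> b' v) = conj_sum (x \<otimes> b v) \<ominus> conj_sum (u \<otimes> b v) \<otimes> conj_sum (x \<otimes> c)"
      using shift[OF xc v] False by (simp add: b'_def)
    then show ?thesis using x False v c_u c_us dual coeff[OF v] by (auto simp: a_minus_def r_neg)
  qed
  ultimately show ?case by blast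
next
  case Nil
  show ?case by simp
qed

text \<open>
  With a dual family \<open>b\<close> of the basis \<open>u\<close>, the diagonal entries are \<open>T (x u\<^sub>i b\<^sub>i)\<close>, so the matrix trace is
  \<open>T (x c)\<close> for \<open>c = \<Sum> u\<^sub>i b\<^sub>i\<close>.  To see \<open>c = 1\<close>, write the expansion \<open>y = \<Sum> T (y b\<^sub>j) u\<^sub>j\<close> as a combination of
  the automorphisms applied to \<open>y\<close>; by their independence the coefficient of the identity, which is \<open>c\<close>,
  equals \<open>1\<close>.
\<close>

lemma matrix_trace_eq_conj_sum:
  assumes us: "field_basis L K us" and x: "x \<in> carrier L"
    and M: "\<And>i j. \<lbrakk> i < length us; j < length us \<rbrakk> \<Longrightarrow> M i j \<in> K"
    and mult: "\<And>i. i < length us \<Longrightarrow> x \<otimes> us ! i = combine (map (M i) [0..<length us]) us"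
  shows "(\<Oplus>i\<in>{..<length us}. M i i) = conj_sum x"
proof -
  define n where "n = length us"
  have ind: "independent K us" and span: "Span K us = carrier L" using us by (auto simp: field_basis_def)
  have usc: "set us \<subseteq> carrier L" using basis_in_carrier[OF us] .
  have uc: "us ! i \<in> carrier L" if "i < n" for i using usc that by (auto simp: n_def)
  have dist: "distinct us" using independent_distinct[OF subfield_K ind] .
  obtain b0 where b0: "\<And>v. v \<in> set us \<Longrightarrow> b0 v \<in> carrier L"
    "\<And>u v. \<lbrakk> u \<in> set us; v \<in> set us \<rbrakk> \<Longrightarrow> conj_sum (u \<otimes> b0 v) = (if u = v then \<one> else \<zero>)"
    using ex_dual_family[OF ind] by blast
  define b where "b j = b0 (us ! j)" for j
  have b: "b j \<in> carrier L" if "j < n" for j using b0 that by (simp add: b_def n_def)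
  have dual: "conj_sum (us ! i \<otimes> b j) = (if i = j then \<one> else \<zero>)" if "i < n" "j < n" for i j
    using b0(2)[of "us ! i" "us ! j"] that dist by (simp add: b_def n_def nth_eq_iff_index_eq)
  \<comment> \<open>coordinates are read off by pairing with the dual family\<close>
  have coord: "conj_sum (combine ks us \<otimes> b j) = ks ! j"
    if ks: "set ks \<subseteq> K" "length ks = n" and j: "j < n" for ks j
  proof -
    have kc: "ks ! i \<in> K" "ks ! i \<in> carrier L" if "i < n" for i
      using ks that K_carrier nth_mem by blast+
    have "combine ks us = (\<Oplus>i\<in>{..<n}. ks ! i \<otimes> us ! i)"
      using ks usc K_carrier by (subst combine_eq_finsum_nth) (auto simp: n_def)
    then have "combine ks us \<otimes> b j = (\<Oplus>i\<in>{..<n}. (ks ! i \<otimes> us ! i) \<otimes> b j)"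
      using kc uc b[OF j] by (simp add: finsum_ldistr)
    also have "\<dots> = (\<Oplus>i\<in>{..<n}. ks ! i \<otimes> (us ! i \<otimes> b j))"
      using kc uc b[OF j] by (intro finsum_cong') (auto simp: m_assoc)
    finally have "conj_sum (combine ks us \<otimes> b j) = (\<Oplus>i\<in>{..<n}. conj_sum (ks ! i \<otimes> (us ! i \<otimes> b j)))"
      using kc uc b[OF j] by (simp only:) (intro conj_sum_finsum, auto)
    also have "\<dots> = (\<Oplus>i\<in>{..<n}. ks ! i \<otimes> (if i = j then \<one> else \<zero>))"
      using kc uc b[OF j] dual j by (intro finsum_cong') (auto simp: conj_sum_scale)
    also have "\<dots> = ks ! j" using kc j by (intro finsum_delta) auto
    finally show ?thesis .
  qed
  have aut_c: "g y \<in> carrier L" if "g \<in> G" "y \<in> carrier L" for g y using aut_hom(1) that .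
  \<comment> \<open>d g is the coefficient of g when the identity map is written as a combination of automorphisms\<close>
  define d where "d g = (\<Oplus>j\<in>{..<n}. g (b j) \<otimes> us ! j)" for g
  have d: "d g \<in> carrier L" if "g \<in> G" for g
    unfolding d_def using that b uc aut_c by (intro finsum_closed) auto
  have repr: "(\<Oplus>g\<in>G. d g \<otimes> g y) = y" if y: "y \<in> carrier L" for y
  proof -
    obtain ks where ks: "set ks \<subseteq> K" "length ks = n" "y = combine ks us"
      using Span_mem_iff_length_version[OF subfield_K usc] y span by (auto simp: n_def)
    have "y = (\<Oplus>j\<in>{..<n}. ks ! j \<otimes> us ! j)"
      using ks usc K_carrier by (subst ks(3), subst combine_eq_finsum_nth) (auto simp: n_def)
    also have "\<dots> = (\<Oplus>j\<in>{..<n}. conj_sum (y \<otimes> b j) \<otimes> us ! j)"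
      using coord ks uc b y by (intro finsum_cong') (auto intro!: conj_sum_closed)
    also have "\<dots> = (\<Oplus>j\<in>{..<n}. \<Oplus>g\<in>G. g (b j) \<otimes> us ! j \<otimes> g y)"
    proof (intro finsum_cong')
      fix j assume j: "j \<in> {..<n}"
      have "conj_sum (y \<otimes> b j) \<otimes> us ! j = (\<Oplus>g\<in>G. g (y \<otimes> b j) \<otimes> us ! j)"
        unfolding conj_sum_def using j y b uc aut_c finite_aut by (intro finsum_ldistr) auto
      also have "\<dots> = (\<Oplus>g\<in>G. g (b j) \<otimes> us ! j \<otimes> g y)"
        using j y b uc aut_c by (intro finsum_cong') (auto simp: aut_hom(2) m_ac)
      finally show "conj_sum (y \<otimes> b j) \<otimes> us ! j = (\<Oplus>g\<in>G. g (b j) \<otimes> us ! j \<otimes> g y)" .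
    qed (use b uc aut_c y in \<open>auto intro!: finsum_closed\<close>)
    also have "\<dots> = (\<Oplus>g\<in>G. \<Oplus>j\<in>{..<n}. g (b j) \<otimes> us ! j \<otimes> g y)"
      using b uc aut_c y finite_aut by (intro finsum_swap) auto
    also have "\<dots> = (\<Oplus>g\<in>G. d g \<otimes> g y)"
      unfolding d_def using b uc aut_c y
      by (intro finsum_cong' refl finsum_ldistr[symmetric]) (auto intro!: finsum_closed)
    finally show ?thesis ..
  qed
  have id_G: "aut_id \<in> G" by simp
  have d_id: "d aut_id = \<one>"
  proof -
    define \<delta> where "\<delta> g = (if aut_id = g then \<one> else \<zero>)" for g
    have \<delta>c: "\<delta> g \<in> carrier L" for g by (simp add: \<delta>_def)
    have "(\<Oplus>g\<in>G. (d g \<ominus> \<delta> g) \<otimes> g z) = \<zero>" if z: "z \<in> carrier L" for z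
    proof -
      have "(\<Oplus>g\<in>G. (d g \<ominus> \<delta> g) \<otimes> g z) = (\<Oplus>g\<in>G. d g \<otimes> g z \<ominus> \<delta> g \<otimes> g z)"
        using d \<delta>c aut_c z by (intro finsum_cong') (auto simp: a_minus_def l_distr l_minus)
      also have "\<dots> = (\<Oplus>g\<in>G. d g \<otimes> g z) \<ominus> (\<Oplus>g\<in>G. \<delta> g \<otimes> g z)"
        using d \<delta>c aut_c z by (intro finsum_minus) auto
      also have "(\<Oplus>g\<in>G. \<delta> g \<otimes> g z) = (\<Oplus>g\<in>G. if aut_id = g then g z else \<zero>)"
        using aut_c z by (intro finsum_cong') (auto simp: \<delta>_def)
      also have "\<dots> = aut_id z"
        using id_G finite_aut aut_c z by (intro finsum_singleton) auto
      finally show ?thesis using repr z by simp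
    qed
    then have "d aut_id \<ominus> \<delta> aut_id = \<zero>"
      using d \<delta>c by (intro aut_independent[of "\<lambda>g. d g \<ominus> \<delta> g"]) auto
    then show ?thesis using d[OF id_G] by (simp add: \<delta>_def)
  qed
  have "d aut_id = (\<Oplus>i\<in>{..<n}. us ! i \<otimes> b i)"
    unfolding d_def using b uc by (intro finsum_cong') (auto simp: m_comm)
  then have one: "(\<Oplus>i\<in>{..<n}. us ! i \<otimes> b i) = \<one>" using d_id by simp
  have "(\<Oplus>i\<in>{..<n}. M i i) = (\<Oplus>i\<in>{..<n}. conj_sum (x \<otimes> (us ! i \<otimes> b i)))"
  proof (intro finsum_cong')
    fix i assume i: "i \<in> {..<n}"
    have "conj_sum (combine (map (M i) [0..<n]) us \<otimes> b i) = map (M i) [0..<n] ! i"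
      using i M by (intro coord) (auto simp: n_def)
    then have "conj_sum (x \<otimes> us ! i \<otimes> b i) = M i i"
      using i mult[of i] by (simp add: n_def)
    then show "M i i = conj_sum (x \<otimes> (us ! i \<otimes> b i))"
      using i x uc b by (simp add: m_assoc)
  qed (use x uc b in \<open>auto intro!: conj_sum_closed\<close>)
  also have "\<dots> = conj_sum (\<Oplus>i\<in>{..<n}. x \<otimes> (us ! i \<otimes> b i))"
    using x uc b by (intro conj_sum_finsum[symmetric]) auto
  also have "(\<Oplus>i\<in>{..<n}. x \<otimes> (us ! i \<otimes> b i)) = x \<otimes> (\<Oplus>i\<in>{..<n}. us ! i \<otimes> b i)"
    using x uc b by (intro finsum_rdistr[symmetric]) auto
  finally show ?thesis using one x by (simp add: n_def)
qed

lemma field_trace_eq_conj_sum: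
  assumes x: "x \<in> carrier L" shows "field_trace L K x = conj_sum x"
  unfolding field_trace_def
proof (rule the_equality)
  obtain us where us: "field_basis L K us" using ex_basis by blast
  note usc = basis_in_carrier[OF us]
  have "\<exists>ks. set ks \<subseteq> K \<and> length ks = length us \<and> x \<otimes> us ! i = combine ks us" if "i < length us" for i
  proof -
    have "us ! i \<in> carrier L" using usc nth_mem[OF that] by blast
    then have "x \<otimes> us ! i \<in> Span K us" using us x unfolding field_basis_def by (metis m_closed)
    then show ?thesis using Span_mem_iff_length_version[OF subfield_K usc] by blast
  qed
  then obtain ks where ks: "\<And>i. i < length us \<Longrightarrow> set (ks i) \<subseteq> K"
    "\<And>i. i < length us \<Longrightarrow> length (ks i) = length us"
    "\<And>i. i < length us \<Longrightarrow> x \<otimes> us ! i = combine (ks i) us" by metis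
  define M where "M i j = ks i ! j" for i j
  have "map (M i) [0..<length us] = ks i" if "i < length us" for i
    using ks(2)[OF that] by (intro nth_equalityI) (auto simp: M_def)
  then have mult: "\<And>i. i < length us \<Longrightarrow> x \<otimes> us ! i = combine (map (M i) [0..<length us]) us" using ks(3) by simp
  moreover have M: "\<And>i j. \<lbrakk> i < length us; j < length us \<rbrakk> \<Longrightarrow> M i j \<in> K"
    unfolding M_def using ks(1,2) by (metis nth_mem subsetD)
  ultimately show "\<exists>us M. field_basis L K us \<and> (\<forall>i<length us. \<forall>j<length us. M i j \<in> K) \<and>
     (\<forall>i<length us. x \<otimes> us ! i = combine (map (M i) [0..<length us]) us) \<and>
     conj_sum x = (\<Oplus>i\<in>{..<length us}. M i i)"
    using us matrix_trace_eq_conj_sum[OF us x, where M = M]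
    by (intro exI[of _ us] exI[of _ M] conjI) simp_all
next
  fix t assume "\<exists>us (M :: nat \<Rightarrow> nat \<Rightarrow> 'a). field_basis L K us \<and> (\<forall>i<length us. \<forall>j<length us. M i j \<in> K) \<and>
     (\<forall>i<length us. x \<otimes> us ! i = combine (map (M i) [0..<length us]) us) \<and>
     t = (\<Oplus>i\<in>{..<length us}. M i i)"
  then obtain us and M :: "nat \<Rightarrow> nat \<Rightarrow> 'a" where us: "field_basis L K us"
    and M: "\<forall>i<length us. \<forall>j<length us. M i j \<in> K"
    and mult: "\<forall>i<length us. x \<otimes> us ! i = combine (map (M i) [0..<length us]) us"
    and t: "t = (\<Oplus>i\<in>{..<length us}. M i i)" by (elim exE conjE)
  have "(\<Oplus>i\<in>{..<length us}. M i i) = conj_sum x"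
    by (rule matrix_trace_eq_conj_sum[OF us x, where M = M]) (simp_all add: M mult)
  then show "t = conj_sum x" using t by simp
qed

end

section \<open>Primes over p\<close>

text \<open>
  Integral closedness enters through \<open>R = S \<inter> K\<close>: elements of \<open>S\<close> fixed by the Galois group, in particular
  norms, traces and symmetric functions of conjugates, lie in \<open>R\<close>.
\<close>

locale galois_normal_subring = galois_extension L K for L (structure) and K +
  fixes R S p :: "'a set"
  assumes subring_S: "subring S L"
    and R_eq: "R = S \<inter> K"
    and aut_S: "\<lbrakk> g \<in> carrier (aut_group L K); x \<in> S \<rbrakk> \<Longrightarrow> g x \<in> S"
    and prime_p: "primeideal p (L\<lparr>carrier := R\<rparr>)"
begin

sublocale S: coefficient_subring L S
  by (intro coefficient_subring.intro coefficient_subring_axioms.intro domain_axioms subring_S)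

lemma subring_R: "subring R L"
  unfolding R_eq using subring_inter[OF subring_S subfieldE(1)[OF subfield_K]] .

sublocale R: coefficient_subring L R
  by (intro coefficient_subring.intro coefficient_subring_axioms.intro domain_axioms subring_R)

lemma R_S: "x \<in> R \<Longrightarrow> x \<in> S" and R_K: "x \<in> R \<Longrightarrow> x \<in> K"
  by (auto simp: R_eq)

lemma p_R: "x \<in> p \<Longrightarrow> x \<in> R"
  using R.primeD(1)[OF prime_p] .

lemma conj_prod_in_R:
  assumes "x \<in> S" shows "(\<Otimes>g\<in>G. g x) \<in> R"
proof -
  have c: "x \<in> carrier L" using assms by (rule S.A_carrier)
  have "(\<Otimes>g\<in>G. g x) \<in> S" using aut_S assms by auto
  moreover have "h (\<Otimes>g\<in>G. g x) = (\<Otimes>g\<in>G. g x)" if h: "h \<in> G" for h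
  proof -
    have "h (\<Otimes>g\<in>G. g x) = (\<Otimes>g\<in>G. h (g x))"
      using aut_hom(1) c h by (intro aut_finprod) auto
    also have "\<dots> = (\<Otimes>g\<in>G. (h \<star> g) x)"
      using c h aut_hom(1) by (intro finprod_cong') auto
    also have "\<dots> = (\<Otimes>g\<in>(\<lambda>g. h \<star> g) ` G. g x)"
      using c h aut_translate(1,2)[OF h] aut_hom(1) by (intro finprod_reindex[symmetric]) auto
    finally show ?thesis using aut_translate(2)[OF h] by simp
  qed
  ultimately show ?thesis using fixed_field S.A_carrier by (auto simp: R_eq)
qed

lemma conj_sum_in_R: "x \<in> S \<Longrightarrow> conj_sum x \<in> R"
  using conj_sum_in_K aut_S S.A_carrier unfolding R_eq conj_sum_def by auto

definition lies_over :: "'a set \<Rightarrow> bool" where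
  "lies_over q \<longleftrightarrow> primeideal q (L\<lparr>carrier := S\<rparr>) \<and> q \<inter> R = p"

lemma lies_overD:
  assumes "lies_over q"
  shows "primeideal q (L\<lparr>carrier := S\<rparr>)" "x \<in> q \<Longrightarrow> x \<in> S" "closed_submodule S q" "\<one> \<notin> q"
    "\<lbrakk> a \<in> S; b \<in> S; a \<otimes> b \<in> q \<rbrakk> \<Longrightarrow> a \<in> q \<or> b \<in> q"
    "x \<in> p \<Longrightarrow> x \<in> q" "\<lbrakk> x \<in> q; x \<in> R \<rbrakk> \<Longrightarrow> x \<in> p"
  using assms S.primeD unfolding lies_over_def by blast+

text \<open>
  This is what remains of lying over after Zorn's lemma: an ideal \<open>q\<close> of \<open>S\<close> that is maximal among those
  meeting \<open>R\<close> inside \<open>p\<close>.  Primality is the usual argument for ideals maximal with respect to a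
  multiplicative set.  If \<open>a \<in> p\<close> were not in \<open>q\<close>, some \<open>r = y + a s\<close> would lie in \<open>R - p\<close> with \<open>y \<in> q\<close>.
  The norm of \<open>y = r - a s\<close> lies in \<open>q \<inter> R \<subseteq> p\<close> and is congruent to the power \<open>r\<^sup>n\<close>, \<open>n = |G|\<close>, modulo
  \<open>a S \<inter> R\<close>, which is contained in \<open>a R \<subseteq> p\<close>.  Hence \<open>r\<^sup>n \<in> p\<close>, a contradiction.
\<close>

lemma ideal_meeting_R_prime:
  assumes q: "q \<subseteq> S" "closed_submodule S q" "q \<inter> R \<subseteq> p"
    and meet: "\<And>a. \<lbrakk> a \<in> S; a \<notin> q \<rbrakk> \<Longrightarrow> \<exists>y\<in>q. \<exists>s\<in>S. y \<oplus> a \<otimes> s \<in> R - p"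
  shows "lies_over q"
proof -
  note qD = S.submoduleD[OF q(2)]
  note pD = R.primeD[OF prime_p] and pM = R.submoduleD[OF R.primeD(2)[OF prime_p]]
  have one: "\<one> \<notin> q" using q(3) pD(3) R.A_simps(2) by blast
  have prime: "a \<in> q \<or> b \<in> q" if ab: "a \<in> S" "b \<in> S" "a \<otimes> b \<in> q" for a b
  proof (rule ccontr)
    assume no: "\<not> ?thesis"
    then obtain y s z t where ys: "y \<in> q" "s \<in> S" "y \<oplus> a \<otimes> s \<in> R - p"
      and zt: "z \<in> q" "t \<in> S" "z \<oplus> b \<otimes> t \<in> R - p"
      using meet[of a] meet[of b] ab by blast
    have c: "y \<in> carrier L" "z \<in> carrier L" "a \<in> carrier L" "b \<in> carrier L" "s \<in> carrier L" "t \<in> carrier L"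
      using ys zt qD S.A_carrier ab by auto
    have "(z \<oplus> b \<otimes> t) \<otimes> y \<oplus> ((a \<otimes> s) \<otimes> z \<oplus> (s \<otimes> t) \<otimes> (a \<otimes> b)) \<in> q"
      using qD(5)[OF _ ys(1), of "z \<oplus> b \<otimes> t"] qD(5)[OF _ zt(1), of "a \<otimes> s"] qD(5)[OF _ ab(3), of "s \<otimes> t"]
        R_S[of "z \<oplus> b \<otimes> t"] zt(2,3) ys(2) ab(1) by (intro qD(4)) simp_all
    also have "(z \<oplus> b \<otimes> t) \<otimes> y \<oplus> ((a \<otimes> s) \<otimes> z \<oplus> (s \<otimes> t) \<otimes> (a \<otimes> b)) = (y \<oplus> a \<otimes> s) \<otimes> (z \<oplus> b \<otimes> t)"
      using c by algebra
    finally have "(y \<oplus> a \<otimes> s) \<otimes> (z \<oplus> b \<otimes> t) \<in> p" using ys zt q(3) R.A_simps(4) by blast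
    then show False using pD(4) ys zt by blast
  qed
  have "a \<in> q" if a: "a \<in> p" for a
  proof (rule ccontr)
    assume nq: "a \<notin> q"
    have aR: "a \<in> R" and aS: "a \<in> S" and aK: "a \<in> K" and ac: "a \<in> carrier L"
      using p_R[OF a] R_S R_K R.A_carrier by auto
    have a0: "a \<noteq> \<zero>" using nq qD(3) by auto
    obtain y s where ys: "y \<in> q" "s \<in> S" "y \<oplus> a \<otimes> s \<in> R - p" using meet[OF aS nq] by blast
    define r where "r = y \<oplus> a \<otimes> s"
    have r: "r \<in> R" "r \<notin> p" "r \<in> S" "r \<in> K" "r \<in> carrier L" using ys(3) R_S R_K R.A_carrier by (auto simp: r_def)
    have c: "y \<in> carrier L" "s \<in> carrier L" "y \<in> S" using ys qD S.A_carrier q by auto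
    have aS_sub: "closed_submodule S {y \<oplus> a \<otimes> s | y s. y \<in> {\<zero>} \<and> s \<in> S}"
      using ac by (intro S.extend_submodule) (auto simp: closed_submodule_def S.A_carrier)
    have "(\<Otimes>g\<in>G. g y) \<ominus> (\<Otimes>g\<in>G. r) \<in> {y \<oplus> a \<otimes> s | y s. y \<in> {\<zero>} \<and> s \<in> S}"
    proof (rule S.finprod_cong_mod[OF aS_sub])
      fix g assume g: "g \<in> G"
      have "y = r \<ominus> a \<otimes> s" unfolding r_def using c ac by algebra
      then have "g y = r \<ominus> a \<otimes> g s"
        using g c ac r by (simp add: aut_hom_minus(2)[OF g] aut_hom[OF g] aK)
      then have "g y \<ominus> r = \<zero> \<oplus> a \<otimes> (\<ominus> g s)"
        using aut_hom(1)[OF g c(2)] ac r by (simp add: a_minus_def a_ac r_minus l_minus r_neg2 r_neg)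
      then show "g y \<ominus> r \<in> {y \<oplus> a \<otimes> s | y s. y \<in> {\<zero>} \<and> s \<in> S}"
        using aut_S[OF g ys(2)] by blast
    qed (use c r aut_S in auto)
    then obtain w where w: "w \<in> S" "(\<Otimes>g\<in>G. g y) \<ominus> (\<Otimes>g\<in>G. r) = \<zero> \<oplus> a \<otimes> w" by blast
    have wc: "w \<in> carrier L" using w S.A_carrier by blast
    have const: "(\<Otimes>g\<in>G. r) = r [^] card G" using r by (simp add: finprod_const)
    have NR: "(\<Otimes>g\<in>G. g y) \<in> R" using conj_prod_in_R[OF c(3)] .
    have "(\<Otimes>g\<in>G. g y) \<in> q"
    proof (rule S.finprod_in_submodule[OF q(2) finite_aut])
      show "aut_id \<in> G" by simp
      show "aut_id y \<in> q" using ys c by simp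
    qed (use aut_S c in auto)
    then have Np: "(\<Otimes>g\<in>G. g y) \<in> p" using NR q(3) by blast
    have diff: "(\<Otimes>g\<in>G. g y) \<ominus> r [^] card G = a \<otimes> w" using w(2) wc ac const by simp
    then have awR: "a \<otimes> w \<in> R" using NR r by (metis R.A_simps(6) R.A_pow)
    have "w = inv a \<otimes> (a \<otimes> w)"
      using a0 ac wc by (simp flip: m_assoc add: field_Units Units_l_inv)
    moreover have "inv a \<in> K" using subfield_m_inv(1)[OF subfield_K] aK a0 by blast
    ultimately have "w \<in> K" using R_K[OF awR] subringE(6)[OF subfieldE(1)[OF subfield_K]] by metis
    then have "w \<in> R" using w by (simp add: R_eq)
    then have "w \<otimes> a \<in> p" using pM(5) a by blast
    then have "a \<otimes> w \<in> p" using ac wc by (simp add: m_comm)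
    moreover have "r [^] card G = (\<Otimes>g\<in>G. g y) \<ominus> a \<otimes> w"
      using R.A_carrier[OF NR] ac wc r by (simp flip: diff add: a_minus_def minus_add r_neg1 r_neg2)
    ultimately have "r [^] card G \<in> p" using pM(7)[OF Np] by simp
    then show False using R.prime_pow[OF prime_p r(1)] r(2) by blast
  qed
  then have "q \<inter> R = p" using q(3) p_R by blast
  moreover have "primeideal q (L\<lparr>carrier := S\<rparr>)"
    unfolding S.primeideal_iff using q one prime by blast
  ultimately show ?thesis by (simp add: lies_over_def)
qed

lemma ex_lies_over: "\<exists>q. lies_over q"
proof -
  define \<I> where "\<I> = {I. I \<subseteq> S \<and> closed_submodule S I \<and> I \<inter> R \<subseteq> p}"
  have pz: "\<zero> \<in> p" using R.submoduleD(3)[OF R.primeD(2)[OF prime_p]] .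
  have "{\<zero>} \<in> \<I>" using pz by (auto simp: \<I>_def closed_submodule_def S.A_carrier)
  then have "\<I> \<noteq> {}" by blast
  then have "\<exists>q\<in>\<I>. \<forall>J\<in>\<I>. q \<subseteq> J \<longrightarrow> J = q"
  proof (rule subset_Zorn_nonempty)
    fix C assume C: "C \<noteq> {}" "subset.chain \<I> C"
    then have mem: "\<And>I. I \<in> C \<Longrightarrow> I \<in> \<I>" and lin: "\<And>I J. \<lbrakk> I \<in> C; J \<in> C \<rbrakk> \<Longrightarrow> I \<subseteq> J \<or> J \<subseteq> I"
      by (auto simp: subset_chain_def)
    have sub: "\<And>I. I \<in> C \<Longrightarrow> closed_submodule S I" using mem by (auto simp: \<I>_def)
    have "x \<oplus> y \<in> \<Union>C" if xy: "x \<in> \<Union>C" "y \<in> \<Union>C" for x y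
    proof -
      obtain I J where IJ: "I \<in> C" "x \<in> I" "J \<in> C" "y \<in> J" using xy by blast
      from lin[OF IJ(1,3)] show ?thesis
      proof
        assume "I \<subseteq> J"
        then have "x \<oplus> y \<in> J" using IJ S.submoduleD(4)[OF sub[OF IJ(3)]] by blast
        then show ?thesis using IJ by blast
      next
        assume "J \<subseteq> I"
        then have "x \<oplus> y \<in> I" using IJ S.submoduleD(4)[OF sub[OF IJ(1)]] by blast
        then show ?thesis using IJ by blast
      qed
    qed
    moreover have "\<zero> \<in> \<Union>C" using C(1) S.submoduleD(3)[OF sub] by blast
    moreover have "a \<otimes> x \<in> \<Union>C" if "x \<in> \<Union>C" "a \<in> S" for a x
      using that S.submoduleD(5)[OF sub] by blast
    moreover have "\<Union>C \<subseteq> carrier L" using S.submoduleD(1)[OF sub] by blast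
    ultimately have "closed_submodule S (\<Union>C)" unfolding closed_submodule_def by blast
    then show "\<Union>C \<in> \<I>" using mem unfolding \<I>_def by blast
  qed
  then obtain q where q: "q \<in> \<I>" "\<And>J. \<lbrakk> J \<in> \<I>; q \<subseteq> J \<rbrakk> \<Longrightarrow> J = q" by blast
  have qS: "q \<subseteq> S" "closed_submodule S q" "q \<inter> R \<subseteq> p" using q(1) by (auto simp: \<I>_def)
  note qM = S.submoduleD[OF qS(2)]
  have "lies_over q"
  proof (rule ideal_meeting_R_prime[OF qS])
    fix a assume a: "a \<in> S" "a \<notin> q"
    have ac: "a \<in> carrier L" using a S.A_carrier by blast
    define J where "J = {y \<oplus> a \<otimes> s | y s. y \<in> q \<and> s \<in> S}"
    have "y \<in> J" if "y \<in> q" for y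
    proof -
      have "y = y \<oplus> a \<otimes> \<zero>" using qM(2)[OF that] ac by simp
      then show ?thesis using that S.A_simps(1) unfolding J_def by blast
    qed
    then have sub: "q \<subseteq> J" by blast
    have "a = \<zero> \<oplus> a \<otimes> \<one>" using ac by simp
    then have "a \<in> J" unfolding J_def using qM(3) S.A_simps(2) by blast
    then have "J \<notin> \<I>" using q(2) sub a(2) by blast
    moreover have "closed_submodule S J" unfolding J_def by (rule S.extend_submodule[OF qS(2) ac])
    moreover have "J \<subseteq> S" using qS(1) a S.A_simps unfolding J_def by blast
    ultimately have "\<not> J \<inter> R \<subseteq> p" unfolding \<I>_def by blast
    then show "\<exists>y\<in>q. \<exists>s\<in>S. y \<oplus> a \<otimes> s \<in> R - p" unfolding J_def by blast
  qed
  then show ?thesis by blast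
qed

end

section \<open>Elements all of whose conjugates lie in a prime\<close>

lemma (in cring) finprod_add_expand:
  assumes "finite F" "s \<in> carrier R" "\<And>i. i \<in> F \<Longrightarrow> f i \<in> carrier R"
  shows "(\<Otimes>i\<in>F. s \<oplus> f i) = (\<Oplus>B\<in>Pow F. s [^] card (F - B) \<otimes> (\<Otimes>i\<in>B. f i))"
  using assms(1,3)
proof (induction F rule: finite_induct)
  case (insert k F)
  let ?t = "\<lambda>F B. s [^] card (F - B) \<otimes> (\<Otimes>i\<in>B. f i)"
  have fk: "f k \<in> carrier R" and fF: "\<And>i. i \<in> F \<Longrightarrow> f i \<in> carrier R" using insert.prems by auto
  have prodc: "(\<Otimes>i\<in>B. f i) \<in> carrier R" if "B \<subseteq> F" for B using that fF by (intro finprod_closed) auto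
  have disj: "Pow F \<inter> insert k ` Pow F = {}" using insert.hyps by blast
  have inj: "inj_on (insert k) (Pow F)" using insert.hyps by (intro inj_onI) (metis Diff_insert_absorb PowD subsetD)
  have fin: "finite B" if "B \<subseteq> F" for B using that insert.hyps finite_subset by blast
  have prodk: "(\<Otimes>i\<in>insert k B. f i) = f k \<otimes> (\<Otimes>i\<in>B. f i)" if "B \<subseteq> F" for B
    using that insert.hyps fk fF fin by (intro finprod_insert) auto
  have "(\<Oplus>B\<in>Pow (insert k F). ?t (insert k F) B)
      = (\<Oplus>B\<in>Pow F. ?t (insert k F) B) \<oplus> (\<Oplus>B\<in>insert k ` Pow F. ?t (insert k F) B)"
    unfolding Pow_insert using insert.hyps disj assms(2) prodc prodk fk by (intro finsum_Un_disjoint) auto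
  also have "(\<Oplus>B\<in>insert k ` Pow F. ?t (insert k F) B) = (\<Oplus>B\<in>Pow F. ?t (insert k F) (insert k B))"
    using inj assms(2) prodc prodk fk by (intro finsum_reindex) auto
  also have "\<dots> = (\<Oplus>B\<in>Pow F. f k \<otimes> ?t F B)"
  proof (intro finsum_cong')
    fix B assume "B \<in> Pow F"
    then have "insert k F - insert k B = F - B" using insert.hyps by blast
    then show "?t (insert k F) (insert k B) = f k \<otimes> ?t F B"
      using \<open>B \<in> Pow F\<close> prodk prodc assms(2) fk by (simp add: m_lcomm)
  qed (use prodc assms(2) fk in auto)
  also have "\<dots> = f k \<otimes> (\<Oplus>B\<in>Pow F. ?t F B)"
    using insert.hyps prodc assms(2) fk by (intro finsum_rdistr[symmetric]) auto
  also have "(\<Oplus>B\<in>Pow F. ?t (insert k F) B) = (\<Oplus>B\<in>Pow F. s \<otimes> ?t F B)"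
  proof (intro finsum_cong')
    fix B assume B: "B \<in> Pow F"
    then have "insert k F - B = insert k (F - B)" using insert.hyps by blast
    then have "card (insert k F - B) = Suc (card (F - B))" using insert.hyps by simp
    then show "?t (insert k F) B = s \<otimes> ?t F B"
      using B prodc assms(2) by (simp add: m_ac)
  qed (use prodc assms(2) in auto)
  also have "\<dots> = s \<otimes> (\<Oplus>B\<in>Pow F. ?t F B)"
    using insert.hyps prodc assms(2) by (intro finsum_rdistr[symmetric]) auto
  also have "(\<Oplus>B\<in>Pow F. ?t F B) = (\<Otimes>i\<in>F. s \<oplus> f i)" using insert.IH fF by simp
  also have "s \<otimes> (\<Otimes>i\<in>F. s \<oplus> f i) \<oplus> f k \<otimes> (\<Otimes>i\<in>F. s \<oplus> f i) = (\<Otimes>i\<in>insert k F. s \<oplus> f i)"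
    using insert.hyps fk fF assms(2) by (simp add: l_distr Pi_def)
  finally show ?case ..
qed simp

definition (in cring) elem_sym :: "'c set \<Rightarrow> ('c \<Rightarrow> 'a) \<Rightarrow> nat \<Rightarrow> 'a" where
  "elem_sym F f k = (\<Oplus>B\<in>{B. B \<subseteq> F \<and> card B = k}. \<Otimes>g\<in>B. f g)"

lemma (in cring) finprod_add_elem_sym:
  assumes F: "finite F" and s: "s \<in> carrier R" and f: "\<And>i. i \<in> F \<Longrightarrow> f i \<in> carrier R"
  shows "(\<Otimes>i\<in>F. s \<oplus> f i) = (\<Oplus>k\<in>{..card F}. s [^] (card F - k) \<otimes> elem_sym F f k)"
proof -
  let ?P = "\<lambda>k. {B. B \<subseteq> F \<and> card B = k}"
  have prodc: "(\<Otimes>i\<in>B. f i) \<in> carrier R" if "B \<subseteq> F" for B using that f by (intro finprod_closed) auto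
  have fin: "finite (?P k)" for k using F by simp
  have "Pow F = \<Union> (?P ` {..card F})" using F card_mono by auto
  then have "(\<Otimes>i\<in>F. s \<oplus> f i) = (\<Oplus>B\<in>\<Union> (?P ` {..card F}). s [^] card (F - B) \<otimes> (\<Otimes>i\<in>B. f i))"
    using finprod_add_expand[OF F s f] by simp
  also have "\<dots> = (\<Oplus>k\<in>{..card F}. \<Oplus>B\<in>?P k. s [^] card (F - B) \<otimes> (\<Otimes>i\<in>B. f i))"
    using fin s prodc by (intro add.finprod_UN_disjoint) (auto simp: pairwise_def disjnt_def)
  also have "\<dots> = (\<Oplus>k\<in>{..card F}. s [^] (card F - k) \<otimes> elem_sym F f k)"
  proof (intro finsum_cong')
    fix k assume "k \<in> {..card F}"
    have "(\<Oplus>B\<in>?P k. s [^] card (F - B) \<otimes> (\<Otimes>i\<in>B. f i)) = (\<Oplus>B\<in>?P k. s [^] (card F - k) \<otimes> (\<Otimes>i\<in>B. f i))"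
      using s prodc F by (intro finsum_cong') (auto simp: card_Diff_subset finite_subset)
    also have "\<dots> = s [^] (card F - k) \<otimes> elem_sym F f k"
      unfolding elem_sym_def using fin s prodc by (intro finsum_rdistr[symmetric]) auto
    finally show "(\<Oplus>B\<in>?P k. s [^] card (F - B) \<otimes> (\<Otimes>i\<in>B. f i)) = s [^] (card F - k) \<otimes> elem_sym F f k" .
  qed (use s prodc in \<open>auto simp: elem_sym_def intro!: finsum_closed\<close>)
  finally show ?thesis .
qed

context galois_normal_subring
begin

text \<open>
  An automorphism permutes the subsets of \<open>G\<close> of given size by translation, so it fixes the coefficients of
  the polynomial with the conjugates of \<open>s\<close> as roots.
\<close>

lemma elem_sym_conjugates_in_R:
  assumes s: "s \<in> S" shows "elem_sym G (\<lambda>g. \<ominus> g s) k \<in> R"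
proof -
  let ?P = "{B. B \<subseteq> G \<and> card B = k}" and ?f = "\<lambda>g. \<ominus> g s"
  have sc: "s \<in> carrier L" using s by (rule S.A_carrier)
  have f: "?f g \<in> S" "?f g \<in> carrier L" if "g \<in> G" for g
    using aut_S[OF that s] aut_hom(1)[OF that sc] by auto
  have prodS: "(\<Otimes>g\<in>B. ?f g) \<in> S" if "B \<subseteq> G" for B using that f by (intro S.A_finprod) auto
  have "elem_sym G ?f k \<in> S" unfolding elem_sym_def using prodS by (intro S.A_finsum) auto
  moreover have "h (elem_sym G ?f k) = elem_sym G ?f k" if h: "h \<in> G" for h
  proof -
    let ?h = "\<lambda>g. h \<star> g"
    have inj: "inj_on ?h B" if "B \<subseteq> G" for B using aut_translate(1)[OF h] that inj_on_subset by blast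
    have "h (elem_sym G ?f k) = (\<Oplus>B\<in>?P. h (\<Otimes>g\<in>B. ?f g))"
      unfolding elem_sym_def using prodS S.A_carrier by (intro aut_finsum h) auto
    also have "\<dots> = (\<Oplus>B\<in>?P. \<Otimes>g\<in>?h ` B. ?f g)"
    proof (intro finsum_cong')
      fix B assume "B \<in> ?P"
      then have B: "B \<subseteq> G" by blast
      have "h (\<Otimes>g\<in>B. ?f g) = (\<Otimes>g\<in>B. h (?f g))"
        using B f by (intro aut_finprod h) auto
      also have "\<dots> = (\<Otimes>g\<in>B. ?f (?h g))"
        using B f sc aut_hom(1) h by (intro finprod_cong') (auto simp: aut_hom_minus(1)[OF h])
      also have "\<dots> = (\<Otimes>g\<in>?h ` B. ?f g)"
        using B f inj h by (intro finprod_reindex[symmetric]) auto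
      finally show "h (\<Otimes>g\<in>B. ?f g) = (\<Otimes>g\<in>?h ` B. ?f g)" .
    next
      show "(\<lambda>B. \<Otimes>g\<in>?h ` B. ?f g) \<in> ?P \<rightarrow> carrier L" using f h by (auto intro!: finprod_closed)
    qed simp
    also have "\<dots> = (\<Oplus>B\<in>(\<lambda>B. ?h ` B) ` ?P. \<Otimes>g\<in>B. ?f g)"
    proof (rule finsum_reindex[symmetric])
      show "inj_on (\<lambda>B. ?h ` B) ?P"
        using inj_on_image_eq_iff[OF aut_translate(1)[OF h]] by (intro inj_onI) auto
      show "(\<lambda>B. \<Otimes>g\<in>B. ?f g) \<in> (\<lambda>B. ?h ` B) ` ?P \<rightarrow> carrier L"
        using f h by (auto intro!: finprod_closed)
    qed
    also have "(\<lambda>B. ?h ` B) ` ?P = ?P"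
    proof (rule endo_inj_surj)
      show "finite ?P" using finite_aut by simp
      show "(\<lambda>B. ?h ` B) ` ?P \<subseteq> ?P" using h inj by (auto simp: card_image)
      show "inj_on (\<lambda>B. ?h ` B) ?P"
        using inj_on_image_eq_iff[OF aut_translate(1)[OF h]] by (intro inj_onI) auto
    qed
    finally show ?thesis by (simp add: elem_sym_def)
  qed
  ultimately show ?thesis using fixed_field S.A_carrier by (auto simp: R_eq)
qed

text \<open>
  The product of the \<open>s - g s\<close> vanishes, since the identity contributes the factor \<open>0\<close>.  Expanded, it is an
  equation for \<open>s\<close> of degree \<open>|G|\<close> whose lower coefficients lie in \<open>q \<inter> R = p\<close>.
\<close>

lemma power_in_extended_ideal:
  assumes q: "lies_over q" and s: "s \<in> S" "\<And>g. g \<in> G \<Longrightarrow> g s \<in> q"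
    and J: "closed_submodule S J" "p \<subseteq> J"
  shows "s [^] card G \<in> J"
proof -
  note qD = lies_overD[OF q] and JD = S.submoduleD[OF J(1)]
  note qM = S.submoduleD[OF qD(3)]
  let ?f = "\<lambda>g. \<ominus> g s" and ?e = "elem_sym G (\<lambda>g. \<ominus> g s)"
  have sc: "s \<in> carrier L" using s S.A_carrier by auto
  have eR: "?e k \<in> R" for k using elem_sym_conjugates_in_R[OF s(1)] .
  then have eS: "?e k \<in> S" and ec: "?e k \<in> carrier L" for k using R_S R.A_carrier by auto
  have e0: "?e 0 = \<one>"
  proof -
    have "{B. B \<subseteq> G \<and> card B = 0} = {{}}" using finite_aut finite_subset by fastforce
    then show ?thesis by (simp add: elem_sym_def finsum_insert)
  qed
  have ep: "?e (Suc k) \<in> p" for k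
  proof -
    have "?e (Suc k) \<in> q" unfolding elem_sym_def
    proof (rule S.submodule_finsum[OF qD(3)])
      fix B assume "B \<in> {B. B \<subseteq> G \<and> card B = Suc k}"
      then have B: "B \<subseteq> G" "card B \<noteq> 0" by auto
      then have "finite B" "B \<noteq> {}" using card_gt_0_iff[of B] by simp_all
      then obtain g where "B \<subseteq> G" "g \<in> B" "finite B" using B by blast
      then show "(\<Otimes>g\<in>B. ?f g) \<in> q"
        using s aut_S qM(6) by (intro S.finprod_in_submodule[OF qD(3)]) auto
    qed
    then show ?thesis using qD(7) eR by blast
  qed
  have sJ: "s [^] (card G - Suc k) \<otimes> ?e (Suc k) \<in> J" for k
    using subsetD[OF J(2) ep[of k]] s by (intro JD(5)) auto
  define r where "r = (\<Oplus>k\<in>Suc ` {..<card G}. s [^] (card G - k) \<otimes> ?e k)"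
  have rJ: "r \<in> J" unfolding r_def using sJ by (intro S.submodule_finsum[OF J(1)]) auto
  have "(\<Otimes>g\<in>G. s \<oplus> ?f g) = \<zero>"
  proof -
    have "(\<Otimes>g\<in>G. s \<oplus> ?f g) \<in> {\<zero>}"
    proof (rule S.finprod_in_submodule[OF _ finite_aut])
      show "aut_id \<in> G" by simp
      show "s \<oplus> \<ominus> aut_id s \<in> {\<zero>}" using sc by (simp add: r_neg)
      show "closed_submodule S {\<zero>}" by (auto simp: closed_submodule_def S.A_carrier)
    qed (use s aut_S in auto)
    then show ?thesis by simp
  qed
  moreover have "(\<Otimes>g\<in>G. s \<oplus> ?f g) = s [^] card G \<oplus> r"
  proof -
    have "{..card G} = insert 0 (Suc ` {..<card G})" using lessThan_Suc_atMost lessThan_Suc_eq_insert_0 by metis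
    then have "(\<Otimes>g\<in>G. s \<oplus> ?f g) = (\<Oplus>k\<in>insert 0 (Suc ` {..<card G}). s [^] (card G - k) \<otimes> ?e k)"
      using finprod_add_elem_sym[OF finite_aut sc, of ?f] aut_hom(1) sc by simp
    also have "\<dots> = s [^] (card G - 0) \<otimes> ?e 0 \<oplus> r"
      unfolding r_def using sc ec by (intro finsum_insert) auto
    finally show ?thesis using sc e0 by simp
  qed
  ultimately have "s [^] card G = \<ominus> r" using sc JD(2)[OF rJ] by (simp add: sum_zero_eq_neg)
  then show ?thesis using JD(6)[OF rJ] by simp
qed

end

section \<open>The trace modulo a prime\<close>

context galois_normal_subring
begin

text \<open>
  The inertia group described on \<open>S/q\<close> instead of \<open>\<kappa>(q)\<close>; the two descriptions agree by \<open>inertia_group_eq\<close>.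
\<close>

definition inertia :: "'a set \<Rightarrow> ('a \<Rightarrow> 'a) set" where
  "inertia q = {g \<in> G. \<forall>y\<in>S. g y \<ominus> y \<in> q}"

lemma inertiaD:
  "g \<in> inertia q \<Longrightarrow> g \<in> G" "\<lbrakk> g \<in> inertia q; y \<in> S \<rbrakk> \<Longrightarrow> g y \<ominus> y \<in> q"
  by (auto simp: inertia_def)

lemma inertiaI: "\<lbrakk> g \<in> G; \<And>y. y \<in> S \<Longrightarrow> g y \<ominus> y \<in> q \<rbrakk> \<Longrightarrow> g \<in> inertia q"
  by (auto simp: inertia_def)

lemma inertia_subgroup:
  assumes q: "closed_submodule S q" shows "subgroup (inertia q) (aut_group L K)"
proof (rule aut.subgroupI)
  show "inertia q \<subseteq> G" by (auto simp: inertia_def)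
  have "aut_id \<in> inertia q"
    using S.submoduleD(3)[OF q] S.A_carrier by (auto simp: inertia_def a_minus_def r_neg)
  then show "inertia q \<noteq> {}" by blast
  show "aut_inv g \<in> inertia q" if g: "g \<in> inertia q" for g
  proof -
    have gG: "g \<in> G" and iG: "aut_inv g \<in> G" using g by (auto simp: inertia_def)
    have "aut_inv g y \<ominus> y \<in> q" if y: "y \<in> S" for y
    proof -
      have y': "aut_inv g y \<in> S" using aut_S[OF iG y] .
      then have "g (aut_inv g y) \<ominus> aut_inv g y \<in> q" using g by (auto simp: inertia_def)
      then have "y \<ominus> aut_inv g y \<in> q" using gG y S.A_carrier by simp
      then show ?thesis using S.cong_mod_sym[OF q y y'] by simp
    qed
    then show ?thesis using iG by (simp add: inertia_def)
  qed
  show "g \<star> h \<in> inertia q" if g: "g \<in> inertia q" and h: "h \<in> inertia q" for g h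
  proof -
    have gG: "g \<in> G" and hG: "h \<in> G" using g h by (auto simp: inertia_def)
    have "(g \<star> h) y \<ominus> y \<in> q" if y: "y \<in> S" for y
    proof -
      have hy: "h y \<in> S" "g (h y) \<in> S" using aut_S gG hG y by auto
      have "g (h y) \<ominus> y \<in> q"
        by (rule S.cong_mod_trans[OF q hy(2,1) y]) (use g h hy y in \<open>auto simp: inertia_def\<close>)
      then show ?thesis using gG hG y S.A_carrier by simp
    qed
    then show ?thesis using gG hG by (simp add: inertia_def)
  qed
qed

text \<open>
  \<open>F\<close> contains one representative from each right coset of the inertia group \<open>I\<close>.  For \<open>i \<in> I\<close> the values \<open>i (g z)\<close>
  and \<open>g z\<close> are congruent, so each coset contributes \<open>|I|\<close> equal terms to the trace modulo \<open>q\<close>; and if two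
  automorphisms agree modulo \<open>q\<close>, then they differ by an element of \<open>I\<close>.
\<close>

lemma trace_mod_prime:
  assumes q: "lies_over q"
  shows "\<exists>F. F \<subseteq> G \<and> (\<forall>g\<in>G. \<exists>f\<in>F. \<forall>y\<in>S. g y \<ominus> f y \<in> q)
    \<and> (\<forall>f\<in>F. \<forall>f'\<in>F. f \<noteq> f' \<longrightarrow> (\<exists>y\<in>S. f y \<ominus> f' y \<notin> q))
    \<and> (\<forall>z\<in>S. conj_sum z \<ominus> ([card (inertia q)] \<cdot> \<one>) \<otimes> (\<Oplus>f\<in>F. f z) \<in> q)"
proof -
  let ?I = "inertia q" and ?C = "rcosets\<^bsub>aut_group L K\<^esub> (inertia q)"
  note qD = lies_overD[OF q] and qM = S.submoduleD[OF lies_overD(3)[OF q]]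
  note I = inertia_subgroup[OF qD(3)]
  interpret I: subgroup ?I "aut_group L K" by (rule I)
  have part: "\<Union>?C = G" using aut.rcosets_part_G[OF I] .
  have disj: "pairwise disjnt ?C" using aut.rcos_disjoint[OF I] .
  have finC: "finite ?C" using part finite_aut by (metis finite_UnionD)
  have sub: "C \<subseteq> G" if "C \<in> ?C" for C using part that by blast
  have fin: "finite C" if "C \<in> ?C" for C using sub[OF that] finite_aut finite_subset by blast
  have card: "card C = card ?I" if "C \<in> ?C" for C
    using aut.card_rcosets_equal[OF that] I.subset by simp
  have same: "g y \<ominus> h y \<in> q" if "C \<in> ?C" "g \<in> C" "h \<in> C" "y \<in> S" for C g h y
  proof -
    \<comment> \<open>each member of the coset is compared with the chosen generator k\<close>
    obtain k where k: "k \<in> G" "C = ?I #>\<^bsub>aut_group L K\<^esub> k" using \<open>C \<in> ?C\<close> by (auto simp: RCOSETS_def)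
    have "i y \<ominus> k y \<in> q" "i y \<in> S" if i: "i \<in> C" for i
    proof -
      obtain j where j: "j \<in> ?I" "i = j \<star> k" using i k by (auto simp: r_coset_def)
      have "i y = j (k y)" using j I.mem_carrier k S.A_carrier[OF \<open>y \<in> S\<close>] by simp
      moreover have ky: "k y \<in> S" using aut_S[OF k(1) \<open>y \<in> S\<close>] .
      moreover have "j (k y) \<in> S" using aut_S[OF I.mem_carrier[OF j(1)] ky] .
      moreover have "j (k y) \<ominus> k y \<in> q" using inertiaD(2)[OF j(1) ky] .
      ultimately show "i y \<ominus> k y \<in> q" "i y \<in> S" by (simp_all only:)
    qed
    note ik = this
    have ky: "k y \<in> S" using aut_S[OF k(1) \<open>y \<in> S\<close>] .
    show ?thesis
      using S.cong_mod_trans[OF qD(3) ik(2)[OF that(2)] ky ik(2)[OF that(3)] ik(1)[OF that(2)]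
        S.cong_mod_sym[OF qD(3) ik(2)[OF that(3)] ky ik(1)[OF that(3)]]] .
  qed
  have "\<exists>r. r \<in> C" if "C \<in> ?C" for C using I.rcosets_non_empty[OF that] by blast
  then obtain rep where rep: "\<And>C. C \<in> ?C \<Longrightarrow> rep C \<in> C" by metis
  have repG: "rep C \<in> G" if "C \<in> ?C" for C using rep sub that by blast
  have inj: "inj_on rep ?C"
    using rep disj by (intro inj_onI) (metis disjnt_iff pairwise_def)
  define F where "F = rep ` ?C"
  have "F \<subseteq> G" using repG by (auto simp: F_def)
  moreover have "\<exists>f\<in>F. \<forall>y\<in>S. g y \<ominus> f y \<in> q" if "g \<in> G" for g
  proof -
    have "g \<in> \<Union>?C" using that by (simp only: part)
    then obtain C where C: "C \<in> ?C" "g \<in> C" by (elim UnionE)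
    have "\<forall>y\<in>S. g y \<ominus> rep C y \<in> q" using same[OF C rep[OF C(1)]] by blast
    then show ?thesis using imageI[OF C(1), of rep] unfolding F_def by blast
  qed
  moreover have "\<exists>y\<in>S. f y \<ominus> f' y \<notin> q" if ff: "f \<in> F" "f' \<in> F" "f \<noteq> f'" for f f'
  proof (rule ccontr)
    assume no: "\<not> ?thesis"
    obtain C C' where C: "C \<in> ?C" "f = rep C" "C' \<in> ?C" "f' = rep C'" using ff by (auto simp: F_def)
    have fG: "f \<in> G" "f' \<in> G" using C repG by auto
    \<comment> \<open>if two representatives agreed modulo q, this quotient would lie in I and put them into one coset\<close>
    let ?g = "f \<star> aut_inv f'"
    have "?g y \<ominus> y \<in> q" if y: "y \<in> S" for y
    proof -
      have iG: "aut_inv f' \<in> G" using fG by simp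
      have y': "aut_inv f' y \<in> S" using aut_S[OF iG y] .
      have "f (aut_inv f' y) \<ominus> f' (aut_inv f' y) \<in> q" using no y' by blast
      then show ?thesis using fG y S.A_carrier by simp
    qed
    then have "?g \<in> ?I"
      using aut.m_closed[OF fG(1) aut.inv_closed[OF fG(2)]] by (intro inertiaI)
    moreover have "f = ?g \<star> f'" using fG by (simp add: aut.m_assoc)
    moreover obtain k where k: "k \<in> G" "C' = ?I #>\<^bsub>aut_group L K\<^esub> k" using C(3) by (auto simp: RCOSETS_def)
    moreover have "C' = ?I #>\<^bsub>aut_group L K\<^esub> f'"
      using aut.repr_independence[OF _ k(1) I] rep[OF C(3)] C(4) k(2) by simp
    ultimately have "f \<in> C'" by (auto simp: r_coset_def)
    moreover have "f \<in> C" using C rep by simp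
    ultimately have "C = C'" using disj C by (metis disjnt_iff pairwise_def)
    then show False using C ff by simp
  qed
  moreover have "conj_sum z \<ominus> ([card ?I] \<cdot> \<one>) \<otimes> (\<Oplus>f\<in>F. f z) \<in> q" if z: "z \<in> S" for z
  proof -
    have zc: "z \<in> carrier L" using z S.A_carrier by blast
    have gz: "g z \<in> S" "g z \<in> carrier L" if "g \<in> G" for g using aut_S[OF that z] S.A_carrier by auto
    have mS: "[n] \<cdot> \<one> \<in> S" for n :: nat by simp
    then have mc: "[n] \<cdot> \<one> \<in> carrier L" for n :: nat using S.A_carrier by blast
    have "conj_sum z = (\<Oplus>g\<in>\<Union>?C. g z)" unfolding part conj_sum_def by simp
    also have "\<dots> = (\<Oplus>C\<in>?C. \<Oplus>g\<in>C. g z)"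
      using finC fin disj gz(2)[OF subsetD[OF sub]]
      by (intro add.finprod_Union_disjoint) auto
    finally have 1: "conj_sum z = (\<Oplus>C\<in>?C. \<Oplus>g\<in>C. g z)" .
    have "(\<Oplus>g\<in>C. g z) \<ominus> ([card ?I] \<cdot> \<one>) \<otimes> rep C z \<in> q" if C: "C \<in> ?C" for C
    proof -
      have "(\<Oplus>g\<in>C. g z) \<ominus> (\<Oplus>g\<in>C. rep C z) \<in> q"
        using C sub gz repG same[OF C _ rep[OF C] z] by (intro S.finsum_cong_mod[OF qD(3)]) auto
      moreover have "(\<Oplus>g\<in>C. rep C z) = [card C] \<cdot> rep C z"
        using gz(2)[OF repG[OF C]] by (rule add.finprod_const)
      moreover have "\<dots> = ([card ?I] \<cdot> \<one>) \<otimes> rep C z"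
        using gz(2)[OF repG[OF C]] card[OF C] by (simp add: add_pow_ldistr)
      ultimately show ?thesis by simp
    qed
    then have "(\<Oplus>C\<in>?C. \<Oplus>g\<in>C. g z) \<ominus> (\<Oplus>C\<in>?C. ([card ?I] \<cdot> \<one>) \<otimes> rep C z) \<in> q"
      using sub gz repG mS by (intro S.finsum_cong_mod[OF qD(3)] S.A_finsum) (auto simp: subset_iff)
    also have "(\<Oplus>C\<in>?C. ([card ?I] \<cdot> \<one>) \<otimes> rep C z) = ([card ?I] \<cdot> \<one>) \<otimes> (\<Oplus>C\<in>?C. rep C z)"
      using finC gz repG mc by (intro finsum_rdistr[symmetric]) auto
    also have "(\<Oplus>C\<in>?C. rep C z) = (\<Oplus>f\<in>F. f z)"
      unfolding F_def using inj gz repG by (intro finsum_reindex[symmetric]) auto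
    finally show ?thesis by (simp add: 1)
  qed
  ultimately show ?thesis by (intro exI[of _ F] conjI ballI impI)
qed

lemma conj_sum_in_p_imp:
  assumes q: "lies_over q" and m: "[card (inertia q)] \<cdot> \<one> \<notin> p"
    and s: "s \<in> S" and tr: "\<And>t. t \<in> S \<Longrightarrow> conj_sum (s \<otimes> t) \<in> p"
  shows "s \<in> q"
proof -
  note qD = lies_overD[OF q]
  note qM = S.submoduleD[OF qD(3)]
  from trace_mod_prime[OF q] obtain F where F: "F \<subseteq> G" "\<forall>g\<in>G. \<exists>f\<in>F. \<forall>y\<in>S. g y \<ominus> f y \<in> q"
    "\<forall>f\<in>F. \<forall>f'\<in>F. f \<noteq> f' \<longrightarrow> (\<exists>y\<in>S. f y \<ominus> f' y \<notin> q)"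
    "\<forall>z\<in>S. conj_sum z \<ominus> ([card (inertia q)] \<cdot> \<one>) \<otimes> (\<Oplus>f\<in>F. f z) \<in> q"
    by (elim exE conjE) (rule that)
  have FG: "f \<in> G" if "f \<in> F" for f using F(1) that by blast
  define m where "m = [card (inertia q)] \<cdot> \<one>"
  have mR: "m \<in> R" unfolding m_def by simp
  have mq: "m \<notin> q" using m qD(7) mR by (auto simp: m_def)
  have "(\<Oplus>f\<in>F. f s \<otimes> f z) \<in> q" if z: "z \<in> S" for z
  proof -
    have sz: "s \<otimes> z \<in> S" using s z by simp
    have eq: "(\<Oplus>f\<in>F. f s \<otimes> f z) = (\<Oplus>f\<in>F. f (s \<otimes> z))"
      using s z FG aut_hom(1,2) S.A_carrier by (intro finsum_cong') auto
    have sumS: "(\<Oplus>f\<in>F. f (s \<otimes> z)) \<in> S" using FG aut_S sz by auto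
    have "conj_sum (s \<otimes> z) \<in> q" using tr[OF z] qD(6) by blast
    moreover have "m \<otimes> (\<Oplus>f\<in>F. f (s \<otimes> z)) \<ominus> conj_sum (s \<otimes> z) \<in> q"
      using S.cong_mod_sym[OF qD(3) R_S[OF conj_sum_in_R[OF sz]] S.A_simps(4)[OF R_S[OF mR] sumS]]
        bspec[OF F(4) sz] unfolding m_def by blast
    ultimately have "(m \<otimes> (\<Oplus>f\<in>F. f (s \<otimes> z)) \<ominus> conj_sum (s \<otimes> z)) \<oplus> conj_sum (s \<otimes> z) \<in> q"
      using qM(4) by blast
    then have "m \<otimes> (\<Oplus>f\<in>F. f (s \<otimes> z)) \<in> q"
      using minus_add_cancel[of "m \<otimes> (\<Oplus>f\<in>F. f (s \<otimes> z))" "conj_sum (s \<otimes> z)"]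
        S.A_carrier[OF sumS] R.A_carrier[OF mR] R.A_carrier[OF conj_sum_in_R[OF sz]] by simp
    then show ?thesis using qD(5)[OF R_S[OF mR] sumS] mq eq by simp
  qed
  then have vanish: "\<forall>z\<in>S. (\<Oplus>f\<in>F. f s \<otimes> f z) \<in> q" by blast
  have "\<forall>f\<in>F. f s \<in> q"
  proof (rule S.dedekind_independence_mod_prime[OF qD(1) finite_subset[OF F(1) finite_aut], where c = "\<lambda>f. f s"])
    show "\<And>f x. \<lbrakk> f \<in> F; x \<in> S \<rbrakk> \<Longrightarrow> f x \<in> S" using aut_S FG by blast
    show "\<And>f x y. \<lbrakk> f \<in> F; x \<in> S; y \<in> S \<rbrakk> \<Longrightarrow> f (x \<otimes> y) = f x \<otimes> f y"
      using aut_hom(2)[OF FG] S.A_carrier by blast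
    show "\<And>f. f \<in> F \<Longrightarrow> f \<one> = \<one>" using aut_hom(4)[OF FG] .
    show "\<forall>f\<in>F. f s \<in> S" using aut_S FG s by blast
    show "\<And>f f'. \<lbrakk> f \<in> F; f' \<in> F; f \<noteq> f' \<rbrakk> \<Longrightarrow> \<exists>y\<in>S. f y \<ominus> f' y \<notin> q"
      by (rule F(3)[rule_format])
  qed (fact vanish)
  moreover obtain f where f: "f \<in> F" "\<forall>y\<in>S. aut_id y \<ominus> f y \<in> q"
    using bspec[OF F(2) aut.one_closed] by blast
  ultimately have fs: "s \<ominus> f s \<in> q" "f s \<in> q" using s S.A_carrier[OF s] by auto
  have "(s \<ominus> f s) \<oplus> f s \<in> q" using qM(4)[OF fs] .
  then show ?thesis
    using minus_add_cancel[OF S.A_carrier[OF s] qM(2)[OF fs(2)]] by simp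
qed

lemma conj_sum_in_p_if:
  assumes q: "lies_over q" and m: "[card (inertia q)] \<cdot> \<one> \<in> p" and z: "z \<in> S"
  shows "conj_sum z \<in> p"
proof -
  note qD = lies_overD[OF q]
  note qM = S.submoduleD[OF qD(3)]
  from trace_mod_prime[OF q] obtain F where F: "F \<subseteq> G" "\<forall>g\<in>G. \<exists>f\<in>F. \<forall>y\<in>S. g y \<ominus> f y \<in> q"
    "\<forall>f\<in>F. \<forall>f'\<in>F. f \<noteq> f' \<longrightarrow> (\<exists>y\<in>S. f y \<ominus> f' y \<notin> q)"
    "\<forall>z\<in>S. conj_sum z \<ominus> ([card (inertia q)] \<cdot> \<one>) \<otimes> (\<Oplus>f\<in>F. f z) \<in> q"
    by (elim exE conjE) (rule that)
  have sumS: "(\<Oplus>f\<in>F. f z) \<in> S" using aut_S z subsetD[OF F(1)] by (intro S.A_finsum) blast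
  have mq: "[card (inertia q)] \<cdot> \<one> \<in> q" using qD(6) m by blast
  then have "(\<Oplus>f\<in>F. f z) \<otimes> ([card (inertia q)] \<cdot> \<one>) \<in> q" using qM(5) sumS by blast
  then have "([card (inertia q)] \<cdot> \<one>) \<otimes> (\<Oplus>f\<in>F. f z) \<in> q"
    using m_comm[OF S.A_carrier[OF sumS] qM(2)[OF mq]] by simp
  then have "(conj_sum z \<ominus> ([card (inertia q)] \<cdot> \<one>) \<otimes> (\<Oplus>f\<in>F. f z)) \<oplus> ([card (inertia q)] \<cdot> \<one>) \<otimes> (\<Oplus>f\<in>F. f z) \<in> q"
    using qM(4) bspec[OF F(4) z] by blast
  then have "conj_sum z \<in> q"
    using minus_add_cancel[OF R.A_carrier[OF conj_sum_in_R[OF z]], of "([card (inertia q)] \<cdot> \<one>) \<otimes> (\<Oplus>f\<in>F. f z)"]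
      qM(2)[OF mq] S.A_carrier[OF sumS] by simp
  then show ?thesis using qD(7) conj_sum_in_R[OF z] by blast
qed

end

section \<open>Conjugacy of the primes over p\<close>

context galois_normal_subring
begin

text \<open>
  The inverse of an element of a finite group is one of its powers.
\<close>

lemma inv_stable_if_stable:
  assumes g: "g \<in> G" and sub: "P \<subseteq> carrier L" and stab: "\<And>x. x \<in> P \<Longrightarrow> g x \<in> P" and x: "x \<in> P"
  shows "aut_inv g x \<in> P"
proof -
  have pow: "(g [^]\<^bsub>aut_group L K\<^esub> n) x \<in> P" for n :: nat
  proof (induction n)
    case 0
    then show ?case using x sub by auto
  next
    case (Suc n)
    have "(g [^]\<^bsub>aut_group L K\<^esub> Suc n) = g \<star> (g [^]\<^bsub>aut_group L K\<^esub> n)"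
      using g aut.nat_pow_Suc2 by blast
    moreover have "(g [^]\<^bsub>aut_group L K\<^esub> n) \<in> G" using g by simp
    ultimately show ?case using Suc stab g x sub by auto
  qed
  have "order (aut_group L K) > 0" using finite_aut by (simp add: aut.order_gt_0_iff_finite)
  then obtain n where n: "order (aut_group L K) = Suc n" using gr0_implies_Suc by blast
  have "(g [^]\<^bsub>aut_group L K\<^esub> n) \<star> g = aut_id"
    using aut.pow_order_eq_1[OF g] n by simp
  then have "aut_inv g = g [^]\<^bsub>aut_group L K\<^esub> n"
    using g aut.inv_equality by simp
  then show ?thesis using pow by simp
qed

text \<open>
  This is the conjugate \<open>g\<^sup>-\<^sup>1 q\<close>; written as a preimage it needs no inverse, and conjugation by \<open>h\<close> afterwards
  is conjugation by the product \<open>g h\<close> (\<open>conj_prime_mult\<close>).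
\<close>

definition conj_prime :: "('a \<Rightarrow> 'a) \<Rightarrow> 'a set \<Rightarrow> 'a set" where
  "conj_prime g q = {x \<in> S. g x \<in> q}"

lemma lies_over_conj_prime:
  assumes g: "g \<in> G" and q: "lies_over q" shows "lies_over (conj_prime g q)"
proof -
  note qD = lies_overD[OF q]
  note qM = S.submoduleD[OF qD(3)]
  have gS: "g x \<in> S" if "x \<in> S" for x using aut_S[OF g that] .
  have hom: "g (x \<oplus> y) = g x \<oplus> g y" "g (x \<otimes> y) = g x \<otimes> g y" if "x \<in> S" "y \<in> S" for x y
    using aut_hom(2,3)[OF g] that S.A_carrier by auto
  have R: "g x = x" if "x \<in> R" for x using aut_hom(5)[OF g R_K[OF that]] .
  have mem: "x \<in> conj_prime g q \<longleftrightarrow> x \<in> S \<and> g x \<in> q" for x by (simp add: conj_prime_def)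
  have sub: "closed_submodule S (conj_prime g q)"
    unfolding closed_submodule_def
  proof (intro conjI ballI subsetI)
    show "x \<in> carrier L" if "x \<in> conj_prime g q" for x using that mem S.A_carrier by blast
    show "\<zero> \<in> conj_prime g q" using qM(3) aut_hom(6)[OF g] by (simp add: mem)
    show "x \<oplus> y \<in> conj_prime g q" if "x \<in> conj_prime g q" "y \<in> conj_prime g q" for x y
      using that hom(1)[of x y] qM(4)[of "g x" "g y"] S.A_simps(3)[of x y] by (simp only: mem)
    show "a \<otimes> x \<in> conj_prime g q" if "a \<in> S" "x \<in> conj_prime g q" for a x
      using that hom(2)[of a x] qM(5)[of "g a" "g x"] gS[of a] S.A_simps(4)[of a x] by (simp only: mem)
  qed
  have prime: "a \<in> conj_prime g q \<or> b \<in> conj_prime g q" if "a \<in> S" "b \<in> S" "a \<otimes> b \<in> conj_prime g q" for a b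
    using that hom(2)[of a b] qD(5)[of "g a" "g b"] gS[of a] gS[of b] by (simp only: mem simp_thms)
  have "\<one> \<notin> conj_prime g q" using qD(4) aut_hom(4)[OF g] by (simp add: mem)
  then have "primeideal (conj_prime g q) (L\<lparr>carrier := S\<rparr>)"
    unfolding S.primeideal_iff using mem sub prime by blast
  moreover have "conj_prime g q \<inter> R = p"
  proof (intro equalityI subsetI)
    fix x assume "x \<in> conj_prime g q \<inter> R"
    then have "x \<in> R" "x \<in> q" using mem[of x] R[of x] by simp_all
    then show "x \<in> p" by (intro qD(7))
  next
    fix x assume x: "x \<in> p"
    have "x \<in> R" using p_R[OF x] .
    moreover have "g x \<in> q" using R[OF p_R[OF x]] qD(6)[OF x] by simp
    ultimately show "x \<in> conj_prime g q \<inter> R" using mem[of x] R_S[of x] by simp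
  qed
  ultimately show ?thesis by (simp add: lies_over_def)
qed

lemma conj_prime_mult:
  assumes "g \<in> G" "h \<in> G" shows "conj_prime h (conj_prime g q) = conj_prime (g \<star> h) q"
proof (rule Set.set_eqI)
  fix x
  show "x \<in> conj_prime h (conj_prime g q) \<longleftrightarrow> x \<in> conj_prime (g \<star> h) q"
  proof (cases "x \<in> S")
    case True
    then show ?thesis
      using aut_S[OF assms(2) True] aut_apply(1)[OF assms S.A_carrier[OF True]] by (simp add: conj_prime_def)
  qed (simp add: conj_prime_def)
qed

text \<open>
  This is incomparability of conjugate primes in its simplest form: a chain of inclusions obtained by
  iterating \<open>g\<close> closes up because \<open>g\<close> has finite order.
\<close>

lemma stable_prime:
  assumes g: "g \<in> G" and q: "lies_over q" and sub: "conj_prime g q \<subseteq> q \<or> q \<subseteq> conj_prime g q"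
  shows "conj_prime g q = q"
proof -
  note qD = lies_overD[OF q]
  have qc: "q \<subseteq> carrier L" using S.submoduleD(1)[OF qD(3)] .
  have iG: "aut_inv g \<in> G" using g by simp
  have "(\<forall>x\<in>q. g x \<in> q) \<and> (\<forall>x\<in>q. aut_inv g x \<in> q)"
    using sub
  proof
    assume s: "conj_prime g q \<subseteq> q"
    have st: "aut_inv g x \<in> q" if "x \<in> q" for x
    proof -
      have "aut_inv g x \<in> conj_prime g q"
        using that aut_S[OF iG qD(2)[OF that]] g qc by (auto simp: conj_prime_def)
      then show ?thesis using s by blast
    qed
    then show ?thesis using inv_stable_if_stable[OF iG qc] g by simp
  next
    assume s: "q \<subseteq> conj_prime g q"
    then have "g x \<in> q" if "x \<in> q" for x using that by (auto simp: conj_prime_def)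
    then show ?thesis using inv_stable_if_stable[OF g qc] by blast
  qed
  note st = this
  show ?thesis
  proof (intro equalityI subsetI)
    fix x assume x: "x \<in> conj_prime g q"
    then have "aut_inv g (g x) \<in> q" using st by (auto simp: conj_prime_def)
    then show "x \<in> q" using x g S.A_carrier by (auto simp: conj_prime_def)
  qed (use st qD(2) in \<open>auto simp: conj_prime_def\<close>)
qed

lemma conj_primes_incomparable:
  assumes q: "lies_over q" and gh: "g \<in> G" "h \<in> G" and sub: "conj_prime g q \<subseteq> conj_prime h q"
  shows "conj_prime g q = conj_prime h q"
proof -
  define k where "k = g \<star> aut_inv h"
  have k: "k \<in> G" "g = k \<star> h" using gh by (auto simp: k_def aut.m_assoc)
  have ih: "aut_inv h \<in> G" using gh by simp
  have "conj_prime (aut_inv h) (conj_prime g q) \<subseteq> conj_prime (aut_inv h) (conj_prime h q)"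
    using sub by (auto simp: conj_prime_def[of "aut_inv h"])
  then have "conj_prime k q \<subseteq> conj_prime aut_id q"
    using gh ih by (simp add: conj_prime_mult k_def)
  also have "conj_prime aut_id q = q"
    using lies_overD(2)[OF q] S.A_carrier by (auto simp: conj_prime_def)
  finally have "conj_prime k q = q" using stable_prime[OF k(1) q] by blast
  then show ?thesis using conj_prime_mult[OF k(1) gh(2), of q] k(2) by simp
qed

text \<open>
  Otherwise prime avoidance gives \<open>x \<in> q'\<close> outside all conjugates of \<open>q\<close>.  The norm of \<open>x\<close> lies in
  \<open>q' \<inter> R = p \<subseteq> q\<close>, so some conjugate of \<open>x\<close> lies in \<open>q\<close>, a contradiction.
\<close>

lemma sub_conj_prime:
  assumes q: "lies_over q" and q': "lies_over q'"
  shows "\<exists>g\<in>G. q' \<subseteq> conj_prime g q"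
proof (rule ccontr)
  assume no: "\<not> ?thesis"
  note q'D = lies_overD[OF q'] and qD = lies_overD[OF q]
  have "\<exists>x\<in>q'. \<forall>P\<in>(\<lambda>g. conj_prime g q) ` G. x \<notin> P"
  proof (rule S.prime_avoidance[OF q'D(3)])
    show "q' \<subseteq> S" using q'D(2) by blast
    show "finite ((\<lambda>g. conj_prime g q) ` G)" using finite_aut by simp
    show "primeideal P (L\<lparr>carrier := S\<rparr>)" if "P \<in> (\<lambda>g. conj_prime g q) ` G" for P
      using that lies_overD(1)[OF lies_over_conj_prime[OF _ q]] by blast
    show "P = P'" if "P \<in> (\<lambda>g. conj_prime g q) ` G" "P' \<in> (\<lambda>g. conj_prime g q) ` G" "P \<subseteq> P'" for P P'
      using that conj_primes_incomparable[OF q] by blast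
    show "\<not> q' \<subseteq> P" if "P \<in> (\<lambda>g. conj_prime g q) ` G" for P using that no by blast
  qed
  then obtain x where x: "x \<in> q'" "\<And>g. g \<in> G \<Longrightarrow> x \<notin> conj_prime g q" by blast
  have xS: "x \<in> S" using q'D(2)[OF x(1)] .
  have "(\<Otimes>g\<in>G. g x) \<in> q'"
  proof (rule S.finprod_in_submodule[OF q'D(3) finite_aut aut.one_closed])
    show "aut_id x \<in> q'" using x S.A_carrier[OF xS] by simp
  qed (use aut_S xS in auto)
  from qD(6)[OF q'D(7)[OF this conj_prod_in_R[OF xS]]]
  have "(\<Otimes>g\<in>G. g x) \<in> q" .
  then have "\<exists>g\<in>G. g x \<in> q"
    by (rule S.prime_finprod[OF qD(1), where f = "\<lambda>g. g x" and I = G, rotated]) (rule aut_S[OF _ xS])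
  then obtain g where g: "g \<in> G" "g x \<in> q" by (elim bexE)
  then have "x \<in> conj_prime g q" using xS by (simp add: conj_prime_def)
  then show False using x(2)[OF g(1)] by simp
qed

lemma primes_conjugate:
  assumes q: "lies_over q" and q': "lies_over q'"
  shows "\<exists>g\<in>G. q' = conj_prime g q"
proof -
  obtain g where g: "g \<in> G" "q' \<subseteq> conj_prime g q" using sub_conj_prime[OF q q'] by blast
  obtain h where h: "h \<in> G" "q \<subseteq> conj_prime h q'" using sub_conj_prime[OF q' q] by blast
  have "conj_prime g q \<subseteq> conj_prime g (conj_prime h q')" using h by (auto simp: conj_prime_def[of g])
  then have sub: "conj_prime g q \<subseteq> conj_prime (h \<star> g) q'"
    using conj_prime_mult[OF h(1) g(1)] by simp
  have "conj_prime (h \<star> g) q' = q'"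
    using stable_prime[OF aut.m_closed[OF h(1) g(1)] q'] sub g(2) by blast
  then show ?thesis using sub g by blast
qed

text \<open>
  Conjugation by \<open>g\<close> embeds the inertia group at \<open>g\<^sup>-\<^sup>1 q\<close> into the one at \<open>q\<close>.
\<close>

lemma card_inertia_le:
  assumes q: "lies_over q" and g: "g \<in> G"
  shows "card (inertia (conj_prime g q)) \<le> card (inertia q)"
proof (rule card_inj_on_le)
  let ?i = "aut_inv g"
  let ?f = "\<lambda>h. g \<star> h \<star> ?i"
  have iG: "?i \<in> G" using g by simp
  show "finite (inertia q)" using finite_aut inertiaD(1) finite_subset by (metis subsetI)
  show "inj_on ?f (inertia (conj_prime g q))"
    using g inertiaD(1) by (intro inj_onI) simp
  show "?f ` inertia (conj_prime g q) \<subseteq> inertia q"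
  proof (rule image_subsetI)
    fix h assume h: "h \<in> inertia (conj_prime g q)"
    have hG: "h \<in> G" using inertiaD(1)[OF h] .
    show "?f h \<in> inertia q"
    proof (rule inertiaI)
      show "?f h \<in> G" using g hG by simp
      fix y assume y: "y \<in> S"
      have yc: "y \<in> carrier L" using S.A_carrier[OF y] .
      have iy: "?i y \<in> S" "?i y \<in> carrier L" "h (?i y) \<in> carrier L"
        using aut_S[OF iG y] S.A_carrier aut_hom(1)[OF hG] by auto
      have "h (?i y) \<ominus> ?i y \<in> conj_prime g q" using inertiaD(2)[OF h iy(1)] .
      then have "g (h (?i y) \<ominus> ?i y) \<in> q" by (simp add: conj_prime_def)
      then have "g (h (?i y)) \<ominus> y \<in> q" using aut_hom_minus(2)[OF g iy(3,2)] g yc by simp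
      then show "?f h y \<ominus> y \<in> q" using g hG iG yc iy by simp
    qed
  qed
qed

lemma card_inertia_unique:
  assumes "lies_over q" "lies_over q'" shows "card (inertia q) = card (inertia q')"
  using card_inertia_le primes_conjugate assms by (metis le_antisym)

text \<open>
  The equivalences with all localizations and residue fields removed; the ideal \<open>J\<close> stands for \<open>p S\<close>.
\<close>

lemma tame_equivalences:
  assumes q: "lies_over q" and J: "closed_submodule S J" "p \<subseteq> J" "\<And>q'. lies_over q' \<Longrightarrow> J \<subseteq> q'"
  shows "{s \<in> S. \<forall>t\<in>S. conj_sum (s \<otimes> t) \<in> p} = {s \<in> S. \<exists>n::nat. s [^] n \<in> J}
      \<longleftrightarrow> (\<exists>s\<in>S. conj_sum s \<notin> p)" (is "?T = ?Rad \<longleftrightarrow> ?C")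
    and "(\<exists>s\<in>S. conj_sum s \<notin> p) \<longleftrightarrow> [card (inertia q)] \<cdot> \<one> \<notin> p" (is "_ \<longleftrightarrow> ?N")
proof -
  note qD = lies_overD[OF q]
  have CN: "?C \<Longrightarrow> ?N" using conj_sum_in_p_if[OF q] by blast
  have NT: "?T = ?Rad" if N: ?N
  proof (intro equalityI subsetI)
    fix s assume s: "s \<in> ?T"
    have "g s \<in> q" if g: "g \<in> G" for g
    proof (rule conj_sum_in_p_imp[OF q N])
      show gs: "g s \<in> S" using aut_S[OF g] s by blast
      fix t assume t: "t \<in> S"
      have iG: "aut_inv g \<in> G" using g by simp
      have t': "aut_inv g t \<in> S" using aut_S[OF iG t] .
      have c: "s \<in> carrier L" "t \<in> carrier L" "aut_inv g t \<in> carrier L"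
        using s t t' S.A_carrier by auto
      have "g s \<otimes> t = g (s \<otimes> aut_inv g t)"
        using aut_hom(2)[OF g c(1,3)] g c by simp
      then have "conj_sum (g s \<otimes> t) = conj_sum (s \<otimes> aut_inv g t)"
        using conj_sum_aut[OF _ g] c by simp
      then show "conj_sum (g s \<otimes> t) \<in> p" using s t' by auto
    qed
    then have "s [^] card G \<in> J" using power_in_extended_ideal[OF q _ _ J(1,2)] s by blast
    then show "s \<in> ?Rad" using s by blast
  next
    fix s assume s: "s \<in> ?Rad"
    then obtain n where n: "s \<in> S" "s [^] (n::nat) \<in> J" by blast
    have "conj_sum (s \<otimes> t) \<in> p" if t: "t \<in> S" for t
    proof -
      have "g (s \<otimes> t) \<in> q" if g: "g \<in> G" for g
      proof -
        have over: "lies_over (conj_prime g q)" using lies_over_conj_prime[OF g q] .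
        note PD = lies_overD[OF over]
        have "s \<in> conj_prime g q" using S.prime_pow[OF PD(1) n(1)] J(3)[OF over] n(2) by blast
        then have "t \<otimes> s \<in> conj_prime g q" using S.submoduleD(5)[OF PD(3) t] by blast
        then have "s \<otimes> t \<in> conj_prime g q"
          using m_comm[OF S.A_carrier[OF n(1)] S.A_carrier[OF t]] by simp
        then show ?thesis by (simp add: conj_prime_def)
      qed
      then have "conj_sum (s \<otimes> t) \<in> q"
        unfolding conj_sum_def by (rule S.submodule_finsum[OF qD(3)])
      then show ?thesis using qD(7) conj_sum_in_R n(1) t by auto
    qed
    then show "s \<in> ?T" using n by blast
  qed
  \<comment> \<open>if all traces lie in p, then 1 lies in the trace ideal, hence in the radical and in q\<close>
  have TC: ?C if T: "?T = ?Rad"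
  proof (rule ccontr)
    assume no: "\<not> ?C"
    have "\<one> \<in> ?T" using no by (auto simp: S.A_carrier)
    then obtain n where "\<one> [^] (n::nat) \<in> J" unfolding T by blast
    then have "\<one> \<in> q" using J(3)[OF q] by auto
    then show False using qD(4) by blast
  qed
  show "?T = ?Rad \<longleftrightarrow> ?C" "?C \<longleftrightarrow> ?N" using CN NT TC by blast+
qed

end

section \<open>Localization at a prime\<close>

context field
begin

lemma nonzero_inv:
  assumes "t \<in> carrier R" "t \<noteq> \<zero>"
  shows "inv t \<in> carrier R" "t \<otimes> inv t = \<one>" "inv t \<otimes> t = \<one>" "inv t \<noteq> \<zero>"
proof -
  have "t \<in> Units R" using assms by (simp add: field_Units)
  then show c: "inv t \<in> carrier R" and r: "t \<otimes> inv t = \<one>" and "inv t \<otimes> t = \<one>"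
    by (simp_all add: Units_r_inv Units_l_inv)
  show "inv t \<noteq> \<zero>" using r assms by auto
qed

lemma inv_mult_nonzero:
  assumes "t \<in> carrier R" "t \<noteq> \<zero>" "u \<in> carrier R" "u \<noteq> \<zero>"
  shows "inv (t \<otimes> u) = inv t \<otimes> inv u"
proof (rule comm_inv_char)
  note t = nonzero_inv[OF assms(1,2)] and u = nonzero_inv[OF assms(3,4)]
  have "t \<otimes> u \<otimes> (inv t \<otimes> inv u) = (t \<otimes> inv t) \<otimes> (u \<otimes> inv u)"
    using t(1) u(1) assms by (simp add: m_ac)
  then show "t \<otimes> u \<otimes> (inv t \<otimes> inv u) = \<one>" using t u by simp
qed (use nonzero_inv assms in auto)

lemma fraction_mult:
  assumes "t \<in> carrier R" "t \<noteq> \<zero>" "u \<in> carrier R" "u \<noteq> \<zero>" "m \<in> carrier R" "n \<in> carrier R"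
  shows "(m \<otimes> inv t) \<otimes> (n \<otimes> inv u) = (m \<otimes> n) \<otimes> inv (t \<otimes> u)"
  using assms nonzero_inv(1) by (simp add: inv_mult_nonzero m_ac)

lemma fraction_eq_iff:
  assumes "t \<in> carrier R" "t \<noteq> \<zero>" "x \<in> carrier R" "m \<in> carrier R"
  shows "x = m \<otimes> inv t \<longleftrightarrow> x \<otimes> t = m"
proof
  assume "x = m \<otimes> inv t"
  then show "x \<otimes> t = m" using nonzero_inv[OF assms(1,2)] assms by (simp add: m_assoc)
next
  assume "x \<otimes> t = m"
  then have "m \<otimes> inv t = x \<otimes> (t \<otimes> inv t)" using nonzero_inv[OF assms(1,2)] assms by (auto simp: m_assoc)
  then show "x = m \<otimes> inv t" using nonzero_inv[OF assms(1,2)] assms by simp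
qed

lemma fraction_add:
  assumes "t \<in> carrier R" "t \<noteq> \<zero>" "u \<in> carrier R" "u \<noteq> \<zero>" "m \<in> carrier R" "n \<in> carrier R"
  shows "(m \<otimes> inv t) \<oplus> (n \<otimes> inv u) = (m \<otimes> u \<oplus> n \<otimes> t) \<otimes> inv (t \<otimes> u)"
proof -
  note t = nonzero_inv[OF assms(1,2)] and u = nonzero_inv[OF assms(3,4)]
  have rearrange: "(m \<otimes> u \<oplus> n \<otimes> t) \<otimes> (v \<otimes> w) = (m \<otimes> v) \<otimes> (u \<otimes> w) \<oplus> (n \<otimes> w) \<otimes> (t \<otimes> v)"
    if "v \<in> carrier R" "w \<in> carrier R" for v w
    using assms that by algebra
  have "(m \<otimes> u \<oplus> n \<otimes> t) \<otimes> (inv t \<otimes> inv u) = (m \<otimes> inv t) \<otimes> (u \<otimes> inv u) \<oplus> (n \<otimes> inv u) \<otimes> (t \<otimes> inv t)"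
    using rearrange[OF t(1) u(1)] .
  then show ?thesis using assms t u by (simp add: inv_mult_nonzero)
qed

end

lemma fractions_iff: "x \<in> fractions L M T \<longleftrightarrow> (\<exists>m\<in>M. \<exists>t\<in>T. x = m \<otimes>\<^bsub>L\<^esub> inv\<^bsub>L\<^esub> t)"
  by (auto simp: fractions_def)

locale prime_of_subring = field L for L (structure) + fixes A q :: "'a set"
  assumes subring_A: "subring A L" and prime_q: "primeideal q (L\<lparr>carrier := A\<rparr>)"
begin

sublocale A: coefficient_subring L A
  by (intro coefficient_subring.intro coefficient_subring_axioms.intro domain_axioms subring_A)

lemmas qD = A.primeD[OF prime_q]
lemmas qM = A.submoduleD[OF qD(2)]

lemma denominator:
  assumes "t \<in> A - q" shows "t \<in> A" "t \<notin> q" "t \<in> carrier L" "t \<noteq> \<zero>" "inv t \<in> carrier L"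
proof -
  show "t \<in> A" "t \<notin> q" "t \<in> carrier L" "t \<noteq> \<zero>" using assms A.A_carrier qM(3) by auto
  then show "inv t \<in> carrier L" using nonzero_inv by blast
qed

lemma denominator_mult: "\<lbrakk> t \<in> A - q; u \<in> A - q \<rbrakk> \<Longrightarrow> t \<otimes> u \<in> A - q"
  using qD(4)[of t u] by auto

lemma denominator_one: "\<one> \<in> A - q"
  using qD(3) by simp

lemma fractions_carrier:
  assumes "M \<subseteq> carrier L" "x \<in> fractions L M (A - q)" shows "x \<in> carrier L"
proof -
  obtain m t where "m \<in> M" "t \<in> A - q" "x = m \<otimes> inv t" using assms(2) unfolding fractions_iff by blast
  then show ?thesis using denominator(5) assms(1) by auto
qed

lemma fractions_sub:
  assumes "M \<subseteq> carrier L" "x \<in> M" shows "x \<in> fractions L M (A - q)"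
proof -
  have "x \<in> carrier L" using assms by blast
  then have "x = x \<otimes> inv \<one>" by simp
  then show ?thesis unfolding fractions_iff using assms(2) denominator_one by blast
qed

lemma fractions_add:
  assumes N: "closed_submodule A N" and x: "x \<in> fractions L N (A - q)" and y: "y \<in> fractions L N (A - q)"
  shows "x \<oplus> y \<in> fractions L N (A - q)"
proof -
  obtain m t where m: "m \<in> N" "t \<in> A - q" "x = m \<otimes> inv t" using x unfolding fractions_iff by blast
  obtain n u where n: "n \<in> N" "u \<in> A - q" "y = n \<otimes> inv u" using y unfolding fractions_iff by blast
  note t = denominator[OF m(2)] and u = denominator[OF n(2)] and ND = A.submoduleD[OF N]
  have c: "m \<in> carrier L" "n \<in> carrier L" using m(1) n(1) ND(2) by auto
  have "u \<otimes> m \<oplus> t \<otimes> n \<in> N" using ND(4)[OF ND(5)[OF u(1) m(1)] ND(5)[OF t(1) n(1)]] .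
  then have "m \<otimes> u \<oplus> n \<otimes> t \<in> N" using c t(3) u(3) by (simp add: m_comm)
  moreover have "x \<oplus> y = (m \<otimes> u \<oplus> n \<otimes> t) \<otimes> inv (t \<otimes> u)"
    unfolding m(3) n(3) by (rule fraction_add[OF t(3,4) u(3,4) c])
  ultimately show ?thesis
    unfolding fractions_iff using denominator_mult[OF m(2) n(2)] by blast
qed

lemma fractions_mult:
  assumes N: "closed_submodule A N" and x: "x \<in> localization_at L A q" and y: "y \<in> fractions L N (A - q)"
  shows "x \<otimes> y \<in> fractions L N (A - q)"
proof -
  obtain m t where m: "m \<in> A" "t \<in> A - q" "x = m \<otimes> inv t" using x unfolding localization_at_def fractions_iff by blast
  obtain n u where n: "n \<in> N" "u \<in> A - q" "y = n \<otimes> inv u" using y unfolding fractions_iff by blast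
  note t = denominator[OF m(2)] and u = denominator[OF n(2)] and ND = A.submoduleD[OF N]
  have "x \<otimes> y = (m \<otimes> n) \<otimes> inv (t \<otimes> u)"
    unfolding m(3) n(3) by (rule fraction_mult[OF t(3,4) u(3,4) A.A_carrier[OF m(1)] ND(2)[OF n(1)]])
  then show ?thesis
    unfolding fractions_iff using denominator_mult[OF m(2) n(2)] ND(5)[OF m(1) n(1)] by blast
qed

lemma submodule_A: "closed_submodule A A"
  by (auto simp: closed_submodule_def A.A_carrier)

lemma subring_localization: "subring (localization_at L A q) L"
proof (rule subringI)
  have Ac: "A \<subseteq> carrier L" using A.A_carrier by blast
  show sub: "localization_at L A q \<subseteq> carrier L"
    using fractions_carrier[OF Ac] by (auto simp: localization_at_def)
  have in_loc: "a \<in> localization_at L A q" if "a \<in> A" for a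
    using fractions_sub[OF Ac that] by (simp add: localization_at_def)
  show "\<one> \<in> localization_at L A q" using in_loc by simp
  show mult: "x \<otimes> y \<in> localization_at L A q" if "x \<in> localization_at L A q" "y \<in> localization_at L A q" for x y
    using fractions_mult[OF submodule_A] that by (simp add: localization_at_def)
  show "x \<oplus> y \<in> localization_at L A q" if "x \<in> localization_at L A q" "y \<in> localization_at L A q" for x y
    using fractions_add[OF submodule_A] that by (simp add: localization_at_def)
  show "\<ominus> x \<in> localization_at L A q" if x: "x \<in> localization_at L A q" for x
    using mult[OF in_loc[of "\<ominus> \<one>"] x] x sub by (auto simp: l_minus)
qed

sublocale loc: coefficient_subring L "localization_at L A q"
  by (intro coefficient_subring.intro coefficient_subring_axioms.intro domain_axioms subring_localization)

lemma localized_prime_ideal: "ideal (fractions L q (A - q)) (L\<lparr>carrier := localization_at L A q\<rparr>)"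
proof -
  have "closed_submodule (localization_at L A q) (fractions L q (A - q))"
    unfolding closed_submodule_def
    using fractions_carrier[OF qM(1)] fractions_sub[OF qM(1) qM(3)] fractions_add[OF qD(2)] fractions_mult[OF qD(2)]
    by blast
  moreover have "fractions L q (A - q) \<subseteq> localization_at L A q"
    using qD(1) unfolding localization_at_def fractions_def by blast
  ultimately show ?thesis unfolding loc.ideal_iff_submodule by blast
qed

lemma A_in_localization: "a \<in> A \<Longrightarrow> a \<in> localization_at L A q"
  using fractions_sub[of A a] A.A_carrier by (auto simp: localization_at_def)

lemma localized_prime_inter:
  assumes a: "a \<in> A" shows "a \<in> fractions L q (A - q) \<longleftrightarrow> a \<in> q"
proof
  assume "a \<in> fractions L q (A - q)"
  then obtain m t where m: "m \<in> q" "t \<in> A - q" "a = m \<otimes> inv t" unfolding fractions_iff by blast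
  note t = denominator[OF m(2)]
  have "a \<otimes> t = m" using fraction_eq_iff[OF t(3,4) A.A_carrier[OF a] qM(2)[OF m(1)]] m(3) by blast
  then show "a \<in> q" using qD(4)[OF a t(1)] m(1) t(2) by blast
qed (rule fractions_sub[OF qM(1)])

lemma coset_eq_zero_iff:
  assumes a: "a \<in> localization_at L A q"
  shows "fractions L q (A - q) +>\<^bsub>L\<lparr>carrier := localization_at L A q\<rparr>\<^esub> a = \<zero>\<^bsub>residue_field L A q\<^esub>
    \<longleftrightarrow> a \<in> fractions L q (A - q)"
proof -
  interpret I: ideal "fractions L q (A - q)" "L\<lparr>carrier := localization_at L A q\<rparr>" by (rule localized_prime_ideal)
  have "\<zero>\<^bsub>residue_field L A q\<^esub> = fractions L q (A - q)" by (simp add: residue_field_def FactRing_def)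
  then show ?thesis using I.rcos_const_imp_mem[of a] I.a_rcos_zero[OF I.is_ideal, of a] a by auto
qed

text \<open>
  The characteristic is an additive order, so it divides \<open>n\<close> exactly when the \<open>n\<close>-fold sum of the unit coset
  is zero, and an element of \<open>A\<close> vanishes in the residue field exactly when it lies in \<open>q\<close>.
\<close>

lemma characteristic_dvd_iff:
  "ring_characteristic (residue_field L A q) dvd n \<longleftrightarrow> [n] \<cdot> \<one> \<in> q" for n :: nat
proof -
  let ?Lo = "L\<lparr>carrier := localization_at L A q\<rparr>" and ?I = "fractions L q (A - q)"
  let ?k = "residue_field L A q"
  interpret I: ideal ?I ?Lo by (rule localized_prime_ideal)
  interpret k: ring ?k unfolding residue_field_def by (rule I.quotient_is_ring)
  have pow: "\<one>\<^bsub>?k\<^esub> [^]\<^bsub>add_monoid ?k\<^esub> n = ?I +>\<^bsub>?Lo\<^esub> ([n] \<cdot> \<one>)" for n :: nat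
  proof (induction n)
    case 0
    have "?I +>\<^bsub>?Lo\<^esub> \<zero> = \<zero>\<^bsub>?k\<^esub>" using coset_eq_zero_iff[of \<zero>] fractions_sub[OF qM(1,3)] by simp
    then show ?case by (simp add: add_pow_def)
  next
    case (Suc n)
    have "\<one>\<^bsub>?k\<^esub> [^]\<^bsub>add_monoid ?k\<^esub> Suc n = (?I +>\<^bsub>?Lo\<^esub> ([n] \<cdot> \<one>)) \<oplus>\<^bsub>?k\<^esub> (?I +>\<^bsub>?Lo\<^esub> \<one>)"
      using Suc by (simp add: residue_field_def FactRing_def)
    also have "\<dots> = ?I +>\<^bsub>?Lo\<^esub> ([n] \<cdot> \<one> \<oplus> \<one>)"
      using I.a_rcos_sum[of "[n] \<cdot> \<one>" \<one>] by (simp add: residue_field_def FactRing_def)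
    finally show ?case by (simp add: add_pow_def)
  qed
  have "\<one>\<^bsub>?k\<^esub> [^]\<^bsub>add_monoid ?k\<^esub> n = \<one>\<^bsub>add_monoid ?k\<^esub> \<longleftrightarrow> ring_characteristic ?k dvd n"
    unfolding ring_characteristic_def by (rule group.pow_eq_id[OF k.a_group]) simp
  moreover have "\<one>\<^bsub>?k\<^esub> [^]\<^bsub>add_monoid ?k\<^esub> n = \<one>\<^bsub>add_monoid ?k\<^esub> \<longleftrightarrow> [n] \<cdot> \<one> \<in> q"
    unfolding pow using coset_eq_zero_iff[of "[n] \<cdot> \<one>"] localized_prime_inter[of "[n] \<cdot> \<one>"] by simp
  ultimately show ?thesis by blast
qed

end

section \<open>The three notions of tameness\<close>

context galois_normal_subring
begin

lemma prime_of_subring_p: "prime_of_subring L R p"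
  by (intro prime_of_subring.intro prime_of_subring_axioms.intro field_axioms subring_R prime_p)

lemma prime_of_subring_over: "lies_over q \<Longrightarrow> prime_of_subring L S q"
  by (intro prime_of_subring.intro prime_of_subring_axioms.intro field_axioms subring_S lies_overD(1))

lemma tamely_ramified_iff:
  defines "J \<equiv> genideal (L\<lparr>carrier := S\<rparr>) p"
  shows "tamely_ramified L K S p \<longleftrightarrow>
    {s \<in> S. \<forall>t\<in>S. conj_sum (s \<otimes> t) \<in> p} = {s \<in> S. \<exists>n::nat. s [^] n \<in> J}"
proof -
  have "field_trace L K (s \<otimes> t) = conj_sum (s \<otimes> t)" if "s \<in> S" "t \<in> S" for s t
    using that S.A_carrier by (simp add: field_trace_eq_conj_sum)
  then have "trace_ideal L K S p = {s \<in> S. \<forall>t\<in>S. conj_sum (s \<otimes> t) \<in> p}"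
    by (auto simp: trace_ideal_def)
  moreover have "radical_of (L\<lparr>carrier := S\<rparr>) J = {s \<in> S. \<exists>n::nat. s [^] n \<in> J}"
    by (simp add: radical_of_def flip: nat_pow_consistent)
  ultimately show ?thesis by (simp add: tamely_ramified_def J_def)
qed

lemma extended_ideal:
  shows "closed_submodule S (genideal (L\<lparr>carrier := S\<rparr>) p)" "p \<subseteq> genideal (L\<lparr>carrier := S\<rparr>) p"
    "lies_over q \<Longrightarrow> genideal (L\<lparr>carrier := S\<rparr>) p \<subseteq> q"
proof -
  interpret SR: cring "L\<lparr>carrier := S\<rparr>" by (rule S.ring_A)
  have pS: "p \<subseteq> carrier (L\<lparr>carrier := S\<rparr>)" using p_R R_S by auto
  show "closed_submodule S (genideal (L\<lparr>carrier := S\<rparr>) p)"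
    using SR.genideal_ideal[OF pS] unfolding S.ideal_iff_submodule by blast
  show "p \<subseteq> genideal (L\<lparr>carrier := S\<rparr>) p" by (rule SR.genideal_self[OF pS])
  assume q: "lies_over q"
  have "ideal q (L\<lparr>carrier := S\<rparr>)"
    using lies_overD(2,3)[OF q] unfolding S.ideal_iff_submodule by blast
  then show "genideal (L\<lparr>carrier := S\<rparr>) p \<subseteq> q"
    by (rule SR.genideal_minimal) (use lies_overD(6)[OF q] in blast)
qed

text \<open>
  Denominators come from \<open>K\<close>, so the localized trace is the sum of conjugates itself.  Its image is an
  \<open>R\<^sub>p\<close>-submodule of \<open>R\<^sub>p\<close>; it contains \<open>1\<close> exactly when some trace from \<open>S\<close> is a denominator.
\<close>

lemma cohomologically_tamely_ramified_iff:
  "cohomologically_tamely_ramified L K R S p \<longleftrightarrow> (\<exists>s\<in>S. conj_sum s \<notin> p)"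
proof -
  interpret P: prime_of_subring L R p by (rule prime_of_subring_p)
  have frac: "conj_sum (m \<otimes> inv t) = conj_sum m \<otimes> inv t" if m: "m \<in> S" and t: "t \<in> R - p" for m t
  proof -
    note td = P.denominator[OF t]
    have "inv t \<in> K" using subfield_m_inv(1)[OF subfield_K, of t] R_K[OF td(1)] td(4) by blast
    then have "conj_sum (inv t \<otimes> m) = inv t \<otimes> conj_sum m"
      using conj_sum_scale S.A_carrier[OF m] by blast
    then show ?thesis using td(5) S.A_carrier[OF m] conj_sum_closed by (simp add: m_comm)
  qed
  have local_trace: "localized_map L S (R - p) (field_trace L K) x = conj_sum x"
    if x: "x \<in> fractions L S (R - p)" for x
    unfolding localized_map_def
  proof (rule the_equality)
    obtain m t where mt: "m \<in> S" "t \<in> R - p" "x = m \<otimes> inv t" using x unfolding fractions_iff by blast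
    have "conj_sum x = field_trace L K m \<otimes> inv t"
      using frac[OF mt(1,2)] mt(3) field_trace_eq_conj_sum[OF S.A_carrier[OF mt(1)]] by simp
    then show "\<exists>m\<in>S. \<exists>t\<in>R - p. x = m \<otimes> inv t \<and> conj_sum x = field_trace L K m \<otimes> inv t"
      using mt by blast
  next
    fix y assume "\<exists>m\<in>S. \<exists>t\<in>R - p. x = m \<otimes> inv t \<and> y = field_trace L K m \<otimes> inv t"
    then obtain m t where mt: "m \<in> S" "t \<in> R - p" "x = m \<otimes> inv t" "y = field_trace L K m \<otimes> inv t" by blast
    then show "y = conj_sum x" using frac field_trace_eq_conj_sum S.A_carrier by simp
  qed
  have image: "localized_map L S (R - p) (field_trace L K) ` fractions L S (R - p) = conj_sum ` fractions L S (R - p)"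
    using local_trace by (intro image_cong) auto
  show ?thesis
    unfolding cohomologically_tamely_ramified_def image
  proof
    assume eq: "conj_sum ` fractions L S (R - p) = localization_at L R p"
    have "\<one> \<in> localization_at L R p" using P.loc.A_simps(2) .
    then obtain x where x: "x \<in> fractions L S (R - p)" "\<one> = conj_sum x" unfolding eq[symmetric] by (elim imageE)
    then obtain m t where mt: "m \<in> S" "t \<in> R - p" "x = m \<otimes> inv t" unfolding fractions_iff by blast
    note t = P.denominator[OF mt(2)]
    have "\<one> = conj_sum m \<otimes> inv t" using x(2) frac[OF mt(1,2)] mt(3) by simp
    then have "conj_sum m = t"
      using fraction_eq_iff[OF t(3,4) one_closed conj_sum_closed[OF S.A_carrier[OF mt(1)]]] t(3) by simp
    then show "\<exists>s\<in>S. conj_sum s \<notin> p" using mt(1) t(2) by blast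
  next
    assume "\<exists>s\<in>S. conj_sum s \<notin> p"
    then obtain s where s: "s \<in> S" "conj_sum s \<notin> p" by blast
    have u: "conj_sum s \<in> R - p" using s conj_sum_in_R by blast
    note ud = P.denominator[OF u]
    show "conj_sum ` fractions L S (R - p) = localization_at L R p"
    proof (intro equalityI subsetI)
      fix y assume "y \<in> conj_sum ` fractions L S (R - p)"
      then obtain m t where mt: "m \<in> S" "t \<in> R - p" "y = conj_sum (m \<otimes> inv t)" unfolding fractions_def by blast
      have "y = conj_sum m \<otimes> inv t" using mt(3) frac[OF mt(1,2)] by simp
      then show "y \<in> localization_at L R p"
        using conj_sum_in_R[OF mt(1)] mt(2) unfolding localization_at_def fractions_iff by blast
    next
      fix y assume "y \<in> localization_at L R p"
      then obtain r t where rt: "r \<in> R" "t \<in> R - p" "y = r \<otimes> inv t"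
        unfolding localization_at_def fractions_iff by blast
      note td = P.denominator[OF rt(2)]
      have rc: "r \<in> carrier L" using R.A_carrier[OF rt(1)] .
      have "conj_sum ((r \<otimes> s) \<otimes> inv (t \<otimes> conj_sum s)) = conj_sum (r \<otimes> s) \<otimes> inv (t \<otimes> conj_sum s)"
        using R_S[OF rt(1)] s(1) by (intro frac P.denominator_mult[OF rt(2) u]) simp
      also have "\<dots> = (r \<otimes> conj_sum s) \<otimes> inv (t \<otimes> conj_sum s)"
        using conj_sum_scale[OF R_K[OF rt(1)] S.A_carrier[OF s(1)]] by simp
      also have "\<dots> = (r \<otimes> inv t) \<otimes> (conj_sum s \<otimes> inv (conj_sum s))"
        using fraction_mult[OF td(3,4) ud(3,4) rc ud(3)] by simp
      also have "\<dots> = y" using rt(3) rc td(5) nonzero_inv(2)[OF ud(3,4)] by simp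
      finally have "y = conj_sum ((r \<otimes> s) \<otimes> inv (t \<otimes> conj_sum s))" ..
      moreover have "(r \<otimes> s) \<otimes> inv (t \<otimes> conj_sum s) \<in> fractions L S (R - p)"
        unfolding fractions_iff using P.denominator_mult[OF rt(2) u] R_S[OF rt(1)] s(1)
        by (intro bexI[of _ "r \<otimes> s"] bexI[of _ "t \<otimes> conj_sum s"]) auto
      ultimately show "y \<in> conj_sum ` fractions L S (R - p)" by blast
    qed
  qed
qed

lemma fractions_prime_iff_over:
  assumes q: "lies_over q" shows "a \<in> S \<Longrightarrow> a \<in> fractions L q (S - q) \<longleftrightarrow> a \<in> q"
  using prime_of_subring.localized_prime_inter[OF prime_of_subring_over[OF q]] .

lemma aut_inv_nonzero:
  assumes "g \<in> G" "t \<in> carrier L" "t \<noteq> \<zero>" shows "g (inv t) = inv (g t)"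
proof -
  have "g t \<otimes> g (inv t) = \<one>"
    using aut_hom(2)[OF assms(1,2) nonzero_inv(1)[OF assms(2,3)]] nonzero_inv(2)[OF assms(2,3)]
      aut_hom(4)[OF assms(1)] by simp
  then show ?thesis
    using comm_inv_char aut_hom(1)[OF assms(1)] assms nonzero_inv(1) by metis
qed

lemma inertia_maps_prime:
  assumes q: "lies_over q" and g: "g \<in> inertia q" and x: "x \<in> q" shows "g x \<in> q"
proof -
  note M = S.submoduleD[OF lies_overD(3)[OF q]]
  have "g x \<ominus> x \<in> q" using inertiaD(2)[OF g lies_overD(2)[OF q x]] .
  from M(4)[OF this x] show ?thesis
    using minus_add_cancel[OF aut_hom(1)[OF inertiaD(1)[OF g] M(2)[OF x]] M(2)[OF x]] by simp
qed

lemma inertia_inv: "\<lbrakk> lies_over q; g \<in> inertia q \<rbrakk> \<Longrightarrow> aut_inv g \<in> inertia q"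
  using subgroup.m_inv_closed[OF inertia_subgroup[OF lies_overD(3)]] .

lemma inertia_maps_denominator:
  assumes q: "lies_over q" and g: "g \<in> inertia q" and t: "t \<in> S - q" shows "g t \<in> S - q"
proof -
  have "g t \<in> S" using aut_S[OF inertiaD(1)[OF g]] t by blast
  moreover have "g t \<notin> q"
  proof
    assume "g t \<in> q"
    then have "aut_inv g (g t) \<in> q" by (rule inertia_maps_prime[OF q inertia_inv[OF q g]])
    then show False using t aut_apply(3)[OF inertiaD(1)[OF g] S.A_carrier] by auto
  qed
  ultimately show ?thesis by blast
qed

text \<open>
  For \<open>x = m / t\<close> the difference \<open>g x - x\<close> has numerator \<open>t (g m - m) - m (g t - t)\<close>, which lies in \<open>q\<close>.
\<close>

lemma inertia_fixes_residues:
  assumes q: "lies_over q" and g: "g \<in> inertia q"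
    and x: "x \<in> localization_at L S q" and i: "i \<in> fractions L q (S - q)"
  shows "\<exists>j\<in>fractions L q (S - q). g (i \<oplus> x) = j \<oplus> x"
proof -
  interpret Q: prime_of_subring L S q by (rule prime_of_subring_over[OF q])
  have gG: "g \<in> G" using inertiaD(1)[OF g] .
  let ?Q = "fractions L q (S - q)"
  obtain a u where a: "a \<in> q" "u \<in> S - q" "i = a \<otimes> inv u" using i unfolding fractions_iff by blast
  obtain m t where m: "m \<in> S" "t \<in> S - q" "x = m \<otimes> inv t"
    using x unfolding localization_at_def fractions_iff by blast
  note ud = Q.denominator[OF a(2)] and td = Q.denominator[OF m(2)]
  have gt: "g t \<in> S - q" and gu: "g u \<in> S - q" using inertia_maps_denominator[OF q g] a(2) m(2) by auto
  note gtd = Q.denominator[OF gt]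
  have c: "i \<in> carrier L" "x \<in> carrier L" "a \<in> carrier L" "m \<in> carrier L" "g m \<in> carrier L"
    using a(3) ud m(3) td Q.qM(2)[OF a(1)] S.A_carrier[OF m(1)] aut_hom(1)[OF gG] by auto
  have "g i = g a \<otimes> inv (g u)"
    unfolding a(3) using aut_hom(2)[OF gG c(3) ud(5)] aut_inv_nonzero[OF gG ud(3,4)] by simp
  then have gi: "g i \<in> ?Q"
    unfolding fractions_iff using inertia_maps_prime[OF q g a(1)] gu by blast
  have gx: "g x = g m \<otimes> inv (g t)"
    unfolding m(3) using aut_hom(2)[OF gG c(4) td(5)] aut_inv_nonzero[OF gG td(3,4)] by simp
  \<comment> \<open>n is the numerator of g x - x over the denominator g t t\<close>
  define n where "n = t \<otimes> (g m \<ominus> m) \<oplus> (\<ominus> m) \<otimes> (g t \<ominus> t)"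
  have nq: "n \<in> q" unfolding n_def
    using m(1) td(1) by (intro Q.qM(4) Q.qM(5) inertiaD(2)[OF g]) auto
  have "g x \<ominus> x = n \<otimes> inv (g t \<otimes> t)"
  proof -
    have "g x \<ominus> x = g m \<otimes> inv (g t) \<oplus> (\<ominus> m) \<otimes> inv t"
    proof -
      have "g x \<ominus> x = (g m \<otimes> inv (g t)) \<ominus> (m \<otimes> inv t)"
        by (rule arg_cong2[OF gx m(3), where f = "\<lambda>a b. a \<ominus> b"])
      then show ?thesis using c(4) td(5) by (simp add: a_minus_def l_minus)
    qed
    also have "\<dots> = (g m \<otimes> t \<oplus> (\<ominus> m) \<otimes> g t) \<otimes> inv (g t \<otimes> t)"
      using c by (intro fraction_add gtd td) auto
    also have "g m \<otimes> t \<oplus> (\<ominus> m) \<otimes> g t = n"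
      unfolding n_def using c(4,5) td(3) gtd(3) by algebra
    finally show ?thesis .
  qed
  then have diff: "g x \<ominus> x \<in> ?Q"
    unfolding fractions_iff using nq Q.denominator_mult[OF gt m(2)] by blast
  have gc: "g i \<in> carrier L" "g x \<in> carrier L" using aut_hom(1)[OF gG] c by auto
  have "g (i \<oplus> x) = g i \<oplus> g x" using aut_hom(3)[OF gG c(1,2)] .
  also have "\<dots> = (g i \<oplus> (g x \<ominus> x)) \<oplus> x" using gc c(2) by algebra
  finally show ?thesis using Q.fractions_add[OF Q.qD(2) gi diff] by blast
qed

text \<open>
  Acting trivially on \<open>S/q\<close> and on its fraction field \<open>\<kappa>(q)\<close> is the same: an element of \<open>S\<close> whose coset is fixed
  moves by an element of \<open>q S\<^sub>q \<inter> S = q\<close>, and the converse is \<open>inertia_fixes_residues\<close>.  For the converse one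
  also needs that inertia maps \<open>q\<close> onto itself, so that it lies in the decomposition group.
\<close>

lemma inertia_group_eq:
  assumes q: "lies_over q" shows "inertia_group L K R S p q = inertia q"
proof -
  interpret Q: prime_of_subring L S q by (rule prime_of_subring_over[OF q])
  let ?Q = "fractions L q (S - q)" and ?k = "residue_field L S q" and ?Lo = "L\<lparr>carrier := localization_at L S q\<rparr>"
  note qM = S.submoduleD[OF lies_overD(3)[OF q]]
  have coset: "?Q +>\<^bsub>?Lo\<^esub> x = {i \<oplus> x | i. i \<in> ?Q}" for x
    by (auto simp: a_r_coset_def')
  have carr: "carrier ?k = {?Q +>\<^bsub>?Lo\<^esub> x | x. x \<in> localization_at L S q}"
    by (auto simp: residue_field_def FactRing_def A_RCOSETS_def')
  have kernel: "g \<in> inertia_group L K R S p q \<longleftrightarrow> g \<in> G \<and> g ` q = q \<and> (\<forall>C\<in>carrier ?k. g ` C = C)" for g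
  proof -
    have "residue_action L S q g = \<one>\<^bsub>aut_group ?k (residue_base_field L R S p q)\<^esub>
        \<longleftrightarrow> (\<forall>C\<in>carrier ?k. g ` C = C)"
      unfolding residue_action_def by (auto simp: aut_group_def BijGroup_def fun_eq_iff restrict_def)
    then show ?thesis
      by (auto simp: inertia_group_def kernel_def decomposition_group_def)
  qed
  show ?thesis
  proof (intro equalityI subsetI)
    fix g assume "g \<in> inertia_group L K R S p q"
    then have g: "g \<in> G" "\<And>C. C \<in> carrier ?k \<Longrightarrow> g ` C = C" unfolding kernel by blast+
    show "g \<in> inertia q"
    proof (rule inertiaI[OF g(1)])
      fix y assume y: "y \<in> S"
      have yc: "y \<in> carrier L" using S.A_carrier[OF y] .
      have "?Q +>\<^bsub>?Lo\<^esub> y \<in> carrier ?k" unfolding carr using Q.A_in_localization[OF y] by blast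
      then have fix_y: "g ` (?Q +>\<^bsub>?Lo\<^esub> y) = ?Q +>\<^bsub>?Lo\<^esub> y" by (rule g(2))
      have "\<zero> \<oplus> y \<in> ?Q +>\<^bsub>?Lo\<^esub> y" unfolding coset using Q.fractions_sub[OF Q.qM(1,3)] by blast
      then have "y \<in> ?Q +>\<^bsub>?Lo\<^esub> y" using yc by simp
      then have "g y \<in> ?Q +>\<^bsub>?Lo\<^esub> y" using fix_y by blast
      then obtain i where i: "i \<in> ?Q" "g y = i \<oplus> y" unfolding coset by blast
      have ic: "i \<in> carrier L" using Q.fractions_carrier[OF Q.qM(1) i(1)] .
      have eq: "g y \<ominus> y = i" unfolding i(2) by (rule add_minus_cancel_right[OF ic yc])
      have "i \<in> S" unfolding eq[symmetric] using aut_S[OF g(1) y] y by simp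
      then have "i \<in> q" using fractions_prime_iff_over[OF q] i(1) by blast
      then show "g y \<ominus> y \<in> q" using eq by simp
    qed
  next
    fix g assume g: "g \<in> inertia q"
    let ?h = "aut_inv g"
    have gG: "g \<in> G" using inertiaD(1)[OF g] .
    have h: "?h \<in> inertia q" using inertia_inv[OF q g] .
    have img: "g ` C = C" if closed: "\<And>x. x \<in> C \<Longrightarrow> g x \<in> C" "\<And>x. x \<in> C \<Longrightarrow> ?h x \<in> C" "C \<subseteq> carrier L" for C
    proof (intro equalityI subsetI)
      fix x assume x: "x \<in> C"
      have "x = g (?h x)" using aut_apply(4)[OF gG] x closed(3) by auto
      then show "x \<in> g ` C" using closed(2)[OF x] by (rule image_eqI)
    qed (use closed(1) in blast)
    have "g ` q = q"
      using inertia_maps_prime[OF q g] inertia_maps_prime[OF q h] qM(1) by (rule img)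
    moreover have "g ` C = C" if C: "C \<in> carrier ?k" for C
    proof -
      obtain x where x: "x \<in> localization_at L S q" "C = ?Q +>\<^bsub>?Lo\<^esub> x" using C unfolding carr by blast
      have closed: "k z \<in> C" if k: "k \<in> inertia q" and z: "z \<in> C" for k z
      proof -
        obtain i where i: "i \<in> ?Q" "z = i \<oplus> x" using z unfolding x(2) coset by blast
        obtain j where "j \<in> ?Q" "k (i \<oplus> x) = j \<oplus> x" using inertia_fixes_residues[OF q k x(1) i(1)] by blast
        then show ?thesis unfolding i(2) x(2) coset by blast
      qed
      have "C \<subseteq> carrier L"
        using Q.fractions_carrier[OF Q.qM(1)] Q.loc.A_carrier[OF x(1)] unfolding x(2) coset by auto
      with closed[OF g] closed[OF h] show ?thesis by (rule img)
    qed
    ultimately show "g \<in> inertia_group L K R S p q" unfolding kernel using gG by blast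
  qed
qed

lemma ramification_index_eq:
  assumes q: "lies_over q" shows "ramification_index L K R S p = card (inertia q)"
proof -
  have over: "q' \<in> primes_over L R S p \<longleftrightarrow> lies_over q'" for q'
    by (auto simp: primes_over_def lies_over_def)
  show ?thesis
    unfolding ramification_index_def
  proof (rule the_equality)
    show "\<exists>q'\<in>primes_over L R S p. card (inertia q) = card (inertia_group L K R S p q')"
      using over q inertia_group_eq[OF q] by (intro bexI[of _ q]) auto
    fix e assume "\<exists>q'\<in>primes_over L R S p. e = card (inertia_group L K R S p q')"
    then obtain q' where q': "lies_over q'" "e = card (inertia_group L K R S p q')" using over by blast
    then show "e = card (inertia q)" using inertia_group_eq card_inertia_unique[OF q] by simp
  qed
qed

lemma numerically_tamely_ramified_iff:
  assumes q: "lies_over q"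
  shows "numerically_tamely_ramified L K R S p \<longleftrightarrow> [card (inertia q)] \<cdot> \<one> \<notin> p"
  unfolding numerically_tamely_ramified_def ramification_index_eq[OF q]
  using prime_of_subring.characteristic_dvd_iff[OF prime_of_subring_p] by blast

lemma tame_ramification_equivalences:
  "tamely_ramified L K S p \<longleftrightarrow> cohomologically_tamely_ramified L K R S p"
  "cohomologically_tamely_ramified L K R S p \<longleftrightarrow> numerically_tamely_ramified L K R S p"
proof -
  obtain q where q: "lies_over q" using ex_lies_over by blast
  note equiv = tame_equivalences[OF q extended_ideal]
  show "tamely_ramified L K S p \<longleftrightarrow> cohomologically_tamely_ramified L K R S p"
    unfolding tamely_ramified_iff cohomologically_tamely_ramified_iff using equiv(1) .
  show "cohomologically_tamely_ramified L K R S p \<longleftrightarrow> numerically_tamely_ramified L K R S p"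
    unfolding cohomologically_tamely_ramified_iff numerically_tamely_ramified_iff[OF q] using equiv(2) .
qed

end

theorem proposition3p44:
  fixes L :: "('a, 'm) ring_scheme" and R K S p :: "'a set"
  assumes "finite_galois_extension L K"
    and "subring R L"
    and "noetherian_domain (L\<lparr>carrier := R\<rparr>)"
    and "K = fraction_field L R"
    and "integral_closure_in L R K = R"
    and "S = integral_closure_in L R (carrier L)"
    and "primeideal p (L\<lparr>carrier := R\<rparr>)"
  shows "(tamely_ramified L K S p \<longleftrightarrow> cohomologically_tamely_ramified L K R S p) \<and>
         (cohomologically_tamely_ramified L K R S p \<longleftrightarrow> numerically_tamely_ramified L K R S p)"
proof -
  interpret gal: galois_extension L K
    using assms(1) by (intro galois_extension.intro galois_extension_axioms.intro)
      (auto simp: finite_galois_extension_def)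
  interpret int: noetherian_coefficients L R
    using assms(2,3) by (intro noetherian_coefficients.intro coefficient_subring.intro
      coefficient_subring_axioms.intro noetherian_coefficients_axioms.intro gal.domain_axioms)
      (auto simp: noetherian_domain_def)
  have RK: "R \<subseteq> K" using assms(5) by (auto simp: integral_closure_in_def)
  have "galois_normal_subring L K R S p"
  proof (intro galois_normal_subring.intro galois_normal_subring_axioms.intro gal.galois_extension_axioms)
    show "subring S L" using int.integral_closure_subring assms(6) by simp
    have "S \<inter> K = integral_closure_in L R K"
      using gal.K_carrier unfolding assms(6) integral_closure_in_def by auto
    then show "R = S \<inter> K" using assms(5) by simp
    show "g x \<in> S" if g: "g \<in> carrier (aut_group L K)" and x: "x \<in> S" for g x
    proof -
      have "g \<in> ring_hom L L" using g gal.aut_iff by blast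
      moreover have "g a = a" if "a \<in> R" for a using gal.aut_hom(5)[OF g] RK that by blast
      moreover have "x \<in> carrier L" "integral_over L R x"
        using x unfolding assms(6) integral_closure_in_def by auto
      ultimately show ?thesis
        using int.integral_hom_image gal.aut_hom(1)[OF g] unfolding assms(6) integral_closure_in_def by blast
    qed
    show "primeideal p (L\<lparr>carrier := R\<rparr>)" by fact
  qed
  then show ?thesis
    using galois_normal_subring.tame_ramification_equivalences by blast
qed

end
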